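(* Let $\Bbbk$ be a commutative ring and let $M$ be an $\mathrm{FI}$-module over $\Bbbk$ that is polynomial of degree $d$ starting at $m \geq 0$. For each $k \geq 0$, the map \[\mathrm{H}_k(\mathfrak{S}_n; M(\overline{n})) \to \mathrm{H}_k(\mathfrak{S}_{n+1}; M(\overline{n+1}))\] is an isomorphism for $n \geq \max(m,2k+2d+2)$ and a surjection for $n \geq \max(m,2k+2d)$.
   Context: $\mathrm{FI}$ is the category of finite sets and injections; an $\mathrm{FI}$-module over $\Bbbk$ is a functor from $\mathrm{FI}$ to $\Bbbk$-modules. Write $\overline{n}=\{1,\dots,n\}$; $\mathfrak{S}_n$ acts on $M(\overline{n})$ via automorphisms of $\overline n$. The map in question is induced by the inclusion $\mathfrak S_n\subset \mathfrak S_{n+1}$ and by $M(\overline n)\to M(\overline{n+1})$ induced by the inclusion $\overline n\hookrightarrow\overline{n+1}$. For a finite set $S$ let $S\sqcup\{\ast\}$ be $S$ with one new element (functorially). The derived module $DM$ is the $\mathrm{FI}$-module $DM(S)=M(S\sqcup\{\ast\})/\mathrm{Im}(M(S)\to M(S\sqcup\{\ast\}))$. $M$ is polynomial of degree $d\ge -1$ starting at $m\in\mathbb Z$ if: for $d=-1$, $M(S)=0$ whenever $|S|\ge m$; for $d\ge 0$, (i) for every injection $f\colon S\to T$ with $|S|\ge m$ the map $f_*\colon M(S)\to M(T)$ is injective, and (ii) $DM$ is polynomial of degree $d-1$ starting at $m-1$. *)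

theory Defs
  imports Complex_Main "HOL-Combinatorics.Permutations"
begin

section \<open>FI-modules\<close>

text \<open>The category FI is modelled by its full subcategory of finite sets of natural numbers
(equivalent to FI).  A morphism S -> T is a function f with inj_on f S and f ` S <= T,
identified with its restriction to S.  An FI-module over the commutative ring 'k is given
by submodules V S of a fixed 'k-module 'b (with scalar multiplication scale) and linear maps
act S T f : V S -> V T, functorial in f.\<close>

definition FI_mor :: "nat set \<Rightarrow> nat set \<Rightarrow> (nat \<Rightarrow> nat) \<Rightarrow> bool" where
  "FI_mor S T f \<longleftrightarrow> finite S \<and> finite T \<and> inj_on f S \<and> f ` S \<subseteq> T"

definition fi_module ::
  "('k::comm_ring_1 \<Rightarrow> 'b::ab_group_add \<Rightarrow> 'b) \<Rightarrow> (nat set \<Rightarrow> 'b set)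
     \<Rightarrow> (nat set \<Rightarrow> nat set \<Rightarrow> (nat \<Rightarrow> nat) \<Rightarrow> 'b \<Rightarrow> 'b) \<Rightarrow> bool" where
  "fi_module scale V act \<longleftrightarrow>
     module scale \<and>
     (\<forall>S. finite S \<longrightarrow> 0 \<in> V S \<and> (\<forall>x\<in>V S. \<forall>y\<in>V S. x + y \<in> V S)
                       \<and> (\<forall>c. \<forall>x\<in>V S. scale c x \<in> V S)) \<and>
     (\<forall>S T f. FI_mor S T f \<longrightarrow>
        (\<forall>x\<in>V S. act S T f x \<in> V T) \<and>
        (\<forall>x\<in>V S. \<forall>y\<in>V S. act S T f (x + y) = act S T f x + act S T f y) \<and>
        (\<forall>c. \<forall>x\<in>V S. act S T f (scale c x) = scale c (act S T f x)) \<and>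
        (\<forall>g. (\<forall>s\<in>S. f s = g s) \<longrightarrow> (\<forall>x\<in>V S. act S T f x = act S T g x))) \<and>
     (\<forall>S. finite S \<longrightarrow> (\<forall>x\<in>V S. act S S id x = x)) \<and>
     (\<forall>S T U f g. FI_mor S T f \<and> FI_mor T U g \<longrightarrow>
        (\<forall>x\<in>V S. act S U (g \<circ> f) x = act T U g (act S T f x)))"

section \<open>Presentations M(S) = V S / Z S, derived modules, polynomiality\<close>

text \<open>To iterate the derived-module construction (which involves quotients) we work with
presentations: M(S) is represented as V S modulo the submodule Z S.  An FI-module is the
presentation with Z S = {0}.\<close>

record 'b fipres =
  pV :: "nat set \<Rightarrow> 'b set"
  pZ :: "nat set \<Rightarrow> 'b set"
  pact :: "nat set \<Rightarrow> nat set \<Rightarrow> (nat \<Rightarrow> nat) \<Rightarrow> 'b \<Rightarrow> 'b"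

text \<open>The functorial one-point extension S \<sqcup> {*}: the new point is the least natural
number not in S.\<close>

definition star :: "nat set \<Rightarrow> nat" where
  "star S = (LEAST x. x \<notin> S)"

definition plus_star :: "nat set \<Rightarrow> nat set" where
  "plus_star S = insert (star S) S"

definition ext_star :: "nat set \<Rightarrow> nat set \<Rightarrow> (nat \<Rightarrow> nat) \<Rightarrow> nat \<Rightarrow> nat" where
  "ext_star S T f = (\<lambda>x. if x = star S then star T else f x)"

text \<open>Derived module: DM(S) = M(S \<sqcup> {*}) / Im(M(S) -> M(S \<sqcup> {*})).\<close>

definition derived :: "'b::ab_group_add fipres \<Rightarrow> 'b fipres" where
  "derived P =
     \<lparr> pV = (\<lambda>S. pV P (plus_star S)),
       pZ = (\<lambda>S. {z + pact P S (plus_star S) id y | z y. z \<in> pZ P (plus_star S) \<and> y \<in> pV P S}),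
       pact = (\<lambda>S T f. pact P (plus_star S) (plus_star T) (ext_star S T f)) \<rparr>"

text \<open>poly_pres e m P: P is polynomial of degree e - 1 starting at m.\<close>

fun poly_pres :: "nat \<Rightarrow> int \<Rightarrow> 'b::ab_group_add fipres \<Rightarrow> bool" where
  "poly_pres 0 m P \<longleftrightarrow>
     (\<forall>S. finite S \<and> int (card S) \<ge> m \<longrightarrow> pV P S \<subseteq> pZ P S)"
| "poly_pres (Suc e) m P \<longleftrightarrow>
     (\<forall>S T f. FI_mor S T f \<and> int (card S) \<ge> m \<longrightarrow>
        (\<forall>x\<in>pV P S. pact P S T f x \<in> pZ P T \<longrightarrow> x \<in> pZ P S))
     \<and> poly_pres e (m - 1) (derived P)"

definition polynomial_fi ::
  "(nat set \<Rightarrow> 'b::ab_group_add set) \<Rightarrow> (nat set \<Rightarrow> nat set \<Rightarrow> (nat \<Rightarrow> nat) \<Rightarrow> 'b \<Rightarrow> 'b)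
     \<Rightarrow> int \<Rightarrow> int \<Rightarrow> bool" where
  "polynomial_fi V act d m \<longleftrightarrow>
     d \<ge> -1 \<and> poly_pres (nat (d + 1)) m \<lparr> pV = V, pZ = (\<lambda>_. {0}), pact = act \<rparr>"

section \<open>Group homology of symmetric groups via the bar complex\<close>

text \<open>\<open>S_n\<close> = permutations of {1..n}; it acts on M({1..n}) by act {1..n} {1..n} p.
H_k(S_n; M) is computed by the (inhomogeneous) bar complex: a k-chain is a function from
k-tuples (lists) of elements of S_n to M({1..n}) (zero off such tuples), with
d(g1,...,gk; a) = (g2,...,gk; g1\<inverse> a) + \<Sum>_{0<i<k} (-1)^i (..., g_i g_{i+1}, ...; a)
  + (-1)^k (g1,...,g(k-1); a).\<close>

definition Sym :: "nat \<Rightarrow> (nat \<Rightarrow> nat) set" where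
  "Sym n = {p. p permutes {1..n}}"

definition tuples :: "nat \<Rightarrow> nat \<Rightarrow> (nat \<Rightarrow> nat) list set" where
  "tuples n k = {gs. length gs = k \<and> set gs \<subseteq> Sym n}"

definition chains :: "(nat set \<Rightarrow> 'b::ab_group_add set) \<Rightarrow> nat \<Rightarrow> nat
     \<Rightarrow> ((nat \<Rightarrow> nat) list \<Rightarrow> 'b) set" where
  "chains V n k = {c. (\<forall>gs\<in>tuples n k. c gs \<in> V {1..n}) \<and> (\<forall>gs. gs \<notin> tuples n k \<longrightarrow> c gs = 0)}"

definition face :: "nat \<Rightarrow> nat \<Rightarrow> (nat \<Rightarrow> nat) list \<Rightarrow> (nat \<Rightarrow> nat) list" where
  "face k i gs = (if i = 0 then tl gs else if i = k then butlast gs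
                  else take (i - 1) gs @ [gs ! (i - 1) \<circ> gs ! i] @ drop (i + 1) gs)"

definition face_coeff :: "(nat set \<Rightarrow> nat set \<Rightarrow> (nat \<Rightarrow> nat) \<Rightarrow> 'b \<Rightarrow> 'b) \<Rightarrow> nat \<Rightarrow> nat
     \<Rightarrow> (nat \<Rightarrow> nat) list \<Rightarrow> 'b::ab_group_add \<Rightarrow> 'b" where
  "face_coeff act n i gs a = (if i = 0 then act {1..n} {1..n} (inv (hd gs)) a
                              else if even i then a else - a)"

definition bd :: "(nat set \<Rightarrow> nat set \<Rightarrow> (nat \<Rightarrow> nat) \<Rightarrow> 'b \<Rightarrow> 'b) \<Rightarrow> nat \<Rightarrow> nat
     \<Rightarrow> ((nat \<Rightarrow> nat) list \<Rightarrow> 'b::ab_group_add) \<Rightarrow> (nat \<Rightarrow> nat) list \<Rightarrow> 'b" where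
  "bd act n k c = (\<lambda>hs. if k \<ge> 1 \<and> hs \<in> tuples n (k - 1) then
      (\<Sum>gs\<in>tuples n k. \<Sum>i\<in>{0..k}. if face k i gs = hs then face_coeff act n i gs (c gs) else 0)
    else 0)"

definition cycles where
  "cycles V act n k = {c \<in> chains V n k. bd act n k c = (\<lambda>_. 0)}"

definition boundaries where
  "boundaries V act n k = bd act n (Suc k) ` chains V n (Suc k)"

text \<open>The chain map induced by S_n \<subseteq> S_(n+1) (a permutation of {1..n} is a permutation
of {1..n+1} fixing n+1) and by M({1..n}) -> M({1..n+1}).\<close>

definition push where
  "push act n c = (\<lambda>gs. if gs \<in> tuples n (length gs) then act {1..n} {1..Suc n} id (c gs) else 0)"

text \<open>Surjectivity / injectivity of the induced map H_k(S_n;M(n)) -> H_k(S_(n+1);M(n+1)).\<close>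

definition hom_surj where
  "hom_surj V act n k \<longleftrightarrow>
     (\<forall>y\<in>cycles V act (Suc n) k. \<exists>x\<in>cycles V act n k.
        (\<lambda>gs. push act n x gs - y gs) \<in> boundaries V act (Suc n) k)"

definition hom_inj where
  "hom_inj V act n k \<longleftrightarrow>
     (\<forall>x\<in>cycles V act n k. push act n x \<in> boundaries V act (Suc n) k \<longrightarrow> x \<in> boundaries V act n k)"

definition hom_iso where
  "hom_iso V act n k \<longleftrightarrow> hom_inj V act n k \<and> hom_surj V act n k"

end

theory Submission
  imports Defs
begin

text \<open>Write \<open>R\<^sub>k(n; M)\<close> for the relative homology of the stabilization map, the homology of its cone;
  the claim is that it vanishes for \<open>n \<ge> max m (2k + 2d)\<close>. For the shift \<open>\<Sigma>M(S) = M(S \<squnion> {*})\<close> the exact sequence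
  \<open>M \<rightarrow> \<Sigma>M \<rightarrow> DM \<rightarrow> 0\<close>, which is left exact in the relevant range, gives
  \<open>R\<^sub>k\<^sub>+\<^sub>1(n; DM) \<rightarrow> R\<^sub>k(n; M) \<rightarrow> R\<^sub>k(n; \<Sigma>M)\<close>, where \<open>\<Sigma>M\<close> is polynomial of degree \<open>d\<close> and \<open>DM\<close> of degree \<open>d - 1\<close>,
  both starting at \<open>m - 1\<close>. This reduces the claim to \<open>m = 0\<close>, where the better range \<open>n \<ge> 2k + d\<close> holds.

  For \<open>m = 0\<close> the complex of injective words \<open>C\<^sub>p(n)\<close>, the direct sum of \<open>M(n - w)\<close> over words \<open>w\<close> of length \<open>p\<close>, is
  exact at \<open>C\<^sub>p\<close> for \<open>n \<ge> p + d + 1\<close>: pushing a letter \<open>x\<close> to the front by induction leaves the cone of the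
  inclusion \<open>M \<rightarrow> \<Sigma>M\<close>, that is, the same complex for \<open>DM\<close>. On homology of the symmetric group all faces of
  \<open>C\<^sub>p\<^sub>+\<^sub>1 \<rightarrow> C\<^sub>p\<close> agree, so for \<open>p = 2j\<close> the pair \<open>C\<^sub>p\<^sub>+\<^sub>1 \<rightarrow> C\<^sub>p\<close> contributes the relative homology
  \<open>R(n - 2j)\<close> of a smaller group; the pair for \<open>j = 0\<close> is the one wanted and the others vanish by induction.\<close>

section \<open>Alternating insertion sums\<close>

text \<open>Iterating the quotient DM would change the carrier at every step. Here all coefficients
  are subgroups of one group \<open>M \<Omega>\<close>, the relations are collected in
  \<open>Z U B\<close>, and exactness is asserted modulo \<open>Z\<close>. The \<open>j\<close>-fold
  derived module starts at \<open>m - j\<close> but is evaluated at the \<open>|U| - j\<close>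
  points outside \<open>B\<close>, so in terms of \<open>U\<close> all starts become the single
  bound \<open>m\<close>. A shift keeps one point of \<open>\<Omega>\<close> away from the words and
  from the acting group; once \<open>m\<close> points are kept away, deleting letters never leads
  below \<open>m\<close>, which is the case of start 0. This is why \<open>\<Omega>\<close> has
  \<open>m\<close> points beyond \<open>{1..Suc n}\<close>.

  Slope 2 comes from columns of word lengths cancelling in pairs. In the range
  \<open>n \<ge> 2k + d\<close>, passing from \<open>(k, d)\<close> to \<open>(k + 1, d - 1)\<close>
  costs 1, and at most \<open>d\<close> such passages leave a nonzero module: hence
  \<open>2k + 2d\<close>. Surjectivity in degree \<open>k\<close> comes from the relative homology
  in degree \<open>k\<close>, injectivity from that in degree \<open>k + 1\<close>, hence the two
  ranges.\<close>

definition subgrp :: "'b::ab_group_add set \<Rightarrow> bool" where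
  "subgrp S \<longleftrightarrow> 0 \<in> S \<and> (\<forall>a\<in>S. \<forall>b\<in>S. a - b \<in> S)"

lemma subgrp_0: "subgrp S \<Longrightarrow> 0 \<in> S"
  and subgrp_diff: "subgrp S \<Longrightarrow> a \<in> S \<Longrightarrow> b \<in> S \<Longrightarrow> a - b \<in> S"
  by (auto simp: subgrp_def)

lemma subgrp_uminus: "subgrp S \<Longrightarrow> a \<in> S \<Longrightarrow> - a \<in> S"
  using subgrp_diff[of S 0 a] subgrp_0[of S] by simp

lemma subgrp_add: "subgrp S \<Longrightarrow> a \<in> S \<Longrightarrow> b \<in> S \<Longrightarrow> a + b \<in> S"
  using subgrp_diff[of S a "- b"] subgrp_uminus[of S b] by simp

lemma subgrp_sum: "subgrp S \<Longrightarrow> (\<And>x. x \<in> A \<Longrightarrow> f x \<in> S) \<Longrightarrow> sum f A \<in> S"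
  by (induction A rule: infinite_finite_induct) (auto intro: subgrp_0 subgrp_add)

definition additive_on :: "'b::ab_group_add set \<Rightarrow> ('b \<Rightarrow> 'c::ab_group_add) \<Rightarrow> bool" where
  "additive_on S F \<longleftrightarrow> subgrp S \<and> (\<forall>a\<in>S. \<forall>b\<in>S. F (a + b) = F a + F b)"

lemma additive_on_subgrp: "additive_on S F \<Longrightarrow> subgrp S"
  by (simp add: additive_on_def)

lemma additive_on_add: "additive_on S F \<Longrightarrow> a \<in> S \<Longrightarrow> b \<in> S \<Longrightarrow> F (a + b) = F a + F b"
  by (simp add: additive_on_def)

lemma additive_on_0: "additive_on S F \<Longrightarrow> F 0 = 0"
  using additive_on_add[of S F 0 0] subgrp_0[OF additive_on_subgrp[of S F]] by simp

lemma additive_on_diff: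
  assumes "additive_on S F" "a \<in> S" "b \<in> S" shows "F (a - b) = F a - F b"
  using additive_on_add[OF assms(1), of "a - b" b] subgrp_diff[OF additive_on_subgrp[OF assms(1)], of a b] assms
  by simp

lemma additive_on_uminus:
  assumes "additive_on S F" "a \<in> S" shows "F (- a) = - F a"
  using additive_on_diff[OF assms(1), of 0 a] additive_on_0[OF assms(1)]
    subgrp_0[OF additive_on_subgrp[OF assms(1)]] assms by simp

lemma additive_on_sum:
  assumes "additive_on S F" "\<And>x. x \<in> A \<Longrightarrow> f x \<in> S" shows "F (sum f A) = (\<Sum>x\<in>A. F (f x))"
  using assms(2)
proof (induction A rule: infinite_finite_induct)
  case (insert x A)
  then show ?case
    using additive_on_add[OF assms(1), of "f x" "sum f A"] subgrp_sum[OF additive_on_subgrp[OF assms(1)], of A f]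
    by simp
qed (auto simp: additive_on_0[OF assms(1)])

definition alt :: "nat \<Rightarrow> 'b::ab_group_add \<Rightarrow> 'b" where
  "alt n a = (if even n then a else - a)"

lemma alt_simps [simp]: "alt 0 a = a" "alt (Suc n) a = - alt n a" "alt n 0 = 0"
  "alt n (alt n a) = a" "alt n (- a) = - alt n a"
  by (auto simp: alt_def)

lemma alt_add: "alt n (a + b) = alt n a + alt n b"
  and alt_diff: "alt n (a - b) = alt n a - alt n b"
  and alt_sum: "alt n (sum f A) = (\<Sum>x\<in>A. alt n (f x))"
  by (auto simp: alt_def sum_negf)

lemma alt_eq_0 [simp]: "alt n a = 0 \<longleftrightarrow> a = 0"
  by (auto simp: alt_def)

lemma subgrp_alt: "subgrp S \<Longrightarrow> a \<in> S \<Longrightarrow> alt n a \<in> S"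
  by (auto simp: alt_def intro: subgrp_uminus)

lemma additive_on_alt: "additive_on S F \<Longrightarrow> a \<in> S \<Longrightarrow> F (alt n a) = alt n (F a)"
  by (auto simp: alt_def additive_on_uminus)

text \<open>\<open>ins X c l = \<Sum>\<^sub>i (-1)^i \<Sum>\<^sub>x\<^sub>\<in>\<^sub>X c (l with x inserted at position i)\<close>: for chains
written as functions on tuples, this is the simplicial boundary.\<close>

fun ins :: "'x set \<Rightarrow> ('x list \<Rightarrow> 'b::ab_group_add) \<Rightarrow> 'x list \<Rightarrow> 'b" where
  "ins X c [] = (\<Sum>x\<in>X. c [x])"
| "ins X c (y # l) = (\<Sum>x\<in>X. c (x # y # l)) - ins X (\<lambda>l'. c (y # l')) l"

lemma ins_cong:
  assumes "\<And>x l'. x \<in> X \<Longrightarrow> set l' = insert x (set l) \<Longrightarrow> length l' = Suc (length l) \<Longrightarrow> c l' = c' l'"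
  shows "ins X c l = ins X c' l"
  using assms
proof (induction l arbitrary: c c')
  case Nil
  then show ?case by (auto intro!: sum.cong)
next
  case (Cons y l)
  have "ins X (\<lambda>l'. c (y # l')) l = ins X (\<lambda>l'. c' (y # l')) l"
    by (rule Cons.IH) (rule Cons.prems, assumption, auto)
  moreover have "(\<Sum>x\<in>X. c (x # y # l)) = (\<Sum>x\<in>X. c' (x # y # l))"
    by (rule sum.cong[OF refl], rule Cons.prems, assumption) auto
  ultimately show ?case by simp
qed

lemma ins_add: "ins X (\<lambda>l. c l + c' l) l = ins X c l + ins X c' l"
  by (induction l arbitrary: c c') (auto simp: sum.distrib)

lemma ins_diff: "ins X (\<lambda>l. c l - c' l) l = ins X c l - ins X c' l"
  by (induction l arbitrary: c c') (auto simp: sum_subtractf)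

lemma ins_uminus: "ins X (\<lambda>l. - c l) l = - ins X c l"
  by (induction l arbitrary: c) (auto simp: sum_negf)

lemma ins_alt: "ins X (\<lambda>l. alt n (c l)) l = alt n (ins X c l)"
  by (auto simp: alt_def ins_uminus)

lemma ins_zero [simp]: "ins X (\<lambda>l. 0) l = 0"
  by (induction l) auto

lemma ins_sum: "ins X (\<lambda>l. \<Sum>a\<in>A. c a l) l = (\<Sum>a\<in>A. ins X (c a) l)"
proof (induction l arbitrary: c)
  case Nil
  then show ?case by (auto intro: sum.swap)
next
  case (Cons y l)
  show ?case using Cons.IH[of "\<lambda>a l'. c a (y # l')"]
    by (simp add: sum_subtractf) (rule sum.swap)
qed

lemma ins_comm: "ins X (\<lambda>e. ins U (c e) w) e = ins U (\<lambda>w. ins X (\<lambda>e. c e w) e) w"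
proof (induction w arbitrary: c)
  case Nil
  then show ?case by (simp add: ins_sum)
next
  case (Cons y w)
  show ?case using Cons.IH[of "\<lambda>e w. c e (y # w)"] by (simp add: ins_diff ins_sum)
qed

lemma ins_closed:
  assumes "subgrp S"
    "\<And>x l'. x \<in> X \<Longrightarrow> set l' = insert x (set l) \<Longrightarrow> length l' = Suc (length l) \<Longrightarrow> c l' \<in> S"
  shows "ins X c l \<in> S"
  using assms(2)
proof (induction l arbitrary: c)
  case Nil
  then show ?case by (auto intro!: subgrp_sum[OF assms(1)])
next
  case (Cons y l)
  have "ins X (\<lambda>l'. c (y # l')) l \<in> S"
    by (rule Cons.IH) (rule Cons.prems, assumption, auto)
  moreover have "(\<Sum>x\<in>X. c (x # y # l)) \<in> S"
    by (rule subgrp_sum[OF assms(1)], rule Cons.prems, assumption) auto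
  ultimately show ?case by (auto intro: subgrp_diff[OF assms(1)])
qed

lemma ins_eq_0:
  assumes "\<And>x l'. x \<in> X \<Longrightarrow> set l' = insert x (set l) \<Longrightarrow> length l' = Suc (length l) \<Longrightarrow> c l' = 0"
  shows "ins X c l = 0"
  using ins_closed[where S = "{0}" and X = X and l = l and c = c] assms by (auto simp: subgrp_def)

lemma ins_additive:
  assumes "additive_on S F"
    "\<And>x l'. x \<in> X \<Longrightarrow> set l' = insert x (set l) \<Longrightarrow> length l' = Suc (length l) \<Longrightarrow> c l' \<in> S"
  shows "ins X (\<lambda>l. F (c l)) l = F (ins X c l)"
  using assms(2)
proof (induction l arbitrary: c)
  case Nil
  then show ?case by (auto simp: additive_on_sum[OF assms(1)])
next
  case (Cons y l)
  have mem: "ins X (\<lambda>l'. c (y # l')) l \<in> S" "\<And>x. x \<in> X \<Longrightarrow> c (x # y # l) \<in> S"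
    by (rule ins_closed[OF additive_on_subgrp[OF assms(1)]], rule Cons.prems, assumption, auto)
       (rule Cons.prems, assumption, auto)
  have "ins X (\<lambda>l'. F (c (y # l'))) l = F (ins X (\<lambda>l'. c (y # l')) l)"
    by (rule Cons.IH) (rule Cons.prems, assumption, auto)
  then show ?case
    using mem subgrp_sum[OF additive_on_subgrp[OF assms(1)], of X "\<lambda>x. c (x # y # l)"]
    by (simp add: additive_on_diff[OF assms(1)] additive_on_sum[OF assms(1)])
qed

lemma ins_map:
  assumes "bij_betw g X X'"
  shows "ins X' c (map g l) = ins X (\<lambda>l. c (map g l)) l"
proof (induction l arbitrary: c)
  case Nil
  then show ?case using sum.reindex_bij_betw[OF assms, of "\<lambda>x. c [x]"] by simp
next
  case (Cons y l)
  show ?case using Cons.IH[of "\<lambda>l'. c (g y # l')"] sum.reindex_bij_betw[OF assms, of "\<lambda>x. c (x # map g (y # l))"]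
    by simp
qed

text \<open>Two insertions in front cancel because the double sum over \<open>X\<close> is
  symmetric; a front insertion combined with a later one meets the opposite sign in the other order.
  This is the square-zero identity in both directions of the double complex.\<close>

lemma ins_ins: "ins X (ins X c) l = 0"
proof (induction l arbitrary: c)
  case Nil
  have "(\<Sum>x\<in>X. \<Sum>y\<in>X. c [y, x]) = (\<Sum>x\<in>X. \<Sum>y\<in>X. c [x, y])" by (rule sum.swap)
  then show ?case by (simp add: sum_subtractf)
next
  case (Cons y l)
  have sw: "(\<Sum>x\<in>X. \<Sum>z\<in>X. c (z # x # y # l)) = (\<Sum>x\<in>X. \<Sum>z\<in>X. c (x # z # y # l))" by (rule sum.swap)
  show ?case using Cons.IH[of "\<lambda>l'. c (y # l')"] sw
    by (simp add: sum_subtractf sum.distrib ins_diff ins_sum)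
qed

lemma ins_set_mono:
  assumes "finite X'" "X \<subseteq> X'"
    "\<And>l'. length l' = Suc (length l) \<Longrightarrow> set l \<subseteq> set l' \<Longrightarrow> \<exists>x\<in>set l'. x \<in> X' - X \<Longrightarrow> c l' = 0"
  shows "ins X' c l = ins X c l"
  using assms(3)
proof (induction l arbitrary: c)
  case Nil
  have "c [x] = 0" if "x \<in> X' - X" for x using that by (intro Nil) auto
  then show ?case by (auto intro!: sum.mono_neutral_right assms)
next
  case (Cons y l)
  have "(\<Sum>x\<in>X'. c (x # y # l)) = (\<Sum>x\<in>X. c (x # y # l))"
    by (rule sum.mono_neutral_right[OF assms(1,2)], rule ballI, rule Cons.prems) auto
  moreover have "ins X' (\<lambda>l'. c (y # l')) l = ins X (\<lambda>l'. c (y # l')) l"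
    by (rule Cons.IH, rule Cons.prems) auto
  ultimately show ?case by simp
qed

lemma ins_append:
  assumes "\<And>a'. length a' = Suc (length a) \<Longrightarrow> set a \<subseteq> set a' \<Longrightarrow> c (a' @ l) = 0"
    "l \<noteq> []"
  shows "ins X c (a @ l) = alt (length a) (ins X (\<lambda>l. c (a @ l)) l)"
  using assms
proof (induction a arbitrary: c)
  case (Cons y a)
  have "(\<Sum>x\<in>X. c (x # y # (a @ l))) = 0"
    using Cons.prems(1)[of "_ # y # a"] by (auto intro!: sum.neutral)
  moreover have "ins X (\<lambda>l'. c (y # l')) (a @ l) = alt (length a) (ins X (\<lambda>l. c (y # a @ l)) l)"
    by (rule Cons.IH) (use Cons.prems(1)[of "y # _"] Cons.prems(2) in auto)
  ultimately show ?case by simp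
qed simp

text \<open>Insertions are recorded only through the set and the length of the longer word; counting
  letters recovers that nothing was repeated.\<close>

lemma distinct_insertD:
  assumes "set w' = insert x (set w)" "length w' = Suc (length w)" "distinct w'"
  shows "distinct w" "x \<notin> set w"
proof -
  have "Suc (length w) = card (insert x (set w))" using assms distinct_card by metis
  moreover have "card (insert x (set w)) \<le> Suc (card (set w))" by (simp add: card_insert_if)
  moreover have "card (set w) \<le> length w" by (rule card_length)
  ultimately have "card (set w) = length w" "card (insert x (set w)) = Suc (card (set w))" by auto
  then show "distinct w" "x \<notin> set w" using card_distinct[of w] by (auto simp: card_insert_if split: if_splits)
qed

text \<open>Meant for chains in which \<open>x\<close> never stands further back than here: an
  insertion anywhere before \<open>x\<close> pushes it back, so only insertions behind
  \<open>x\<close> survive, with the sign of the \<open>Suc (length a)\<close> letters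
  passed.\<close>

lemma ins_prefix:
  assumes "\<And>a'. length a' = Suc (length a) \<Longrightarrow> set a \<subseteq> set a' \<Longrightarrow> c (a' @ x # l) = 0"
  shows "ins X c (a @ x # l) = alt (Suc (length a)) (ins X (\<lambda>l. c (a @ x # l)) l)"
proof -
  have "(\<Sum>y\<in>X. c (a @ y # x # l)) = 0"
    using assms[of "a @ [_]"] by (auto intro!: sum.neutral)
  then show ?thesis using ins_append[of a c "x # l" X] assms by simp
qed

lemma ins_insert:
  assumes "finite X" "x \<notin> X"
  shows "ins (insert x X) c l = ins X c l + ins {x} c l"
  using assms by (induction l arbitrary: c) auto

text \<open>Inserting \<open>x\<close> behind the first letter gives a word in which something
  precedes \<open>x\<close>, and there \<open>c\<close> vanishes.\<close>

lemma ins_single: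
  assumes "\<And>a l. a \<noteq> [] \<Longrightarrow> c (a @ x # l) = 0"
  shows "ins {x} c l = c (x # l)"
proof -
  have z: "ins {x} c l = 0" if "\<And>a l. c (a @ x # l) = 0" for c :: "'a list \<Rightarrow> 'b" and l
    using that
  proof (induction l arbitrary: c)
    case Nil
    then show ?case using Nil[of "[]" "[]"] by simp
  next
    case (Cons y l)
    have "ins {x} (\<lambda>l'. c (y # l')) l = 0"
      by (rule Cons.IH) (use Cons.prems[of "y # _"] in auto)
    then show ?case using Cons.prems[of "[]" "y # l"] by simp
  qed
  show ?thesis
  proof (cases l)
    case (Cons y l')
    have "ins {x} (\<lambda>l'. c (y # l')) l' = 0"
      by (rule z) (use assms[of "y # _"] in auto)
    then show ?thesis using Cons by simp
  qed simp
qed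

section \<open>Push-forward and prisms\<close>

text \<open>The direct image of a chain: at \<open>l\<close> it sums \<open>c\<close> over the
  tuples \<open>e\<close> in \<open>X\<close> with \<open>map f e = l\<close>, chosen entry by
  entry.\<close>

fun push_fwd :: "'x set \<Rightarrow> ('x \<Rightarrow> 'y) \<Rightarrow> ('x list \<Rightarrow> 'b::ab_group_add) \<Rightarrow> 'y list \<Rightarrow> 'b" where
  "push_fwd X f c [] = c []"
| "push_fwd X f c (y # l) = (\<Sum>x\<in>{x\<in>X. f x = y}. push_fwd X f (\<lambda>l'. c (x # l')) l)"

text \<open>The prism between the simplicial maps \<open>f\<close> and \<open>g\<close>, that is,
  the sum over \<open>i\<close> of \<open>(-1)^i\<close> times the tuple
  \<open>f x_0, ..., f x_i, g x_i, ..., g x_k\<close>, read off from the target tuple: either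
  \<open>g\<close> takes over right after the first entry, or the first entry is stripped at the
  cost of a sign.\<close>

fun pris :: "'x set \<Rightarrow> ('x \<Rightarrow> 'y) \<Rightarrow> ('x \<Rightarrow> 'y) \<Rightarrow> ('x list \<Rightarrow> 'b::ab_group_add) \<Rightarrow> 'y list \<Rightarrow> 'b" where
  "pris X f g c [] = 0"
| "pris X f g c (y # l) = (\<Sum>x\<in>{x\<in>X. f x = y}.
     (case l of [] \<Rightarrow> 0 | z # l' \<Rightarrow> if z = g x then push_fwd X g (\<lambda>l'. c (x # l')) l' else 0)
      - pris X f g (\<lambda>l'. c (x # l')) l)"

lemma push_fwd_add: "push_fwd X f (\<lambda>l. c l + c' l) l = push_fwd X f c l + push_fwd X f c' l"
  by (induction l arbitrary: c c') (auto simp: sum.distrib)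

lemma push_fwd_diff: "push_fwd X f (\<lambda>l. c l - c' l) l = push_fwd X f c l - push_fwd X f c' l"
  by (induction l arbitrary: c c') (auto simp: sum_subtractf)

lemma push_fwd_zero [simp]: "push_fwd X f (\<lambda>l. 0) l = 0"
  by (induction l) auto

lemma push_fwd_sum: "push_fwd X f (\<lambda>l. \<Sum>a\<in>A. c a l) l = (\<Sum>a\<in>A. push_fwd X f (c a) l)"
  by (induction A rule: infinite_finite_induct) (auto simp: push_fwd_add)

lemma pris_add: "pris X f g (\<lambda>l. c l + c' l) l = pris X f g c l + pris X f g c' l"
proof (induction l arbitrary: c c')
  case (Cons y l)
  show ?case
    by (auto simp: Cons.IH push_fwd_add sum.distrib[symmetric] algebra_simps split: list.splits intro!: sum.cong)
qed simp

lemma pris_zero [simp]: "pris X f g (\<lambda>l. 0) l = 0"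
  by (induction l) (auto split: list.splits intro!: sum.neutral)

lemma pris_uminus: "pris X f g (\<lambda>l. - c l) l = - pris X f g c l"
  using pris_add[of X f g c "\<lambda>l. - c l" l] by (simp add: add_eq_0_iff)

lemma pris_diff: "pris X f g (\<lambda>l. c l - c' l) l = pris X f g c l - pris X f g c' l"
  using pris_add[of X f g c "\<lambda>l. - c' l" l] by (simp add: pris_uminus)

lemma pris_sum: "pris X f g (\<lambda>l. \<Sum>a\<in>A. c a l) l = (\<Sum>a\<in>A. pris X f g (c a) l)"
  by (induction A rule: infinite_finite_induct) (auto simp: pris_add)

lemma sum_fibres:
  assumes "finite X" "finite Y" "f ` X \<subseteq> Y"
  shows "(\<Sum>y\<in>Y. \<Sum>x\<in>{x\<in>X. f x = y}. h x y) = (\<Sum>x\<in>X. h x (f x))"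
proof -
  have "(\<Sum>y\<in>Y. \<Sum>x\<in>{x\<in>X. f x = y}. h x y) = (\<Sum>y\<in>Y. \<Sum>x\<in>{x\<in>X. f x = y}. h x (f x))"
    by (auto intro!: sum.cong)
  also have "\<dots> = (\<Sum>x\<in>X. h x (f x))"
    by (rule sum.group[OF assms])
  finally show ?thesis .
qed

lemma push_fwd_ins:
  assumes "finite X" "finite Y" "f ` X \<subseteq> Y"
  shows "ins Y (push_fwd X f c) l = push_fwd X f (ins X c) l"
proof (induction l arbitrary: c)
  case Nil
  then show ?case using sum_fibres[OF assms, of "\<lambda>x _. c [x]"] by simp
next
  case (Cons y l)
  have "ins Y (\<lambda>l'. push_fwd X f c (y # l')) l = (\<Sum>x\<in>{x\<in>X. f x = y}. push_fwd X f (ins X (\<lambda>l'. c (x # l'))) l)"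
    by (simp add: ins_sum Cons.IH)
  moreover have "(\<Sum>z\<in>Y. push_fwd X f c (z # y # l))
     = (\<Sum>z\<in>X. \<Sum>x\<in>{x\<in>X. f x = y}. push_fwd X f (\<lambda>l'. c (z # x # l')) l)"
    using sum_fibres[OF assms] by simp
  ultimately show ?case
    by (simp add: push_fwd_diff push_fwd_sum sum_subtractf) (rule sum.swap)
qed

text \<open>The homotopy formula for the prism. In the induction on the target tuple,
  \<open>K x\<close> is the term in which \<open>g\<close> takes over at once; all contributions
  over a fixed \<open>x\<close> in the fibre of \<open>y\<close> reduce to the formula for the chain
  with \<open>x\<close> fixed in front.\<close>

lemma pris_ins:
  fixes c :: "'x list \<Rightarrow> 'b::ab_group_add"
  assumes "finite X" "finite Y" "f ` X \<subseteq> Y" "g ` X \<subseteq> Y"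
  shows "ins Y (pris X f g c) l + pris X f g (ins X c) l = push_fwd X g c l - push_fwd X f c l"
proof (induction l arbitrary: c)
  case Nil
  then show ?case by simp
next
  case (Cons y l)
  let ?F = "{x\<in>X. f x = y}"
  define K where "K = (\<lambda>x l. case l of [] \<Rightarrow> 0 | z # l' \<Rightarrow> if z = g x then push_fwd X g (\<lambda>l'. c (x # l')) l' else 0)"
  have insK: "ins Y (K x) l = push_fwd X g (\<lambda>l'. c (x # l')) l -
      (case l of [] \<Rightarrow> 0 | z # l' \<Rightarrow> if z = g x then ins Y (push_fwd X g (\<lambda>l'. c (x # l'))) l' else 0)"
    if "x \<in> X" for x
  proof -
    have s: "(\<Sum>z\<in>Y. K x (z # m)) = push_fwd X g (\<lambda>l'. c (x # l')) m" for m
      using that assms(2,4) by (auto simp: K_def sum.delta)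
    show ?thesis
    proof (cases l)
      case Nil then show ?thesis using s[of "[]"] by simp
    next
      case (Cons z l')
      have "ins Y (\<lambda>l'. K x (z # l')) l' = (if z = g x then ins Y (push_fwd X g (\<lambda>l'. c (x # l'))) l' else 0)"
        by (simp add: K_def)
      then show ?thesis using s[of l] Cons by simp
    qed
  qed
  \<comment> \<open>Summing over the new first letter \<open>z\<close> leaves a free sum over
    \<open>x\<close>, since \<open>z\<close> is then \<open>f x\<close>. The terms in which
    \<open>g\<close> takes over at once require \<open>y = g x\<close> and add up to the direct
    image along \<open>g\<close>.\<close>
  have A: "(\<Sum>z\<in>Y. pris X f g c (z # y # l)) =
     push_fwd X g c (y # l) - (\<Sum>x\<in>X. pris X f g (\<lambda>l'. c (x # l')) (y # l))"
  proof -
    have "(\<Sum>z\<in>Y. pris X f g c (z # y # l)) =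
      (\<Sum>x\<in>X. (if y = g x then push_fwd X g (\<lambda>l'. c (x # l')) l else 0) - pris X f g (\<lambda>l'. c (x # l')) (y # l))"
      using sum_fibres[OF assms(1-3), of "\<lambda>x z. (if y = g x then push_fwd X g (\<lambda>l'. c (x # l')) l else 0) - pris X f g (\<lambda>l'. c (x # l')) (y # l)"]
      by simp
    also have "\<dots> = (\<Sum>x\<in>X. if y = g x then push_fwd X g (\<lambda>l'. c (x # l')) l else 0)
        - (\<Sum>x\<in>X. pris X f g (\<lambda>l'. c (x # l')) (y # l))" by (simp only: sum_subtractf)
    also have "(\<Sum>x\<in>X. if y = g x then push_fwd X g (\<lambda>l'. c (x # l')) l else 0) = push_fwd X g c (y # l)"
      using assms(1) by (auto simp: sum.inter_filter[symmetric] eq_commute intro: sum.cong)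
    finally show ?thesis .
  qed
  have B: "ins Y (\<lambda>l'. pris X f g c (y # l')) l = (\<Sum>x\<in>?F. ins Y (K x) l - ins Y (pris X f g (\<lambda>l'. c (x # l'))) l)"
    by (simp add: ins_sum ins_diff K_def)
  define J where "J = (\<lambda>x h. case l of [] \<Rightarrow> (0::'b) | z # l' \<Rightarrow> if z = g x then h l' else 0)"
  have C: "pris X f g (ins X c) (y # l) = (\<Sum>x\<in>?F.
       J x (push_fwd X g (\<lambda>l'. (\<Sum>z\<in>X. c (z # x # l')) - ins X (\<lambda>l'. c (x # l')) l'))
        - pris X f g (\<lambda>l'. (\<Sum>z\<in>X. c (z # x # l')) - ins X (\<lambda>l'. c (x # l')) l') l)"
    unfolding J_def pris.simps ins.simps ..
  have Jd: "J x (push_fwd X g (\<lambda>l'. (\<Sum>z\<in>X. c (z # x # l')) - ins X (\<lambda>l'. c (x # l')) l'))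
     = (\<Sum>z\<in>X. J x (push_fwd X g (\<lambda>l'. c (z # x # l')))) - J x (push_fwd X g (ins X (\<lambda>l'. c (x # l'))))" for x
    by (auto simp: J_def push_fwd_diff push_fwd_sum split: list.splits)
  have Jk: "ins Y (K x) l = push_fwd X g (\<lambda>l'. c (x # l')) l - J x (push_fwd X g (ins X (\<lambda>l'. c (x # l'))))"
    if "x \<in> X" for x
    using insK[OF that] push_fwd_ins[OF assms(1,2,4), of "\<lambda>l'. c (x # l')"]
    by (simp add: J_def split: list.splits)
  have D: "(\<Sum>x\<in>X. pris X f g (\<lambda>l'. c (x # l')) (y # l)) =
     (\<Sum>z\<in>X. \<Sum>x\<in>?F. J x (push_fwd X g (\<lambda>l'. c (z # x # l'))) - pris X f g (\<lambda>l'. c (z # x # l')) l)"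
    by (simp add: J_def)
  have D': "(\<Sum>x\<in>X. pris X f g (\<lambda>l'. c (x # l')) (y # l)) =
     (\<Sum>x\<in>?F. (\<Sum>z\<in>X. J x (push_fwd X g (\<lambda>l'. c (z # x # l')))) - (\<Sum>z\<in>X. pris X f g (\<lambda>l'. c (z # x # l')) l))"
    unfolding D by (subst sum.swap) (simp add: sum_subtractf)
  have "ins Y (pris X f g c) (y # l) + pris X f g (ins X c) (y # l) =
    push_fwd X g c (y # l) - (\<Sum>x\<in>?F. (\<Sum>z\<in>X. J x (push_fwd X g (\<lambda>l'. c (z # x # l')))) - (\<Sum>z\<in>X. pris X f g (\<lambda>l'. c (z # x # l')) l))
    - (\<Sum>x\<in>?F. ins Y (K x) l - ins Y (pris X f g (\<lambda>l'. c (x # l'))) l)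
    + (\<Sum>x\<in>?F. (\<Sum>z\<in>X. J x (push_fwd X g (\<lambda>l'. c (z # x # l')))) - J x (push_fwd X g (ins X (\<lambda>l'. c (x # l'))))
       - ((\<Sum>z\<in>X. pris X f g (\<lambda>l'. c (z # x # l')) l) - pris X f g (ins X (\<lambda>l'. c (x # l'))) l))"
    unfolding C ins.simps A B D' Jd by (simp add: pris_diff pris_sum)
  also have "\<dots> = push_fwd X g c (y # l) - (\<Sum>x\<in>?F.
      ((\<Sum>z\<in>X. J x (push_fwd X g (\<lambda>l'. c (z # x # l')))) - (\<Sum>z\<in>X. pris X f g (\<lambda>l'. c (z # x # l')) l))
      + (ins Y (K x) l - ins Y (pris X f g (\<lambda>l'. c (x # l'))) l)
      - ((\<Sum>z\<in>X. J x (push_fwd X g (\<lambda>l'. c (z # x # l')))) - J x (push_fwd X g (ins X (\<lambda>l'. c (x # l'))))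
       - ((\<Sum>z\<in>X. pris X f g (\<lambda>l'. c (z # x # l')) l) - pris X f g (ins X (\<lambda>l'. c (x # l'))) l)))"
    by (simp only: sum.distrib sum_subtractf) (simp add: algebra_simps)
  also have "\<dots> = push_fwd X g c (y # l) - (\<Sum>x\<in>?F. push_fwd X f (\<lambda>l'. c (x # l')) l)"
  proof -
    have "((\<Sum>z\<in>X. J x (push_fwd X g (\<lambda>l'. c (z # x # l')))) - (\<Sum>z\<in>X. pris X f g (\<lambda>l'. c (z # x # l')) l))
      + (ins Y (K x) l - ins Y (pris X f g (\<lambda>l'. c (x # l'))) l)
      - ((\<Sum>z\<in>X. J x (push_fwd X g (\<lambda>l'. c (z # x # l')))) - J x (push_fwd X g (ins X (\<lambda>l'. c (x # l'))))
       - ((\<Sum>z\<in>X. pris X f g (\<lambda>l'. c (z # x # l')) l) - pris X f g (ins X (\<lambda>l'. c (x # l'))) l))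
       = push_fwd X f (\<lambda>l'. c (x # l')) l" if "x \<in> ?F" for x
    proof -
      have ih: "pris X f g (ins X (\<lambda>l'. c (x # l'))) l = push_fwd X g (\<lambda>l'. c (x # l')) l - push_fwd X f (\<lambda>l'. c (x # l')) l
          - ins Y (pris X f g (\<lambda>l'. c (x # l'))) l"
        using Cons.IH[of "\<lambda>l'. c (x # l')"] by (simp add: algebra_simps eq_diff_eq)
      show ?thesis using that by (simp add: Jk ih)
    qed
    then show ?thesis by (intro arg_cong2[where f = minus] refl sum.cong)
  qed
  finally show ?case by simp
qed

text \<open>Equivariance of the direct image: \<open>\<gamma>\<close> and \<open>\<gamma>'\<close>
  are translations by one group element on source and target, \<open>F\<close> is its action on
  coefficients. There are two chains \<open>c\<close> and \<open>c'\<close> because stripping the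
  first letter fixes \<open>x\<close> in one and \<open>\<gamma> x\<close> in the other.\<close>

lemma push_fwd_transport:
  assumes "additive_on S F" "bij_betw \<gamma> X X" "inj \<gamma>'" "\<And>x. x \<in> X \<Longrightarrow> f' (\<gamma> x) = \<gamma>' (f x)"
    "\<And>e. set e \<subseteq> X \<Longrightarrow> c e \<in> S" "\<And>e. set e \<subseteq> X \<Longrightarrow> c' (map \<gamma> e) = F (c e)"
  shows "push_fwd X f c l \<in> S" "push_fwd X f' c' (map \<gamma>' l) = F (push_fwd X f c l)"
proof -
  have "push_fwd X f c l \<in> S \<and> push_fwd X f' c' (map \<gamma>' l) = F (push_fwd X f c l)"
    using assms(5,6)
  proof (induction l arbitrary: c c')
    case Nil
    then show ?case using Nil(1)[of "[]"] Nil(2)[of "[]"] by simp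
  next
    case (Cons y l)
    have IH: "push_fwd X f (\<lambda>l'. c (x # l')) l \<in> S \<and>
       push_fwd X f' (\<lambda>l'. c' (\<gamma> x # l')) (map \<gamma>' l) = F (push_fwd X f (\<lambda>l'. c (x # l')) l)" if "x \<in> X" for x
      using Cons.prems(1)[of "x # _"] Cons.prems(2)[of "x # _"] that by (intro Cons.IH) auto
    have bij: "bij_betw \<gamma> {x\<in>X. f x = y} {x\<in>X. f' x = \<gamma>' y}"
    proof -
      have "\<gamma> ` {x\<in>X. f x = y} = {x\<in>X. f' x = \<gamma>' y}"
      proof safe
        fix x assume "x \<in> X" "f' x = \<gamma>' y"
        then obtain u where "u \<in> X" "x = \<gamma> u" using assms(2) by (auto simp: bij_betw_def)
        with \<open>f' x = \<gamma>' y\<close> assms(3,4) show "x \<in> \<gamma> ` {x\<in>X. f x = y}" by (auto dest: injD)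
      qed (use assms(2,4) in \<open>auto simp: bij_betw_def\<close>)
      then show ?thesis using assms(2) by (auto simp: bij_betw_def inj_on_def)
    qed
    have "push_fwd X f' c' (map \<gamma>' (y # l)) = (\<Sum>x\<in>{x\<in>X. f x = y}. push_fwd X f' (\<lambda>l'. c' (\<gamma> x # l')) (map \<gamma>' l))"
      using sum.reindex_bij_betw[OF bij, of "\<lambda>x. push_fwd X f' (\<lambda>l'. c' (x # l')) (map \<gamma>' l)"] by simp
    also have "\<dots> = (\<Sum>x\<in>{x\<in>X. f x = y}. F (push_fwd X f (\<lambda>l'. c (x # l')) l))"
      using IH by (intro sum.cong) auto
    also have "\<dots> = F (push_fwd X f c (y # l))"
      using IH by (simp, subst additive_on_sum[OF assms(1)], auto)
    finally show ?case using IH by (auto intro!: subgrp_sum additive_on_subgrp[OF assms(1)])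
  qed
  then show "push_fwd X f c l \<in> S" "push_fwd X f' c' (map \<gamma>' l) = F (push_fwd X f c l)" by auto
qed

lemma pris_transport:
  assumes "additive_on S F" "bij_betw \<gamma> X X" "inj \<gamma>'" "\<And>x. x \<in> X \<Longrightarrow> f' (\<gamma> x) = \<gamma>' (f x)"
    "\<And>x. x \<in> X \<Longrightarrow> g' (\<gamma> x) = \<gamma>' (g x)"
    "\<And>e. set e \<subseteq> X \<Longrightarrow> c e \<in> S" "\<And>e. set e \<subseteq> X \<Longrightarrow> c' (map \<gamma> e) = F (c e)"
  shows "pris X f g c l \<in> S" "pris X f' g' c' (map \<gamma>' l) = F (pris X f g c l)"
proof -
  have "pris X f g c l \<in> S \<and> pris X f' g' c' (map \<gamma>' l) = F (pris X f g c l)"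
    using assms(6,7)
  proof (induction l arbitrary: c c')
    case Nil
    then show ?case by (simp add: additive_on_0[OF assms(1)] subgrp_0[OF additive_on_subgrp[OF assms(1)]])
  next
    case (Cons y l)
    let ?k = "\<lambda>c f g x l. (case l of [] \<Rightarrow> 0 | z # l' \<Rightarrow> if z = g x then push_fwd X g (\<lambda>l'. c (x # l')) l' else 0)
      - pris X f g (\<lambda>l'. c (x # l')) l"
    have IH: "?k c f g x l \<in> S \<and> ?k c' f' g' (\<gamma> x) (map \<gamma>' l) = F (?k c f g x l)" if "x \<in> X" for x
    proof -
      have 1: "pris X f g (\<lambda>l'. c (x # l')) l \<in> S \<and>
       pris X f' g' (\<lambda>l'. c' (\<gamma> x # l')) (map \<gamma>' l) = F (pris X f g (\<lambda>l'. c (x # l')) l)"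
        using Cons.prems(1)[of "x # _"] Cons.prems(2)[of "x # _"] that by (intro Cons.IH) auto
      have 2: "push_fwd X g (\<lambda>l'. c (x # l')) l' \<in> S"
         "push_fwd X g' (\<lambda>l'. c' (\<gamma> x # l')) (map \<gamma>' l') = F (push_fwd X g (\<lambda>l'. c (x # l')) l')" for l'
      proof -
        have *: "c (x # e) \<in> S" "c' (\<gamma> x # map \<gamma> e) = F (c (x # e))" if "set e \<subseteq> X" for e
          using Cons.prems(1)[of "x # e"] Cons.prems(2)[of "x # e"] that \<open>x \<in> X\<close> by auto
        show "push_fwd X g (\<lambda>l'. c (x # l')) l' \<in> S"
          "push_fwd X g' (\<lambda>l'. c' (\<gamma> x # l')) (map \<gamma>' l') = F (push_fwd X g (\<lambda>l'. c (x # l')) l')"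
          by (rule push_fwd_transport[OF assms(1,2,3), of g' g "\<lambda>l'. c (x # l')" "\<lambda>l'. c' (\<gamma> x # l')" l'];
              use assms(5) * in simp)+
      qed
      have 3: "(case l of [] \<Rightarrow> 0 | z # l' \<Rightarrow> if z = g x then push_fwd X g (\<lambda>l'. c (x # l')) l' else 0) \<in> S \<and>
        (case map \<gamma>' l of [] \<Rightarrow> 0 | z # l' \<Rightarrow> if z = g' (\<gamma> x) then push_fwd X g' (\<lambda>l'. c' (\<gamma> x # l')) l' else 0)
        = F (case l of [] \<Rightarrow> 0 | z # l' \<Rightarrow> if z = g x then push_fwd X g (\<lambda>l'. c (x # l')) l' else 0)"
        using 2 that assms(3,5) additive_on_0[OF assms(1)] subgrp_0[OF additive_on_subgrp[OF assms(1)]]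
        by (cases l) (auto dest: injD)
      show ?thesis using 1 3
        by (auto simp: additive_on_diff[OF assms(1)] intro!: subgrp_diff[OF additive_on_subgrp[OF assms(1)]])
    qed
    have bij: "bij_betw \<gamma> {x\<in>X. f x = y} {x\<in>X. f' x = \<gamma>' y}"
    proof -
      have "\<gamma> ` {x\<in>X. f x = y} = {x\<in>X. f' x = \<gamma>' y}"
      proof safe
        fix x assume "x \<in> X" "f' x = \<gamma>' y"
        then obtain u where "u \<in> X" "x = \<gamma> u" using assms(2) by (auto simp: bij_betw_def)
        with \<open>f' x = \<gamma>' y\<close> assms(3,4) show "x \<in> \<gamma> ` {x\<in>X. f x = y}" by (auto dest: injD)
      qed (use assms(2,4) in \<open>auto simp: bij_betw_def\<close>)
      then show ?thesis using assms(2) by (auto simp: bij_betw_def inj_on_def)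
    qed
    have "pris X f' g' c' (map \<gamma>' (y # l)) = (\<Sum>x\<in>{x\<in>X. f x = y}. ?k c' f' g' (\<gamma> x) (map \<gamma>' l))"
      using sum.reindex_bij_betw[OF bij, of "\<lambda>x. ?k c' f' g' x (map \<gamma>' l)"] by simp
    also have "\<dots> = (\<Sum>x\<in>{x\<in>X. f x = y}. F (?k c f g x l))"
      using IH by (intro sum.cong) auto
    also have "\<dots> = F (pris X f g c (y # l))"
      using IH by (simp, subst additive_on_sum[OF assms(1)], auto)
    finally show ?case using IH by (auto intro!: subgrp_sum additive_on_subgrp[OF assms(1)])
  qed
  then show "pris X f g c l \<in> S" "pris X f' g' c' (map \<gamma>' l) = F (pris X f g c l)" by auto
qed

lemma push_fwd_eq_0:
  assumes "\<And>e. length e = length l \<Longrightarrow> set e \<subseteq> X \<Longrightarrow> map f e = l \<Longrightarrow> c e = 0"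
  shows "push_fwd X f c l = 0"
  using assms by (induction l arbitrary: c) (auto intro!: sum.neutral)

lemma push_fwd_id:
  assumes "\<And>e. c e \<noteq> 0 \<Longrightarrow> set e \<subseteq> A" "A \<subseteq> X" "finite X" "\<And>x. x \<in> A \<Longrightarrow> f x = x"
     "f ` X \<subseteq> A"
  shows "push_fwd X f c l = c l"
  using assms(1)
proof (induction l arbitrary: c)
  case (Cons y l)
  have "push_fwd X f (\<lambda>l'. c (x # l')) l = c (x # l)" for x
    using Cons.prems[of "x # _"] by (intro Cons.IH) auto
  then have "push_fwd X f c (y # l) = (\<Sum>x\<in>{x\<in>X. f x = y}. c (x # l))"
    by simp
  also have "\<dots> = (\<Sum>x\<in>{x\<in>X. f x = y}. if x = y then c (y # l) else 0)"
    using Cons.prems assms(4) by (intro sum.cong) (auto, force)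
  also have "\<dots> = c (y # l)"
  proof (cases "y \<in> A")
    case True
    then show ?thesis using assms by (auto simp: sum.delta)
  next
    case False
    then have "c (y # l) = 0" using Cons.prems[of "y # l"] by auto
    then show ?thesis by (auto intro!: sum.neutral)
  qed
  finally show ?case .
qed simp

lemma push_fwd_bij:
  assumes "\<And>x. x \<in> X \<Longrightarrow> f x \<in> X \<and> f' (f x) = x" "\<And>x. x \<in> X \<Longrightarrow> f' x \<in> X \<and> f (f' x) = x"
    "finite X" "set l \<subseteq> X"
  shows "push_fwd X f c l = c (map f' l)"
  using assms(4)
proof (induction l arbitrary: c)
  case (Cons y l)
  have "{x\<in>X. f x = y} = {f' y}" using assms(1,2) Cons.prems by force
  then show ?case using Cons by simp
qed simp

text \<open>At \<open>l\<close> the prism evaluates \<open>c\<close> only at nonempty tuples shorter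
  by one. This suits a resolution without augmentation, where nothing is known at the empty
  tuple.\<close>

lemma pris_eq_0:
  assumes "\<And>e. Suc (length e) = length l \<Longrightarrow> e \<noteq> [] \<Longrightarrow> set e \<subseteq> X \<Longrightarrow> c e = 0"
  shows "pris X f g c l = 0"
  using assms
proof (induction l arbitrary: c)
  case (Cons y l)
  have "pris X f g (\<lambda>l'. c (x # l')) l = 0" if "x \<in> X" for x
    using that Cons.prems by (intro Cons.IH) auto
  moreover have "push_fwd X g (\<lambda>l'. c (x # l')) l' = 0" if "x \<in> X" "l = z # l'" for x z l'
    using that Cons.prems by (intro push_fwd_eq_0) auto
  ultimately show ?case by (auto split: list.splits intro!: sum.neutral)
qed simp

lemma push_fwd_supp: "push_fwd X f c l \<noteq> 0 \<Longrightarrow> set l \<subseteq> f ` X"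
proof (induction l arbitrary: c)
  case (Cons y l)
  then obtain x where "x \<in> X" "f x = y" "push_fwd X f (\<lambda>l'. c (x # l')) l \<noteq> 0"
    by (auto elim!: sum.not_neutral_contains_not_neutral)
  then show ?case using Cons.IH by auto
qed simp

lemma pris_supp: "pris X f g c l \<noteq> 0 \<Longrightarrow> set l \<subseteq> f ` X \<union> g ` X"
proof (induction l arbitrary: c)
  case (Cons y l)
  from sum.not_neutral_contains_not_neutral[OF Cons.prems[unfolded pris.simps]]
  obtain x where x: "x \<in> X" "f x = y"
    "(case l of [] \<Rightarrow> 0 | z # l' \<Rightarrow> if z = g x then push_fwd X g (\<lambda>l'. c (x # l')) l' else 0) - pris X f g (\<lambda>l'. c (x # l')) l \<noteq> 0"
    by blast
  then consider "pris X f g (\<lambda>l'. c (x # l')) l \<noteq> 0"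
    | z l' where "l = z # l'" "z = g x" "push_fwd X g (\<lambda>l'. c (x # l')) l' \<noteq> 0"
    by (cases "pris X f g (\<lambda>l'. c (x # l')) l = 0") (auto split: list.splits if_splits)
  then show ?case
  proof cases
    case 1
    then show ?thesis using Cons.IH x by auto
  next
    case 2
    then show ?thesis using push_fwd_supp[OF 2(3)] x by auto
  qed
qed simp

section \<open>Polynomial systems of subgroups\<close>

text \<open>In the application \<open>M U\<close> is the image of the module at \<open>U\<close> in the module at \<open>\<Omega>\<close>, so that
  inclusions induce inclusions; \<open>M U / Z U B\<close> is then the \<open>|B|\<close>-fold derived module at \<open>U - B\<close>,
  and \<open>q - 1\<close> is the degree.\<close>

locale poly_system =
  fixes \<Omega> :: "nat set" and M :: "nat set \<Rightarrow> 'b::ab_group_add set"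
    and \<rho> :: "(nat \<Rightarrow> nat) \<Rightarrow> 'b \<Rightarrow> 'b" and m q :: nat and Z :: "nat set \<Rightarrow> nat set \<Rightarrow> 'b set"
  defines "Z U B \<equiv> {\<Sum>b\<in>B. f b |f. \<forall>b\<in>B. f b \<in> M (U - {b})}"
  assumes fin: "finite \<Omega>"
    and M_subgrp: "U \<subseteq> \<Omega> \<Longrightarrow> subgrp (M U)"
    and M_mono: "U \<subseteq> U' \<Longrightarrow> U' \<subseteq> \<Omega> \<Longrightarrow> M U \<subseteq> M U'"
    and \<rho>_M: "g permutes \<Omega> \<Longrightarrow> U \<subseteq> \<Omega> \<Longrightarrow> v \<in> M U \<Longrightarrow> \<rho> g v \<in> M (g ` U)"
    and \<rho>_add: "g permutes \<Omega> \<Longrightarrow> v \<in> M \<Omega> \<Longrightarrow> w \<in> M \<Omega> \<Longrightarrow> \<rho> g (v + w) = \<rho> g v + \<rho> g w"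
    and \<rho>_comp: "g permutes \<Omega> \<Longrightarrow> h permutes \<Omega> \<Longrightarrow> v \<in> M \<Omega> \<Longrightarrow> \<rho> (g \<circ> h) v = \<rho> g (\<rho> h v)"
    and \<rho>_fix: "g permutes \<Omega> \<Longrightarrow> U \<subseteq> \<Omega> \<Longrightarrow> v \<in> M U \<Longrightarrow> \<forall>u\<in>U. g u = u \<Longrightarrow> \<rho> g v = v"
    and inj_mod: "U \<subseteq> \<Omega> \<Longrightarrow> B \<subseteq> U \<Longrightarrow> x \<in> U \<Longrightarrow> x \<notin> B \<Longrightarrow> m < card U \<Longrightarrow>
        v \<in> M (U - {x}) \<Longrightarrow> v \<in> Z U B \<Longrightarrow> v \<in> Z (U - {x}) B"
    and vanish: "U \<subseteq> \<Omega> \<Longrightarrow> B \<subseteq> U \<Longrightarrow> m \<le> card U \<Longrightarrow> q \<le> card B \<Longrightarrow> M U \<subseteq> Z U B"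
begin

lemma fin_sub: "U \<subseteq> \<Omega> \<Longrightarrow> finite U"
  using fin finite_subset by blast

lemma M_sub: "U \<subseteq> \<Omega> \<Longrightarrow> v \<in> M U \<Longrightarrow> v \<in> M \<Omega>"
  using M_mono[of U \<Omega>] by auto

lemma \<rho>_additive: "g permutes \<Omega> \<Longrightarrow> additive_on (M \<Omega>) (\<rho> g)"
  using M_subgrp[of \<Omega>] \<rho>_add by (auto simp: additive_on_def)

lemma \<rho>_id: "v \<in> M \<Omega> \<Longrightarrow> \<rho> id v = v"
  by (rule \<rho>_fix[of id \<Omega>]) (auto simp: permutes_id)

lemma \<rho>_inv:
  assumes "g permutes \<Omega>" "v \<in> M \<Omega>"
  shows "\<rho> (inv g) (\<rho> g v) = v" "\<rho> g (\<rho> (inv g) v) = v"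
proof -
  note i = permutes_inv[OF assms(1)]
  show "\<rho> (inv g) (\<rho> g v) = v"
    using \<rho>_comp[OF i assms] permutes_inv_o[OF assms(1)] \<rho>_id[OF assms(2)] by simp
  show "\<rho> g (\<rho> (inv g) v) = v"
    using \<rho>_comp[OF assms(1) i assms(2)] permutes_inv_o[OF assms(1)] \<rho>_id[OF assms(2)] by simp
qed

lemma \<rho>_0 [simp]: "g permutes \<Omega> \<Longrightarrow> \<rho> g 0 = 0"
  by (rule additive_on_0[OF \<rho>_additive])

lemma \<rho>_eq_0: "g permutes \<Omega> \<Longrightarrow> v \<in> M \<Omega> \<Longrightarrow> \<rho> g v = 0 \<longleftrightarrow> v = 0"
  by (metis \<rho>_inv(1) \<rho>_0 permutes_inv)

lemma Z_subgrp:
  assumes "U \<subseteq> \<Omega>" shows "subgrp (Z U B)"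
  unfolding subgrp_def
proof (intro conjI ballI)
  have s: "subgrp (M (U - {b}))" for b using assms by (intro M_subgrp) auto
  show "0 \<in> Z U B" unfolding Z_def using s by (auto intro!: exI[of _ "\<lambda>_. 0"] simp: subgrp_0)
  fix a b assume "a \<in> Z U B" "b \<in> Z U B"
  then obtain f g where "a = sum f B" "b = sum g B" "\<forall>b\<in>B. f b \<in> M (U - {b})" "\<forall>b\<in>B. g b \<in> M (U - {b})"
    unfolding Z_def by auto
  then show "a - b \<in> Z U B" unfolding Z_def using s
    by (auto intro!: exI[of _ "\<lambda>x. f x - g x"] simp: sum_subtractf subgrp_diff)
qed

lemma Z_empty [simp]: "Z U {} = {0}"
  by (auto simp: Z_def)

lemma Z_mono:
  assumes "U \<subseteq> U'" "U' \<subseteq> \<Omega>" shows "Z U B \<subseteq> Z U' B"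
proof
  fix v assume "v \<in> Z U B"
  then obtain f where f: "v = sum f B" "\<And>b. b \<in> B \<Longrightarrow> f b \<in> M (U - {b})" unfolding Z_def by auto
  moreover have "M (U - {b}) \<subseteq> M (U' - {b})" for b using assms by (intro M_mono) auto
  ultimately show "v \<in> Z U' B" unfolding Z_def by auto
qed

text \<open>This is the passage to the next derived module: enlarging \<open>B\<close> by
  \<open>x\<close> divides out one more image, that of the points without \<open>x\<close>. The
  summand \<open>a\<close> serves later as a lift to coefficients avoiding \<open>x\<close>.\<close>

lemma Z_insert:
  assumes "finite B" "x \<notin> B"
  shows "v \<in> Z U (insert x B) \<longleftrightarrow> (\<exists>a\<in>M (U - {x}). \<exists>b\<in>Z U B. v = a + b)"
proof
  assume "v \<in> Z U (insert x B)"
  then obtain f where "v = sum f (insert x B)" "\<forall>b\<in>insert x B. f b \<in> M (U - {b})" unfolding Z_def by auto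
  then have "f x \<in> M (U - {x})" "sum f B \<in> Z U B" "v = f x + sum f B"
    using assms unfolding Z_def by auto
  then show "\<exists>a\<in>M (U - {x}). \<exists>b\<in>Z U B. v = a + b" by blast
next
  assume "\<exists>a\<in>M (U - {x}). \<exists>b\<in>Z U B. v = a + b"
  then obtain a f where *: "a \<in> M (U - {x})" "\<forall>b\<in>B. f b \<in> M (U - {b})" "v = a + sum f B"
    unfolding Z_def by auto
  have "v = sum (f(x := a)) (insert x B)" using * assms
    by (auto intro!: sum.cong)
  moreover have "\<forall>b\<in>insert x B. (f(x := a)) b \<in> M (U - {b})" using * by auto
  ultimately show "v \<in> Z U (insert x B)" unfolding Z_def by blast
qed

lemma Z_insert_mono:
  assumes "U \<subseteq> \<Omega>" "finite B" shows "Z U B \<subseteq> Z U (insert x B)"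
proof (cases "x \<in> B")
  case False
  have "0 \<in> M (U - {x})" using assms by (auto intro!: subgrp_0 M_subgrp)
  then show ?thesis using Z_insert[OF assms(2) False] by force
qed (auto simp: insert_absorb)

lemma \<rho>_Z:
  assumes "g permutes \<Omega>" "U \<subseteq> \<Omega>" "\<forall>b\<in>B. g b = b" "v \<in> Z U B"
  shows "\<rho> g v \<in> Z (g ` U) B"
proof -
  obtain f where f: "v = sum f B" "\<And>b. b \<in> B \<Longrightarrow> f b \<in> M (U - {b})"
    using assms(4) unfolding Z_def by auto
  have "\<rho> g (f b) \<in> M (g ` U - {b})" if "b \<in> B" for b
  proof -
    have "g ` (U - {b}) = g ` U - {b}"
      using assms(3) that permutes_inj[OF assms(1)] by (auto dest: injD)
    then show ?thesis using \<rho>_M[OF assms(1) _ f(2)[OF that]] assms(2) by auto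
  qed
  moreover have "\<rho> g v = (\<Sum>b\<in>B. \<rho> g (f b))" unfolding f(1)
    using f(2) assms(2) by (intro additive_on_sum[OF \<rho>_additive[OF assms(1)]]) (auto intro: M_sub[of "U - {_}"])
  ultimately show ?thesis unfolding Z_def by blast
qed

subsection \<open>Exactness of the complex of injective words\<close>

text \<open>A word uses up its letters, so its coefficient lives on the remaining points.
  \<open>Y\<close> may exceed the alphabet \<open>U\<close> by the points of shifts and
  derivations.\<close>

definition word_chain :: "nat set \<Rightarrow> nat set \<Rightarrow> nat \<Rightarrow> (nat list \<Rightarrow> 'b) \<Rightarrow> bool" where
  "word_chain Y U p c \<longleftrightarrow> (\<forall>w. c w \<noteq> 0 \<longrightarrow> distinct w \<and> set w \<subseteq> U \<and> length w = p) \<and> (\<forall>w. c w \<in> M (Y - set w))"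

definition zero_mod :: "nat set \<Rightarrow> nat set \<Rightarrow> (nat list \<Rightarrow> 'b) \<Rightarrow> bool" where
  "zero_mod Y B c \<longleftrightarrow> (\<forall>w. c w \<in> Z (Y - set w) B)"

lemma word_chain_0: "word_chain Y U p c \<Longrightarrow> \<not> (distinct w \<and> set w \<subseteq> U \<and> length w = p) \<Longrightarrow> c w = 0"
  unfolding word_chain_def by blast

lemma word_chain_M: "word_chain Y U p c \<Longrightarrow> c w \<in> M (Y - set w)"
  unfolding word_chain_def by blast

lemma word_chain_ins:
  assumes "word_chain Y U (Suc p) c" "Y \<subseteq> \<Omega>"
  shows "word_chain Y U p (ins U c)"
  unfolding word_chain_def
proof (intro conjI allI impI)
  fix w
  have "ins U c w = 0" if "\<not> (distinct w \<and> set w \<subseteq> U \<and> length w = p)"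
  proof (rule ins_eq_0)
    fix x w' assume x: "x \<in> U" "set w' = insert x (set w)" "length w' = Suc (length w)"
    then show "c w' = 0" using that distinct_insertD[OF x(2,3)]
      by (intro word_chain_0[OF assms(1)]) auto
  qed
  then show "ins U c w \<noteq> 0 \<Longrightarrow> distinct w" "ins U c w \<noteq> 0 \<Longrightarrow> set w \<subseteq> U" "ins U c w \<noteq> 0 \<Longrightarrow> length w = p"
    by blast+
  have "subgrp (M (Y - set w))" using assms(2) by (auto intro!: M_subgrp)
  then show "ins U c w \<in> M (Y - set w)"
  proof (rule ins_closed)
    fix x w' assume "set w' = insert x (set w)"
    then show "c w' \<in> M (Y - set w)"
      using word_chain_M[OF assms(1), of w'] M_mono[of "Y - set w'" "Y - set w"] assms(2) by auto
  qed
qed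

lemma word_chain_ins_0:
  assumes "word_chain Y U p c" "\<not> (distinct w \<and> set w \<subseteq> U \<and> Suc (length w) = p)"
  shows "ins U c w = 0"
proof (rule ins_eq_0)
  fix x w' assume x: "x \<in> U" "set w' = insert x (set w)" "length w' = Suc (length w)"
  then show "c w' = 0" using assms(2) distinct_insertD[OF x(2,3)]
    by (intro word_chain_0[OF assms(1)]) auto
qed

lemma zero_mod_ins:
  assumes "zero_mod Y B c" "Y \<subseteq> \<Omega>"
  shows "zero_mod Y B (ins U c)"
  unfolding zero_mod_def
proof
  fix w
  show "ins U c w \<in> Z (Y - set w) B"
  proof (rule ins_closed)
    show "subgrp (Z (Y - set w) B)" using assms(2) by (auto intro: Z_subgrp)
    fix x w' assume "set w' = insert x (set w)"
    then have "Z (Y - set w') B \<subseteq> Z (Y - set w) B"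
      using assms(2) by (intro Z_mono) auto
    then show "c w' \<in> Z (Y - set w) B"
      using assms(1) unfolding zero_mod_def by blast
  qed
qed

lemma zero_mod_add:
  "zero_mod Y B c \<Longrightarrow> zero_mod Y B c' \<Longrightarrow> Y \<subseteq> \<Omega> \<Longrightarrow> zero_mod Y B (\<lambda>w. c w + c' w)"
  unfolding zero_mod_def by (auto intro!: subgrp_add Z_subgrp)

lemma zero_mod_diff:
  "zero_mod Y B c \<Longrightarrow> zero_mod Y B c' \<Longrightarrow> Y \<subseteq> \<Omega> \<Longrightarrow> zero_mod Y B (\<lambda>w. c w - c' w)"
  unfolding zero_mod_def by (auto intro!: subgrp_diff Z_subgrp)

lemma word_chain_add:
  assumes "word_chain Y U p c" "word_chain Y U p c'" "Y \<subseteq> \<Omega>"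
  shows "word_chain Y U p (\<lambda>w. c w + c' w)"
proof -
  have "c w + c' w \<in> M (Y - set w)" for w
    using assms unfolding word_chain_def by (intro subgrp_add M_subgrp) auto
  moreover have "c w + c' w = 0" if "\<not> (distinct w \<and> set w \<subseteq> U \<and> length w = p)" for w
    using word_chain_0[OF assms(1) that] word_chain_0[OF assms(2) that] by simp
  ultimately show ?thesis unfolding word_chain_def by blast
qed

lemma word_chain_diff:
  assumes "word_chain Y U p c" "word_chain Y U p c'" "Y \<subseteq> \<Omega>"
  shows "word_chain Y U p (\<lambda>w. c w - c' w)"
proof -
  have "c w - c' w \<in> M (Y - set w)" for w
    using assms unfolding word_chain_def by (intro subgrp_diff M_subgrp) auto
  moreover have "c w - c' w = 0" if "\<not> (distinct w \<and> set w \<subseteq> U \<and> length w = p)" for w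
    using word_chain_0[OF assms(1) that] word_chain_0[OF assms(2) that] by simp
  ultimately show ?thesis unfolding word_chain_def by blast
qed

lemma word_chain_zero: "Y \<subseteq> \<Omega> \<Longrightarrow> word_chain Y U p (\<lambda>w. 0)"
  unfolding word_chain_def by (auto intro!: subgrp_0 M_subgrp)

lemma word_chainI:
  assumes "\<And>w. \<not> (distinct w \<and> set w \<subseteq> U \<and> length w = p) \<Longrightarrow> c w = 0"
    "\<And>w. distinct w \<Longrightarrow> set w \<subseteq> U \<Longrightarrow> length w = p \<Longrightarrow> c w \<in> M (Y - set w)" "Y \<subseteq> \<Omega>"
  shows "word_chain Y U p c"
  unfolding word_chain_def
proof (intro conjI allI impI)
  fix w
  have "0 \<in> M (Y - set w)" using assms(3) by (auto intro!: subgrp_0 M_subgrp)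
  then show "c w \<in> M (Y - set w)" using assms(1,2) by metis
qed (use assms(1) in blast)+

text \<open>Induction on the alphabet. Both recursive calls preserve the bound
  \<open>p + q \<le> card U + card B\<close>: the cone turns the letter \<open>x\<close> into an
  element of \<open>B\<close>, and fixing a prefix \<open>a @ [x]\<close> takes away as many letters
  as positions. Once \<open>q \<le> card B\<close> the coefficients vanish; before that, the bound
  supplies a letter.\<close>

lemma word_exact:
  assumes "Y \<subseteq> \<Omega>" "U \<subseteq> Y" "B \<subseteq> Y" "U \<inter> B = {}" "m \<le> card (Y - U)" "p + q \<le> card U + card B"
    "word_chain Y U p c" "zero_mod Y B (ins U c)"
  shows "\<exists>b. word_chain Y U (Suc p) b \<and> zero_mod Y B (\<lambda>w. c w - ins U b w)"
  using assms
proof (induction "card U" arbitrary: U Y B p c rule: less_induct)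
  case less
  note Y\<Omega> = \<open>Y \<subseteq> \<Omega>\<close>
  have fY: "finite Y" and fB: "finite B" and fU: "finite U"
    using fin_sub[OF Y\<Omega>] less.prems(2,3) finite_subset by blast+
  have YM: "subgrp (M (Y - A))" and YZ: "subgrp (Z (Y - A) B)" for A
    using Y\<Omega> by (auto intro!: M_subgrp Z_subgrp)
  show ?case
  proof (cases "q \<le> card B")
    case True
    have "c w \<in> Z (Y - set w) B" for w
    proof (cases "set w \<subseteq> U")
      case sw: True
      have "m \<le> card (Y - set w)"
        using sw fY by (intro order_trans[OF less.prems(5)] card_mono) auto
      moreover have "B \<subseteq> Y - set w" using sw less.prems(3,4) by auto
      ultimately show ?thesis
        using vanish[of "Y - set w" B] True word_chain_M[OF less.prems(7), of w] Y\<Omega> by auto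
    qed (use word_chain_0[OF less.prems(7)] YZ in \<open>auto simp: subgrp_0\<close>)
    then show ?thesis using word_chain_zero[OF Y\<Omega>]
      by (auto intro!: exI[of _ "\<lambda>w. 0"] simp: zero_mod_def)
  next
    case False
    then have "card U > 0" using less.prems(6) by auto
    then obtain x where x: "x \<in> U" by fastforce
    define U' where "U' = U - {x}"
    have U: "U = insert x U'" "x \<notin> U'" "finite U'" using x fU by (auto simp: U'_def)
    have cU: "card U = Suc (card U')" using U by simp
    have U'Y: "U' \<subseteq> Y" "x \<in> Y" "x \<notin> B" "U' \<inter> B = {}" using less.prems(2,4) U by auto
    text \<open>Once \<open>x\<close> occurs in \<open>c\<close> only as a first letter, \<open>c\<close> is a chain of the cone of
      the inclusion of the coefficients avoiding \<open>x\<close>, which computes the derived coefficients.\<close>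
    have base: "\<exists>b. word_chain Y U (Suc p) b \<and> zero_mod Y B (\<lambda>w. c w - ins U b w)"
      if c: "word_chain Y U p c" "zero_mod Y B (ins U c)" and c0: "\<And>a v. a \<noteq> [] \<Longrightarrow> c (a @ x # v) = 0" for c
    proof -
      define y0 where "y0 = (\<lambda>w. if x \<in> set w then 0 else c w)"
      have y0: "word_chain Y U' p y0"
        by (rule word_chainI) (use c(1) Y\<Omega> U in \<open>auto simp: y0_def word_chain_def\<close>)
      \<comment> \<open>Over a word \<open>v\<close> avoiding \<open>x\<close>, the letter
        \<open>x\<close> can be inserted only in front, as it occurs nowhere else in
        \<open>c\<close>.\<close>
      have insc: "ins U c v = ins U' y0 v + c (x # v)" if "x \<notin> set v" for v
      proof -
        have "ins U' c v = ins U' y0 v"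
          by (rule ins_cong) (use that U in \<open>auto simp: y0_def\<close>)
        then show ?thesis using ins_insert[of U' x c v] U ins_single[of c x v] c0 by simp
      qed
      have xZ: "M (Y - set v - {x}) \<subseteq> Z (Y - set v) (insert x B)" for v
      proof
        fix a assume "a \<in> M (Y - set v - {x})"
        then show "a \<in> Z (Y - set v) (insert x B)"
          using subgrp_0[OF YZ, of "set v"] unfolding Z_insert[OF fB \<open>x \<notin> B\<close>]
          by (intro bexI[of _ a] bexI[of _ 0]) auto
      qed
      have cyc: "zero_mod Y (insert x B) (ins U' y0)"
        unfolding zero_mod_def
      proof
        fix v
        show "ins U' y0 v \<in> Z (Y - set v) (insert x B)"
        proof (cases "x \<in> set v")
          case True
          then have "ins U' y0 v = 0" by (intro ins_eq_0) (auto simp: y0_def)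
          then show ?thesis using Y\<Omega> by (auto intro!: subgrp_0 Z_subgrp)
        next
          case False
          have sub: "Y - set v \<subseteq> \<Omega>" using Y\<Omega> by auto
          have "ins U c v \<in> Z (Y - set v) B" using c(2) unfolding zero_mod_def by blast
          then have 1: "ins U c v \<in> Z (Y - set v) (insert x B)"
            using Z_insert_mono[OF sub fB, of x] by blast
          have "Y - set (x # v) = Y - set v - {x}" by auto
          then have 2: "c (x # v) \<in> Z (Y - set v) (insert x B)"
            using word_chain_M[OF c(1), of "x # v"] xZ[of v] by auto
          have "ins U' y0 v = ins U c v - c (x # v)" using insc[OF False] by simp
          then show ?thesis using subgrp_diff[OF Z_subgrp[OF sub] 1 2] by simp
        qed
      qed
      have less_U: "card U' < card U" using cU by simp
      have B': "insert x B \<subseteq> Y" "U' \<inter> insert x B = {}" using U'Y U less.prems(3) by auto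
      have mU': "m \<le> card (Y - U')" using fY U by (intro order_trans[OF less.prems(5)] card_mono) auto
      have pU': "p + q \<le> card U' + card (insert x B)" using less.prems(6) cU fB U'Y by simp
      obtain b0 where b0: "word_chain Y U' (Suc p) b0" "zero_mod Y (insert x B) (\<lambda>w. y0 w - ins U' b0 w)"
        using less.hyps[OF less_U Y\<Omega> U'Y(1) B' mU' pU' y0 cyc] by blast
      define good where "good = (\<lambda>w. distinct w \<and> set w \<subseteq> U' \<and> length w = p)"
      \<comment> \<open>\<open>u\<close> is the part of the remainder that lies in the coefficients
        without \<open>x\<close> and can therefore be carried by the word \<open>x # w\<close>.
        Demanding 0 off the good words keeps it a word chain.\<close>
      have "\<exists>u. \<forall>w. u w \<in> M (Y - set w - {x}) \<and> y0 w - ins U' b0 w - u w \<in> Z (Y - set w) B \<and> (\<not> good w \<longrightarrow> u w = 0)"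
      proof (rule choice, rule allI)
        fix w
        show "\<exists>u. u \<in> M (Y - set w - {x}) \<and> y0 w - ins U' b0 w - u \<in> Z (Y - set w) B \<and> (\<not> good w \<longrightarrow> u = 0)"
        proof (cases "good w")
          case True
          obtain a b where "a \<in> M (Y - set w - {x})" "b \<in> Z (Y - set w) B" "y0 w - ins U' b0 w = a + b"
            using b0(2) Z_insert[OF fB \<open>x \<notin> B\<close>, of _ "Y - set w"] unfolding zero_mod_def by blast
          then show ?thesis using True by (intro exI[of _ a]) auto
        next
          case False
          then have "y0 w = 0" "ins U' b0 w = 0" using word_chain_0[OF y0, of w] word_chain_ins_0[OF b0(1), of w]
            unfolding good_def by auto
          moreover have "0 \<in> M (Y - set w - {x})" using Y\<Omega> by (auto intro!: subgrp_0 M_subgrp)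
          ultimately show ?thesis using subgrp_0[OF YZ] by auto
        qed
      qed
      then obtain u where u: "\<And>w. u w \<in> M (Y - set w - {x})" "\<And>w. y0 w - ins U' b0 w - u w \<in> Z (Y - set w) B"
        "\<And>w. \<not> good w \<Longrightarrow> u w = 0" by auto
      have u_chain: "word_chain Y U' p u"
      proof (rule word_chainI)
        fix w show "u w \<in> M (Y - set w)" using u(1)[of w] M_mono[of "Y - set w - {x}" "Y - set w"] Y\<Omega> by auto
      qed (use u(3) Y\<Omega> in \<open>auto simp: good_def\<close>)
      define b where "b = (\<lambda>w. case w of [] \<Rightarrow> 0 | y # v \<Rightarrow> if y = x then u v else b0 w)"
      have bx: "b (x # v) = u v" and b_no: "x \<notin> set w \<Longrightarrow> b w = b0 w" for v w
        using word_chain_0[OF b0(1), of "[]"] by (auto simp: b_def split: list.splits)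
      have b_later: "b (a @ x # v) = 0" if "a \<noteq> []" for a v
        using that U u(3) word_chain_0[OF b0(1), of "a @ x # v"] by (cases a) (auto simp: b_def good_def)
      have b_chain: "word_chain Y U (Suc p) b"
      proof (rule word_chainI)
        fix w assume *: "\<not> (distinct w \<and> set w \<subseteq> U \<and> length w = Suc p)"
        show "b w = 0"
        proof (cases w)
          case (Cons y v)
          show ?thesis
          proof (cases "y = x")
            case True
            then have "\<not> good v" using * Cons U by (auto simp: good_def)
            then show ?thesis using u(3) True Cons bx by simp
          next
            case False
            then show ?thesis using word_chain_0[OF b0(1), of w] * U Cons by (auto simp: b_def)
          qed
        qed (simp add: b_def)
      next
        fix w show "b w \<in> M (Y - set w)"
        proof (cases w)
          case (Cons y v)
          have eq: "Y - set (x # v) = Y - set v - {x}" by auto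
          show ?thesis
          proof (cases "y = x")
            case True
            then show ?thesis using u(1)[of v] eq Cons bx by simp
          next
            case False
            then have "b w = b0 w" using Cons by (simp add: b_def)
            then show ?thesis using word_chain_M[OF b0(1), of w] by simp
          qed
        qed (use subgrp_0[OF YM, of "{}"] in \<open>simp add: b_def\<close>)
      qed (rule Y\<Omega>)
      have "c w - ins U b w \<in> Z (Y - set w) B" for w
      proof (cases "x \<in> set w")
        case False
        have "ins U' b w = ins U' b0 w"
          by (rule ins_cong, rule b_no) (use False U(2) in auto)
        then have "ins U b w = ins U' b0 w + u w"
          using ins_insert[of U' x b w] U ins_single[of b x w] b_later bx by simp
        then show ?thesis using u(2)[of w] False by (simp add: y0_def algebra_simps)
      next
        case True
        then obtain a v where w: "w = a @ x # v" by (meson split_list)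
        have pre: "ins U b w = alt (Suc (length a)) (ins U (\<lambda>l. b (a @ x # l)) v)"
          unfolding w by (rule ins_prefix) (auto intro!: b_later)
        show ?thesis
        proof (cases "a = []")
          case False
          then show ?thesis using pre b_later c0 YZ w by (simp add: subgrp_0)
        next
          case a: True
          have insu: "ins U u v = ins U' u v"
            by (rule ins_set_mono) (use U fU u(3) in \<open>auto simp: good_def\<close>)
          have t: "c w - ins U b w = c (x # v) + ins U' u v"
            using pre a w insu bx by simp
          show ?thesis
          proof (cases "x \<notin> set v \<and> set v \<subseteq> U'")
            case False
            then have "c (x # v) = 0" using word_chain_0[OF c(1), of "x # v"] U by auto
            moreover have "ins U' u v = 0" using word_chain_ins_0[OF u_chain] False U by blast
            ultimately show ?thesis using t subgrp_0[OF YZ] by simp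
          next
            case v: True
            define z where "z = (\<lambda>w. y0 w - ins U' b0 w - u w)"
            have "zero_mod Y B z" using u(2) by (auto simp: zero_mod_def z_def)
            then have insz: "ins U' z v \<in> Z (Y - set v) B"
              using zero_mod_ins[OF _ Y\<Omega>] unfolding zero_mod_def by blast
            have "ins U' z v = ins U' y0 v - ins U' u v"
              unfolding z_def ins_diff by (simp add: ins_ins)
            then have "c (x # v) + ins U' u v = ins U c v - ins U' z v" using insc v by simp
            moreover have "ins U c v \<in> Z (Y - set v) B" using c(2) unfolding zero_mod_def by blast
            ultimately have tZ: "c (x # v) + ins U' u v \<in> Z (Y - set v) B"
              using subgrp_diff[OF YZ _ insz] by simp
            have "ins U' u v \<in> M (Y - set v - {x})"
            proof (rule ins_closed)
              show "subgrp (M (Y - set v - {x}))" using Y\<Omega> by (auto intro!: M_subgrp)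
              fix y w' assume "set w' = insert y (set v)"
              then have "M (Y - set w' - {x}) \<subseteq> M (Y - set v - {x})" using Y\<Omega> by (intro M_mono) auto
              then show "u w' \<in> M (Y - set v - {x})" using u(1)[of w'] by blast
            qed
            moreover have vx: "Y - set (x # v) = Y - set v - {x}" by auto
            moreover have "subgrp (M (Y - set v - {x}))" using Y\<Omega> by (intro M_subgrp) auto
            ultimately have tM: "c (x # v) + ins U' u v \<in> M (Y - set v - {x})"
              using word_chain_M[OF c(1), of "x # v"] by (auto intro: subgrp_add)
            \<comment> \<open>So far the remainder on \<open>x # v\<close> is in \<open>Z\<close>
              only for the larger set \<open>Y - set v\<close>. That set contains \<open>x\<close>
              and all of \<open>Y - U\<close>, hence has more than \<open>m\<close> points, and
              injectivity on the derived module brings the remainder down to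
              \<open>Y - set v - {x}\<close>.\<close>
            have "card (insert x (Y - U)) \<le> card (Y - set v)"
              using fY v U U'Y by (intro card_mono) auto
            then have "m < card (Y - set v)" using less.prems(5) fY x by simp
            then have "c (x # v) + ins U' u v \<in> Z (Y - set v - {x}) B"
              using tM tZ Y\<Omega> U'Y v less.prems(3) by (intro inj_mod) auto
            then show ?thesis unfolding t using w a vx by simp
          qed
        qed
      qed
      then show ?thesis using b_chain unfolding zero_mod_def by blast
    qed
    \<comment> \<open>Induction on the last position \<open>i\<close> at which \<open>x\<close> may
      occur; the case \<open>i = 0\<close> is \<open>base\<close>.\<close>
    have "\<exists>b. word_chain Y U (Suc p) b \<and> zero_mod Y B (\<lambda>w. c w - ins U b w)"
      if "word_chain Y U p c" "zero_mod Y B (ins U c)" "\<And>a v. length a > i \<Longrightarrow> c (a @ x # v) = 0" for c i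
      using that
    proof (induction i arbitrary: c)
      case 0
      then show ?case by (intro base) auto
    next
      case (Suc i0)
      define i where "i = Suc i0"
      note c = Suc.prems(1,2)
      have c0: "c (a @ x # v) = 0" if "length a > i" for a v using Suc.prems(3) that i_def by simp
      show ?case
      proof (cases "i < p")
        case False
        have "c (a @ x # v) = 0" if "length a > i0" for a v
          using that False by (intro word_chain_0[OF c(1)]) (auto simp: i_def)
        then show ?thesis using Suc.IH c by blast
      next
        case ip: True
        define good where "good = (\<lambda>a. distinct a \<and> set a \<subseteq> U' \<and> length a = i)"
        define z where "z = (\<lambda>a v. c (a @ x # v))"
        define Ya where "Ya = (\<lambda>a. Y - set a - {x})"
        define Ua where "Ua = (\<lambda>a. U' - set a)"
        \<comment> \<open>With \<open>x\<close> at its last possible position \<open>i\<close>,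
          insertions before \<open>x\<close> contribute nothing, so behind each prefix
          \<open>a\<close> the chain is a cycle of words in the letters \<open>Ua a\<close>, modulo
          \<open>Z\<close>. The induction hypothesis fills it.\<close>
        have "\<exists>W. \<forall>a. good a \<longrightarrow> word_chain (Ya a) (Ua a) (p - i) (W a) \<and>
            zero_mod (Ya a) B (\<lambda>v. z a v - ins (Ua a) (W a) v)"
        proof (rule choice, rule allI)
          fix a
          have "\<exists>W. word_chain (Ya a) (Ua a) (Suc (p - Suc i)) W \<and>
            zero_mod (Ya a) B (\<lambda>v. z a v - ins (Ua a) W v)" if "good a"
          proof (rule less.hyps)
            note g = that[unfolded good_def]
            show "card (Ua a) < card U" using cU U by (auto simp: Ua_def less_Suc_eq_le intro!: card_mono)
            show "Ya a \<subseteq> \<Omega>" "Ua a \<subseteq> Ya a" "B \<subseteq> Ya a" "Ua a \<inter> B = {}"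
              using Y\<Omega> U'Y U g less.prems(3) by (auto simp: Ya_def Ua_def)
            have "Ya a - Ua a = Y - U" using g U by (auto simp: Ya_def Ua_def)
            then show "m \<le> card (Ya a - Ua a)" using less.prems(5) by simp
            have "card (Ua a) = card U' - i" using g U card_Diff_subset[of "set a" U']
              by (simp add: Ua_def distinct_card)
            then show "p - Suc i + q \<le> card (Ua a) + card B" using less.prems(6) cU ip by simp
            show za: "word_chain (Ya a) (Ua a) (p - Suc i) (z a)"
            proof (rule word_chainI)
              fix v assume *: "\<not> (distinct v \<and> set v \<subseteq> Ua a \<and> length v = p - Suc i)"
              then show "z a v = 0" unfolding z_def using ip g U
                by (intro word_chain_0[OF c(1)]) (auto simp: Ua_def)
            next
              fix v
              have "Ya a - set v = Y - set (a @ x # v)" by (auto simp: Ya_def)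
              then show "z a v \<in> M (Ya a - set v)"
                using word_chain_M[OF c(1), of "a @ x # v"] by (simp add: z_def)
            qed (use \<open>Ya a \<subseteq> \<Omega>\<close> in auto)
            show "zero_mod (Ya a) B (ins (Ua a) (z a))"
              unfolding zero_mod_def
            proof
              fix v
              have "ins (Ua a) (z a) v = ins U (z a) v"
                by (rule ins_set_mono[symmetric])
                   (use U fU word_chain_0[OF za] in \<open>auto simp: Ua_def\<close>)
              also have "\<dots> = alt (Suc i) (ins U c (a @ x # v))"
                using ins_prefix[of a c x v U] c0 g by (simp add: z_def)
              also have "\<dots> \<in> Z (Y - set (a @ x # v)) B"
                by (rule subgrp_alt[OF YZ]) (use c(2) zero_mod_def in blast)
              also have "Y - set (a @ x # v) = Ya a - set v" by (auto simp: Ya_def)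
              finally show "ins (Ua a) (z a) v \<in> Z (Ya a - set v) B" .
            qed
          qed
          then show "\<exists>W. good a \<longrightarrow> word_chain (Ya a) (Ua a) (p - i) W \<and>
            zero_mod (Ya a) B (\<lambda>v. z a v - ins (Ua a) W v)" using ip by (simp add: Suc_diff_Suc)
        qed
        then obtain W where W: "\<And>a. good a \<Longrightarrow> word_chain (Ya a) (Ua a) (p - i) (W a)"
          "\<And>a. good a \<Longrightarrow> zero_mod (Ya a) B (\<lambda>v. z a v - ins (Ua a) (W a) v)" by blast
        \<comment> \<open>The sign compensates the one that arises from moving an insertion past
          \<open>a\<close> and \<open>x\<close>.\<close>
        define b where "b = (\<lambda>w. if i < length w \<and> w ! i = x \<and> good (take i w)
           then alt (Suc i) (W (take i w) (drop (Suc i) w)) else 0)"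
        have b_at: "b (a @ x # v) = (if good a then alt (Suc i) (W a v) else 0)" if "length a = i" for a v
          using that by (auto simp: b_def)
        have b_nz: "\<exists>a v. w = a @ x # v \<and> good a \<and> W a v \<noteq> 0" if "b w \<noteq> 0" for w
        proof -
          have "i < length w" "w ! i = x" "good (take i w)" "W (take i w) (drop (Suc i) w) \<noteq> 0"
            using that by (auto simp: b_def split: if_splits)
          then show ?thesis using id_take_nth_drop[of i w] by metis
        qed
        have b_chain: "word_chain Y U (Suc p) b"
        proof (rule word_chainI)
          fix w assume *: "\<not> (distinct w \<and> set w \<subseteq> U \<and> length w = Suc p)"
          show "b w = 0"
          proof (rule ccontr)
            assume "b w \<noteq> 0"
            then obtain a v where w: "w = a @ x # v" "good a" "W a v \<noteq> 0" using b_nz by blast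
            then have "distinct v" "set v \<subseteq> Ua a" "length v = p - i"
              using word_chain_0[OF W(1)[OF w(2)], of v] by blast+
            then show False using * w U ip by (auto simp: good_def Ua_def)
          qed
        next
          fix w
          show "b w \<in> M (Y - set w)"
          proof (cases "b w = 0")
            case False
            then obtain a v where w: "w = a @ x # v" "good a" using b_nz by blast
            have "Ya a - set v = Y - set w" using w by (auto simp: Ya_def)
            then show ?thesis using word_chain_M[OF W(1)[OF w(2)], of v] w b_at[of a v]
              by (auto simp: good_def intro!: subgrp_alt subgrp_uminus YM)
          qed (use subgrp_0[OF YM] in simp)
        qed (rule Y\<Omega>)
        \<comment> \<open>A word carrying \<open>b\<close> has \<open>x\<close> at position
          \<open>i\<close> and is distinct, so \<open>x\<close> cannot occur again further
          back.\<close>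
        have b_later: "b (a @ x # v) = 0" if "length a > i" for a v
        proof (rule ccontr)
          assume nz: "b (a @ x # v) \<noteq> 0"
          then have "distinct (a @ x # v)" using word_chain_0[OF b_chain] by blast
          moreover have "a ! i = x" "i < length a" using nz that by (auto simp: b_def nth_append split: if_splits)
          ultimately show False by (auto dest: nth_mem)
        qed
        define c1 where "c1 = (\<lambda>w. c w - ins U b w)"
        have ins_b: "ins U b (a @ x # v) = alt (Suc (length a)) (ins U (\<lambda>l. b (a @ x # l)) v)" if "length a \<ge> i" for a v
          using that by (intro ins_prefix b_later) auto
        have c1_later: "c1 (a @ x # v) = 0" if "length a > i" for a v
          using c0[OF that] b_later[OF that] ins_b[of a v] that by (simp add: c1_def)
        have c1_at: "c1 (a @ x # v) \<in> Z (Y - set (a @ x # v)) B" if "length a = i" for a v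
        proof (cases "good a")
          case True
          have "ins U (W a) v = ins (Ua a) (W a) v"
            by (rule ins_set_mono) (use U fU word_chain_0[OF W(1)[OF True]] in \<open>auto simp: Ua_def\<close>)
          then have "c1 (a @ x # v) = z a v - ins (Ua a) (W a) v"
            using ins_b[of a v] that True b_at[OF that] by (simp add: c1_def z_def ins_uminus ins_alt)
          moreover have "Ya a - set v = Y - set (a @ x # v)" by (auto simp: Ya_def)
          ultimately show ?thesis using W(2)[OF True] unfolding zero_mod_def by metis
        next
          case False
          then have "c (a @ x # v) = 0" using that U by (intro word_chain_0[OF c(1)]) (auto simp: good_def)
          moreover have "ins U b (a @ x # v) = 0" using ins_b[of a v] that False b_at[OF that] by simp
          ultimately show ?thesis using subgrp_0[OF YZ, of "set (a @ x # v)"] by (simp add: c1_def)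
        qed
        have c1_chain: "word_chain Y U p c1" unfolding c1_def
          by (intro word_chain_diff c word_chain_ins b_chain Y\<Omega>)
        \<comment> \<open>On words with \<open>x\<close> at position \<open>i\<close>,
          \<open>c1\<close> is only zero modulo \<open>Z\<close>. Cutting these values off gives the
          strict vanishing needed for \<open>i0\<close>, at the price of a chain in
          \<open>Z\<close>.\<close>
        define c2 where "c2 = (\<lambda>w. if \<exists>a v. w = a @ x # v \<and> length a \<ge> i then 0 else c1 w)"
        have c2_chain: "word_chain Y U p c2"
          by (rule word_chainI) (use word_chain_0[OF c1_chain] word_chain_M[OF c1_chain] subgrp_0[OF YM] Y\<Omega> in \<open>auto simp: c2_def\<close>)
        have c12: "zero_mod Y B (\<lambda>w. c1 w - c2 w)"
          unfolding zero_mod_def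
        proof
          fix w show "c1 w - c2 w \<in> Z (Y - set w) B"
          proof (cases "\<exists>a v. w = a @ x # v \<and> length a \<ge> i")
            case True
            then obtain a v where w: "w = a @ x # v" "length a \<ge> i" by blast
            then show ?thesis using True c1_at[of a v] c1_later[of a v] subgrp_0[OF YZ, of "set w"]
              by (cases "length a = i") (auto simp: c2_def)
          qed (use subgrp_0[OF YZ] in \<open>auto simp: c2_def\<close>)
        qed
        have "ins U c2 = (\<lambda>w. ins U c w - ins U (\<lambda>w. c1 w - c2 w) w)"
          by (auto simp: ins_diff c1_def ins_ins)
        then have "zero_mod Y B (ins U c2)"
          using zero_mod_diff[OF c(2) zero_mod_ins[OF c12 Y\<Omega>] Y\<Omega>] by simp
        moreover have "c2 (a @ x # v) = 0" if "length a > i0" for a v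
          using that by (auto simp: c2_def i_def)
        ultimately obtain b2 where b2: "word_chain Y U (Suc p) b2" "zero_mod Y B (\<lambda>w. c2 w - ins U b2 w)"
          using Suc.IH[OF c2_chain] by blast
        have "(\<lambda>w. c w - ins U (\<lambda>w. b w + b2 w) w) = (\<lambda>w. (c1 w - c2 w) + (c2 w - ins U b2 w))"
          by (auto simp: c1_def ins_add)
        then show ?thesis using zero_mod_add[OF c12 b2(2) Y\<Omega>] word_chain_add[OF b_chain b2(1) Y\<Omega>] by metis
      qed
    qed
    moreover have "c (a @ x # v) = 0" if "length a > p" for a v
      using that by (intro word_chain_0[OF less.prems(7)]) auto
    ultimately show ?thesis using less.prems(7,8) by blast
  qed
qed

end

lemma permutes_comp_iff:
  assumes "g permutes S" shows "g \<circ> h permutes S \<longleftrightarrow> h permutes S"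
proof
  assume *: "g \<circ> h permutes S"
  have "inv g \<circ> (g \<circ> h) = h" using permutes_inv_o(2)[OF assms] by (simp add: comp_assoc[symmetric])
  then show "h permutes S" using permutes_compose[OF * permutes_inv[OF assms]] by simp
qed (rule permutes_compose[OF _ assms])

context poly_system
begin

section \<open>The double complex\<close>

abbreviation X :: "(nat \<Rightarrow> nat) set" where "X \<equiv> {g. g permutes \<Omega>}"

definition equivariant :: "nat set \<Rightarrow> ((nat \<Rightarrow> nat) list \<Rightarrow> nat list \<Rightarrow> 'b) \<Rightarrow> bool" where
  "equivariant U c \<longleftrightarrow> (\<forall>g e w. g permutes U \<longrightarrow> c (map ((\<circ>) g) e) (map g w) = \<rho> g (c e w))"

definition chain :: "nat set \<Rightarrow> nat set \<Rightarrow> nat \<Rightarrow> ((nat \<Rightarrow> nat) list \<Rightarrow> nat list \<Rightarrow> 'b) \<Rightarrow> bool" where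
  "chain Y U L c \<longleftrightarrow>
     (\<forall>e w. c e w \<noteq> 0 \<longrightarrow> e \<noteq> [] \<and> set e \<subseteq> X \<and> distinct w \<and> set w \<subseteq> U \<and> length e + length w = L) \<and>
     (\<forall>e w. c e w \<in> M (Y - set w)) \<and> equivariant U c"

text \<open>Tuples \<open>e\<close> are the homogeneous simplices of a free \<open>Perm(\<Omega>)\<close>-resolution, words \<open>w\<close> the simplices of
  the complex of injective words, and equivariant functions stand for coinvariants. The resolution is
  not augmented, hence the value at \<open>e = []\<close> is set to \<open>0\<close>.\<close>

definition tot :: "nat set \<Rightarrow> ((nat \<Rightarrow> nat) list \<Rightarrow> nat list \<Rightarrow> 'b) \<Rightarrow> (nat \<Rightarrow> nat) list \<Rightarrow> nat list \<Rightarrow> 'b" where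
  "tot U c e w = (if e = [] then 0 else ins X (\<lambda>e. c e w) e + alt (length e) (ins U (c e) w))"

definition null :: "nat set \<Rightarrow> nat set \<Rightarrow> ((nat \<Rightarrow> nat) list \<Rightarrow> nat list \<Rightarrow> 'b) \<Rightarrow> bool" where
  "null Y B c \<longleftrightarrow> (\<forall>e. zero_mod Y B (c e))"

lemma finX [simp]: "finite X"
  by (rule finite_permutations[OF fin])

lemma X_comp_iff: "g permutes \<Omega> \<Longrightarrow> g \<circ> h permutes \<Omega> \<longleftrightarrow> h permutes \<Omega>"
  by (rule permutes_comp_iff)

lemma bij_X:
  assumes "g permutes \<Omega>" shows "bij_betw ((\<circ>) g) X X"
proof (rule bij_betwI[where g = "(\<circ>) (inv g)"])
  have "inv g permutes \<Omega>" using assms by (rule permutes_inv)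
  then show "(\<circ>) g \<in> X \<rightarrow> X" "(\<circ>) (inv g) \<in> X \<rightarrow> X" using assms X_comp_iff by auto
qed (auto simp: comp_assoc[symmetric] permutes_inv_o[OF assms])

lemma set_map_X: "g permutes \<Omega> \<Longrightarrow> set (map ((\<circ>) g) e) \<subseteq> X \<longleftrightarrow> set e \<subseteq> X"
  using X_comp_iff by auto

lemma perm_sub: "g permutes U \<Longrightarrow> U \<subseteq> \<Omega> \<Longrightarrow> g permutes \<Omega>"
  by (rule permutes_subset)

lemma perm_image: "g permutes U \<Longrightarrow> U \<subseteq> Y \<Longrightarrow> g ` (Y - set w) = Y - set (map g w)"
  using permutes_image[OF permutes_subset[of g U Y]] permutes_inj[of g U] by (simp add: image_set_diff)

lemma perm_map_sub: "g permutes U \<Longrightarrow> set (map g w) \<subseteq> U \<longleftrightarrow> set w \<subseteq> U"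
  using permutes_in_image[of g U] by auto

lemma perm_map_distinct: "g permutes U \<Longrightarrow> distinct (map g w) \<longleftrightarrow> distinct w"
  using permutes_inj_on[of g U "set w"] by (simp add: distinct_map)

lemma map_inv_perm:
  assumes "g permutes U"
  shows "map g (map (inv g) w) = w" "map (inv g) (map g w) = w"
    "map ((\<circ>) g) (map ((\<circ>) (inv g)) e) = e" "map ((\<circ>) (inv g)) (map ((\<circ>) g) e) = e"
  using permutes_inv_o[OF assms] permutes_inverses[OF assms]
  by (auto simp: comp_def fun_eq_iff intro!: map_idI)

lemma chain_0: "chain Y U L c \<Longrightarrow>
    \<not> (e \<noteq> [] \<and> set e \<subseteq> X \<and> distinct w \<and> set w \<subseteq> U \<and> length e + length w = L) \<Longrightarrow> c e w = 0"
  unfolding chain_def by blast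

lemma chain_M: "chain Y U L c \<Longrightarrow> c e w \<in> M (Y - set w)"
  unfolding chain_def by blast

lemma chain_M\<Omega>: "chain Y U L c \<Longrightarrow> Y \<subseteq> \<Omega> \<Longrightarrow> c e w \<in> M \<Omega>"
  by (rule M_sub[of "Y - set w"]) (auto simp: chain_M)

lemma chain_eq: "chain Y U L c \<Longrightarrow> g permutes U \<Longrightarrow> c (map ((\<circ>) g) e) (map g w) = \<rho> g (c e w)"
  unfolding chain_def equivariant_def by blast

text \<open>The support conditions are invariant under \<open>g\<close>, so equivariance has to be
  checked only where the chain may be nonzero.\<close>

lemma chainI:
  assumes "\<And>e w. \<not> (e \<noteq> [] \<and> set e \<subseteq> X \<and> distinct w \<and> set w \<subseteq> U \<and> length e + length w = L) \<Longrightarrow> c e w = 0"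
    "\<And>e w. e \<noteq> [] \<Longrightarrow> set e \<subseteq> X \<Longrightarrow> distinct w \<Longrightarrow> set w \<subseteq> U \<Longrightarrow> c e w \<in> M (Y - set w)"
    "\<And>g e w. g permutes U \<Longrightarrow> e \<noteq> [] \<Longrightarrow> set e \<subseteq> X \<Longrightarrow> distinct w \<Longrightarrow> set w \<subseteq> U \<Longrightarrow> length e + length w = L \<Longrightarrow>
       c (map ((\<circ>) g) e) (map g w) = \<rho> g (c e w)"
    "Y \<subseteq> \<Omega>" "U \<subseteq> Y"
  shows "chain Y U L c"
  unfolding chain_def equivariant_def
proof (intro conjI allI impI)
  fix e w
  have "0 \<in> M (Y - set w)" using assms(4) by (auto intro!: subgrp_0 M_subgrp)
  then show "c e w \<in> M (Y - set w)" using assms(1,2) by metis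
  fix g assume g: "g permutes U"
  then have g\<Omega>: "g permutes \<Omega>" using assms(4,5) by (auto intro: perm_sub)
  show "c (map ((\<circ>) g) e) (map g w) = \<rho> g (c e w)"
  proof (cases "e \<noteq> [] \<and> set e \<subseteq> X \<and> distinct w \<and> set w \<subseteq> U \<and> length e + length w = L")
    case True
    then show ?thesis using assms(3)[OF g] by blast
  next
    case False
    then have "c (map ((\<circ>) g) e) (map g w) = 0"
      using perm_map_distinct[OF g] perm_map_sub[OF g] set_map_X[OF g\<Omega>] by (intro assms(1)) auto
    then show ?thesis using assms(1)[OF False] g\<Omega> by simp
  qed
qed (use assms(1) in blast)+

lemma chain_comb:
  assumes "chain Y U L c" "chain Y U L c'" "Y \<subseteq> \<Omega>" "U \<subseteq> Y"
  shows chain_add: "chain Y U L (\<lambda>e w. c e w + c' e w)"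
    and chain_diff: "chain Y U L (\<lambda>e w. c e w - c' e w)"
proof -
  have s: "subgrp (M (Y - set w))" for w :: "nat list" using assms(3) by (auto intro: M_subgrp)
  have g: "additive_on (M \<Omega>) (\<rho> g)" if "g permutes U" for g
    using \<rho>_additive perm_sub[OF that] assms(3,4) by blast
  note m = chain_M\<Omega>[OF assms(1,3)] chain_M\<Omega>[OF assms(2,3)]
  show "chain Y U L (\<lambda>e w. c e w + c' e w)"
    by (rule chainI) (use assms(3,4) chain_0[OF assms(1)] chain_0[OF assms(2)] chain_M[OF assms(1)] chain_M[OF assms(2)]
        chain_eq[OF assms(1)] chain_eq[OF assms(2)] additive_on_add[OF g] m in \<open>auto intro!: subgrp_add[OF s]\<close>)
  show "chain Y U L (\<lambda>e w. c e w - c' e w)"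
    by (rule chainI) (use assms(3,4) chain_0[OF assms(1)] chain_0[OF assms(2)] chain_M[OF assms(1)] chain_M[OF assms(2)]
        chain_eq[OF assms(1)] chain_eq[OF assms(2)] additive_on_diff[OF g] m in \<open>auto intro!: subgrp_diff[OF s]\<close>)
qed

lemma chain_zero: "Y \<subseteq> \<Omega> \<Longrightarrow> U \<subseteq> Y \<Longrightarrow> chain Y U L (\<lambda>e w. 0)"
  using perm_sub[OF _ order_trans[of U Y \<Omega>]] by (intro chainI) (auto intro!: subgrp_0 M_subgrp)

lemma chain_restrict:
  assumes "chain Y U L c" "Y \<subseteq> \<Omega>" "U \<subseteq> Y"
  shows "chain Y U L (\<lambda>e w. if P (length w) then c e w else 0)"
proof -
  have "0 \<in> M (Y - set w)" for w :: "nat list" using assms(2) by (auto intro!: subgrp_0 M_subgrp)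
  then show ?thesis
    by (intro chainI) (use assms chain_0[OF assms(1)] chain_M[OF assms(1)] chain_eq[OF assms(1)] perm_sub[of _ U] in auto)
qed

lemma tot_add: "tot U (\<lambda>e w. c e w + c' e w) e w = tot U c e w + tot U c' e w"
  by (simp add: tot_def ins_add alt_add)

lemma tot_diff: "tot U (\<lambda>e w. c e w - c' e w) e w = tot U c e w - tot U c' e w"
  by (simp add: tot_def ins_diff alt_diff)

text \<open>\<open>ins X\<close> evaluates its chain at tuples longer by one, so the sign
  \<open>alt (length e)\<close> makes the two commuting differentials anticommute.\<close>

lemma tot_tot: "tot U (tot U c) e w = 0"
proof (cases "e = []")
  case False
  have "ins X (\<lambda>e. tot U c e w) e = ins X (\<lambda>e'. ins X (\<lambda>e. c e w) e' + alt (Suc (length e)) (ins U (c e') w)) e"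
    by (rule ins_cong) (use False in \<open>auto simp: tot_def\<close>)
  moreover have "ins U (tot U c e) w = ins U (\<lambda>w. ins X (\<lambda>e. c e w) e) w"
  proof -
    have "tot U c e = (\<lambda>w. ins X (\<lambda>e. c e w) e + alt (length e) (ins U (c e) w))"
      using False by (simp add: tot_def fun_eq_iff)
    then show ?thesis by (simp add: ins_add ins_alt ins_ins)
  qed
  ultimately show ?thesis using False
    by (simp add: tot_def[of U "tot U c"] ins_add ins_diff ins_ins ins_uminus ins_alt ins_comm[of X U c w e])
qed (simp add: tot_def)

lemma null_comb:
  assumes "null Y B c" "null Y B c'" "Y \<subseteq> \<Omega>"
  shows null_add: "null Y B (\<lambda>e w. c e w + c' e w)" and null_diff: "null Y B (\<lambda>e w. c e w - c' e w)"
  using assms zero_mod_add zero_mod_diff unfolding null_def by auto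

lemma null_tot:
  assumes "null Y B c" "Y \<subseteq> \<Omega>"
  shows "null Y B (tot U c)"
  unfolding null_def zero_mod_def
proof (intro allI)
  fix e w
  have s: "subgrp (Z (Y - set w) B)" using assms(2) by (auto intro: Z_subgrp)
  have "ins X (\<lambda>e. c e w) e \<in> Z (Y - set w) B"
    by (rule ins_closed[OF s]) (use assms(1) in \<open>auto simp: null_def zero_mod_def\<close>)
  moreover have "ins U (c e) w \<in> Z (Y - set w) B"
    using zero_mod_ins[of Y B "c e" U] assms unfolding null_def zero_mod_def by blast
  ultimately show "tot U c e w \<in> Z (Y - set w) B"
    using s by (auto simp: tot_def intro!: subgrp_add subgrp_alt subgrp_0)
qed

lemma chain_word:
  assumes "chain Y U L c" "Y \<subseteq> \<Omega>"
  shows "word_chain Y U (L - length e) (c e)"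
proof (rule word_chainI)
  fix w assume "\<not> (distinct w \<and> set w \<subseteq> U \<and> length w = L - length e)"
  then show "c e w = 0" by (intro chain_0[OF assms(1)]) auto
qed (use assms chain_M[OF assms(1)] in auto)

lemma chain_tot:
  assumes c: "chain Y U (Suc L) c" and Y: "Y \<subseteq> \<Omega>" "U \<subseteq> Y"
  shows "chain Y U L (tot U c)"
proof (rule chainI)
  fix e w assume *: "\<not> (e \<noteq> [] \<and> set e \<subseteq> X \<and> distinct w \<and> set w \<subseteq> U \<and> length e + length w = L)"
  show "tot U c e w = 0"
  proof (cases "e = []")
    case False
    have "ins X (\<lambda>e. c e w) e = 0"
      by (rule ins_eq_0, rule chain_0[OF c]) (use * False in auto)
    moreover have "ins U (c e) w = 0"
    proof (rule ins_eq_0)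
      fix x w' assume x: "x \<in> U" "set w' = insert x (set w)" "length w' = Suc (length w)"
      show "c e w' = 0" using * False x distinct_insertD[OF x(2,3)] by (intro chain_0[OF c]) auto
    qed
    ultimately show ?thesis by (simp add: tot_def)
  qed (simp add: tot_def)
next
  fix e w
  have s: "subgrp (M (Y - set w))" using Y by (auto intro: M_subgrp)
  have "ins X (\<lambda>e. c e w) e \<in> M (Y - set w)"
    by (rule ins_closed[OF s]) (rule chain_M[OF c])
  moreover have "ins U (c e) w \<in> M (Y - set w)"
  proof (rule ins_closed[OF s])
    fix x w' assume "set w' = insert x (set w)"
    then have "M (Y - set w') \<subseteq> M (Y - set w)" using Y by (intro M_mono) auto
    then show "c e w' \<in> M (Y - set w)" using chain_M[OF c] by blast
  qed
  ultimately show "tot U c e w \<in> M (Y - set w)"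
    using s by (auto simp: tot_def intro!: subgrp_add subgrp_alt subgrp_0)
next
  fix g w and e :: "(nat \<Rightarrow> nat) list" assume g: "g permutes U" and e: "e \<noteq> []"
  have g\<Omega>: "g permutes \<Omega>" using perm_sub[OF g] Y by auto
  note m = chain_M\<Omega>[OF c Y(1)]
  note add = \<rho>_additive[OF g\<Omega>] and sM = M_subgrp[OF order_refl]
  have "ins X (\<lambda>e. c e (map g w)) (map ((\<circ>) g) e) = ins X (\<lambda>e. c (map ((\<circ>) g) e) (map g w)) e"
    by (rule ins_map[OF bij_X[OF g\<Omega>]])
  also have "\<dots> = \<rho> g (ins X (\<lambda>e. c e w) e)"
    unfolding chain_eq[OF c g] by (rule ins_additive[OF add m])
  finally have 1: "ins X (\<lambda>e. c e (map g w)) (map ((\<circ>) g) e) = \<rho> g (ins X (\<lambda>e. c e w) e)" .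
  have "ins U (c (map ((\<circ>) g) e)) (map g w) = ins U (\<lambda>w. c (map ((\<circ>) g) e) (map g w)) w"
    by (rule ins_map) (rule permutes_imp_bij[OF g])
  also have "\<dots> = \<rho> g (ins U (c e) w)"
    unfolding chain_eq[OF c g] by (rule ins_additive[OF add m])
  finally have 2: "ins U (c (map ((\<circ>) g) e)) (map g w) = \<rho> g (ins U (c e) w)" .
  have "ins X (\<lambda>e. c e w) e \<in> M \<Omega>" "ins U (c e) w \<in> M \<Omega>"
    by (rule ins_closed[OF sM m])+
  then show "tot U c (map ((\<circ>) g) e) (map g w) = \<rho> g (tot U c e w)"
    using e 1 2 by (simp add: tot_def additive_on_add[OF add] additive_on_alt[OF add] subgrp_alt[OF sM])
qed (use Y in auto)

text \<open>Every \<open>e\<close> factors as \<open>r e \<circ> rep e\<close>, where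
  \<open>rep e\<close> represents the coset \<open>Perm(U) e\<close>; the identity represents
  \<open>Perm(U)\<close> itself. Thus \<open>r\<close> compares the resolution built from
  \<open>Perm(\<Omega>)\<close> with the standard one of \<open>Perm(U)\<close>.\<close>

lemma ex_retraction:
  assumes "U \<subseteq> \<Omega>"
  obtains r where "\<And>e. e permutes \<Omega> \<Longrightarrow> r e permutes U"
    "\<And>g e. g permutes U \<Longrightarrow> e permutes \<Omega> \<Longrightarrow> r (g \<circ> e) = g \<circ> r e" "\<And>e. e permutes U \<Longrightarrow> r e = e"
proof -
  define orb where "orb = (\<lambda>e :: nat \<Rightarrow> nat. {g \<circ> e | g. g permutes U})"
  define rep where "rep = (\<lambda>e. if e permutes U then id else (SOME e'. e' \<in> orb e))"
  define r where "r = (\<lambda>e. e \<circ> inv (rep e))"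
  have inU: "g \<circ> e permutes U \<longleftrightarrow> e permutes U" if "g permutes U" for g e
    by (rule permutes_comp_iff[OF that])
  have orb_g: "orb (g \<circ> e) = orb e" if "g permutes U" for g e
  proof -
    have "h \<circ> e = (h \<circ> inv g) \<circ> (g \<circ> e) \<and> h \<circ> inv g permutes U" if "h permutes U" for h
      using that \<open>g permutes U\<close> permutes_inv_o(2)[OF \<open>g permutes U\<close>]
      by (simp add: comp_assoc permutes_compose permutes_inv) (metis comp_assoc id_comp)
    moreover have "h \<circ> (g \<circ> e) = (h \<circ> g) \<circ> e \<and> h \<circ> g permutes U" if "h permutes U" for h
      using that \<open>g permutes U\<close> by (simp add: comp_assoc permutes_compose)
    ultimately show ?thesis unfolding orb_def by blast
  qed
  have rep: "rep e \<in> orb e" for e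
  proof (cases "e permutes U")
    case True
    then have "id = inv e \<circ> e \<and> inv e permutes U" by (simp add: permutes_inv permutes_inv_o)
    then show ?thesis using True by (auto simp: rep_def orb_def)
  next
    case False
    have "id \<circ> e \<in> orb e" unfolding orb_def using permutes_id by blast
    then have "(SOME e'. e' \<in> orb e) \<in> orb e" by (rule someI[of "\<lambda>e'. e' \<in> orb e"])
    then show ?thesis using False by (simp add: rep_def)
  qed
  have "r e permutes U" if e: "e permutes \<Omega>" for e
  proof -
    obtain g where g: "rep e = g \<circ> e" "g permutes U" using rep[of e] by (auto simp: orb_def)
    have "r e = inv g"
      using permutes_bij[OF e] permutes_bij[OF g(2)] permutes_inv_o[OF e]
      by (simp add: r_def g(1) o_inv_distrib) (metis comp_assoc id_comp)
    then show ?thesis using permutes_inv[OF g(2)] by simp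
  qed
  moreover have "r (g \<circ> e) = g \<circ> r e" if "g permutes U" for g e
    using inU[OF that] orb_g[OF that] by (simp add: r_def rep_def comp_assoc)
  moreover have "r e = e" if "e permutes U" for e
    using that by (simp add: r_def rep_def)
  ultimately show thesis using that by blast
qed

text \<open>\<open>Perm(U)\<close> acts freely on nonempty tuples in \<open>X\<close>, so pointwise choices can be made equivariantly.\<close>

lemma equivariant_choice:
  assumes U: "U \<subseteq> \<Omega>"
    and ex: "\<And>e. e \<noteq> [] \<Longrightarrow> set e \<subseteq> X \<Longrightarrow> \<exists>f. Q e f"
    and QM: "\<And>e f w. Q e f \<Longrightarrow> f w \<in> M \<Omega>"
    and Qg: "\<And>g e f. g permutes U \<Longrightarrow> e \<noteq> [] \<Longrightarrow> set e \<subseteq> X \<Longrightarrow> Q e f \<Longrightarrow>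
               Q (map ((\<circ>) g) e) (\<lambda>w. \<rho> g (f (map (inv g) w)))"
  obtains c where "\<And>e. e \<noteq> [] \<Longrightarrow> set e \<subseteq> X \<Longrightarrow> Q e (c e)"
    "\<And>e w. \<not> (e \<noteq> [] \<and> set e \<subseteq> X) \<Longrightarrow> c e w = 0" "equivariant U c"
proof -
  obtain r where r: "\<And>e. e permutes \<Omega> \<Longrightarrow> r e permutes U"
    "\<And>g e. g permutes U \<Longrightarrow> e permutes \<Omega> \<Longrightarrow> r (g \<circ> e) = g \<circ> r e"
    by (rule ex_retraction[OF U]) blast
  obtain F where F: "\<And>e. e \<noteq> [] \<Longrightarrow> set e \<subseteq> X \<Longrightarrow> Q e (F e)" using ex by metis
  \<comment> \<open>\<open>n e\<close> is the translate of \<open>e\<close> whose first entry is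
    sent to \<open>id\<close> by \<open>r\<close>. The choice is made there and carried back by
    \<open>r (hd e)\<close>, which depends equivariantly on \<open>e\<close>.\<close>
  define n where "n = (\<lambda>e. map ((\<circ>) (inv (r (hd e)))) e)"
  define c where "c = (\<lambda>e w. if e \<noteq> [] \<and> set e \<subseteq> X then \<rho> (r (hd e)) (F (n e) (map (inv (r (hd e))) w)) else 0)"
  have n: "n e \<noteq> [] \<and> set (n e) \<subseteq> X" and rU: "r (hd e) permutes U" if "e \<noteq> []" "set e \<subseteq> X" for e
  proof -
    show rU: "r (hd e) permutes U" using that by (intro r(1)) (cases e; auto)
    have "inv (r (hd e)) permutes \<Omega>" by (rule perm_sub[OF permutes_inv[OF rU] U])
    then show "n e \<noteq> [] \<and> set (n e) \<subseteq> X" using that set_map_X unfolding n_def by auto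
  qed
  show thesis
  proof (rule that)
    fix e :: "(nat \<Rightarrow> nat) list" assume e: "e \<noteq> []" "set e \<subseteq> X"
    have "Q (map ((\<circ>) (r (hd e))) (n e)) (\<lambda>w. \<rho> (r (hd e)) (F (n e) (map (inv (r (hd e))) w)))"
      using n[OF e] by (intro Qg rU[OF e] F) auto
    moreover have "map ((\<circ>) (r (hd e))) (n e) = e" unfolding n_def by (rule map_inv_perm(3)[OF rU[OF e]])
    moreover have "c e = (\<lambda>w. \<rho> (r (hd e)) (F (n e) (map (inv (r (hd e))) w)))" using e by (simp add: c_def)
    ultimately show "Q e (c e)" by simp
  next
    show "equivariant U c" unfolding equivariant_def
    proof (intro allI impI)
      fix g e w assume g: "g permutes U"
      have g\<Omega>: "g permutes \<Omega>" by (rule perm_sub[OF g U])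
      show "c (map ((\<circ>) g) e) (map g w) = \<rho> g (c e w)"
      proof (cases "e \<noteq> [] \<and> set e \<subseteq> X")
        case True
        let ?r = "r (hd e)"
        have ru: "?r permutes U" using rU True by blast
        have hd: "r (hd (map ((\<circ>) g) e)) = g \<circ> ?r"
          using True r(2)[OF g, of "hd e"] by (cases e) auto
        have inv: "inv (g \<circ> ?r) = inv ?r \<circ> inv g"
          using permutes_bij[OF g] permutes_bij[OF ru] by (rule o_inv_distrib)
        have "n (map ((\<circ>) g) e) = n e"
          unfolding n_def hd inv using permutes_inv_o(2)[OF g]
          by (auto simp: comp_assoc intro!: map_cong) (metis comp_assoc id_comp)
        moreover have "map (inv (g \<circ> ?r)) (map g w) = map (inv ?r) w"
          unfolding inv using permutes_inverses(2)[OF g] by (simp add: comp_def)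
        moreover have "map ((\<circ>) g) e \<noteq> [] \<and> set (map ((\<circ>) g) e) \<subseteq> X" using True set_map_X[OF g\<Omega>, of e] by simp
        ultimately have "c (map ((\<circ>) g) e) (map g w) = \<rho> (g \<circ> ?r) (F (n e) (map (inv ?r) w))"
          unfolding c_def hd by presburger
        also have "\<dots> = \<rho> g (\<rho> ?r (F (n e) (map (inv ?r) w)))"
          using n[of e] True F by (intro \<rho>_comp g\<Omega> perm_sub[OF ru U] QM[of "n e" "F (n e)"]) auto
        finally show ?thesis using True by (simp add: c_def)
      next
        case False
        then have "c e w = 0" unfolding c_def by presburger
        moreover have "\<not> (map ((\<circ>) g) e \<noteq> [] \<and> set (map ((\<circ>) g) e) \<subseteq> X)"
          using False set_map_X[OF g\<Omega>, of e] by simp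
        then have "c (map ((\<circ>) g) e) (map g w) = 0" unfolding c_def by presburger
        ultimately show ?thesis using g\<Omega> by simp
      qed
    qed
  qed (unfold c_def, presburger)
qed

lemma word_chain_perm:
  assumes "word_chain Y U p f" "g permutes U" "Y \<subseteq> \<Omega>" "U \<subseteq> Y"
  shows "word_chain Y U p (\<lambda>w. \<rho> g (f (map (inv g) w)))"
proof -
  have g\<Omega>: "g permutes \<Omega>" using perm_sub[OF assms(2)] assms(3,4) by auto
  note i = permutes_inv[OF assms(2)]
  show ?thesis
  proof (rule word_chainI)
    fix w assume "\<not> (distinct w \<and> set w \<subseteq> U \<and> length w = p)"
    then have "f (map (inv g) w) = 0"
      using perm_map_sub[OF i, of w] perm_map_distinct[OF i, of w] by (intro word_chain_0[OF assms(1)]) auto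
    then show "\<rho> g (f (map (inv g) w)) = 0" using g\<Omega> by simp
  next
    fix w
    have "\<rho> g (f (map (inv g) w)) \<in> M (g ` (Y - set (map (inv g) w)))"
      using assms(3) by (intro \<rho>_M g\<Omega> word_chain_M[OF assms(1)]) auto
    then show "\<rho> g (f (map (inv g) w)) \<in> M (Y - set w)"
      unfolding perm_image[OF assms(2,4)] map_inv_perm(1)[OF assms(2)] .
  qed (rule assms(3))
qed

lemma zero_mod_perm:
  assumes "zero_mod Y B f" "g permutes U" "Y \<subseteq> \<Omega>" "U \<subseteq> Y" "U \<inter> B = {}"
  shows "zero_mod Y B (\<lambda>w. \<rho> g (f (map (inv g) w)))"
  unfolding zero_mod_def
proof
  fix w
  have g\<Omega>: "g permutes \<Omega>" using perm_sub[OF assms(2)] assms(3,4) by auto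
  have "\<forall>b\<in>B. g b = b" using assms(2,5) by (auto simp: permutes_def)
  moreover have "f (map (inv g) w) \<in> Z (Y - set (map (inv g) w)) B" using assms(1) zero_mod_def by blast
  ultimately have "\<rho> g (f (map (inv g) w)) \<in> Z (g ` (Y - set (map (inv g) w))) B"
    using assms(3) by (intro \<rho>_Z g\<Omega>) auto
  then show "\<rho> g (f (map (inv g) w)) \<in> Z (Y - set w) B"
    unfolding perm_image[OF assms(2,4)] map_inv_perm(1)[OF assms(2)] .
qed

lemma ins_perm:
  assumes "g permutes U" "Y \<subseteq> \<Omega>" "U \<subseteq> Y" "\<And>w. f w \<in> M \<Omega>"
  shows "ins U (\<lambda>w. \<rho> g (f (map (inv g) w))) w = \<rho> g (ins U f (map (inv g) w))"
proof -
  have g\<Omega>: "g permutes \<Omega>" using perm_sub[OF assms(1)] assms(2,3) by auto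
  have "ins U (\<lambda>w. \<rho> g (f (map (inv g) w))) w = \<rho> g (ins U (\<lambda>w. f (map (inv g) w)) w)"
    by (rule ins_additive[OF \<rho>_additive[OF g\<Omega>] assms(4)])
  also have "ins U (\<lambda>w. f (map (inv g) w)) w = ins U f (map (inv g) w)"
    using ins_map[OF permutes_imp_bij[OF permutes_inv[OF assms(1)]], of f w] by simp
  finally show ?thesis .
qed

text \<open>The staircase argument: the part of lowest word length \<open>p\<close> is a cycle of
  words for each fixed \<open>e\<close>, modulo \<open>Z\<close>, and is filled there; what remains
  starts at word length \<open>p + 1\<close>. As \<open>e\<close> is nonempty, \<open>p < L\<close>,
  which accounts for the \<open>Suc\<close> in the bound.\<close>

lemma chain_exact:
  assumes Y: "Y \<subseteq> \<Omega>" "U \<subseteq> Y" "B \<subseteq> Y" "U \<inter> B = {}" "m \<le> card (Y - U)" "L + q \<le> Suc (card U + card B)"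
    and c: "chain Y U L c" "null Y B (tot U c)"
  shows "\<exists>b. chain Y U (Suc L) b \<and> null Y B (\<lambda>e w. c e w - tot U b e w)"
proof -
  have YZ: "subgrp (Z (Y - A) B)" and YM: "subgrp (M (Y - A))" for A
    using Y(1) by (auto intro!: Z_subgrp M_subgrp)
  have "\<exists>b. chain Y U (Suc L) b \<and> null Y B (\<lambda>e w. c e w - tot U b e w)"
    if "chain Y U L c" "null Y B (tot U c)" "\<And>e w. length w < p \<Longrightarrow> c e w = 0" for p c
    using that
  proof (induction "L - p" arbitrary: p c)
    case 0
    have "c e w = 0" for e w
      using 0(1,4) by (cases "length w < p"; cases e) (auto intro!: chain_0[OF 0(2)])
    then show ?case using chain_zero[OF Y(1,2)] subgrp_0[OF YZ]
      by (auto intro!: exI[of _ "\<lambda>e w. 0"] simp: null_def zero_mod_def tot_def)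
  next
    case (Suc k)
    note c = Suc.prems(1,2)
    have low: "c e w = 0" if "length w < p" for e w using Suc.prems(3) that by blast
    define cp where "cp = (\<lambda>e w. if length w = p then c e w else 0)"
    have cp_chain: "chain Y U L cp" unfolding cp_def by (rule chain_restrict[OF c(1) Y(1,2)])
    \<comment> \<open>The last clause makes the choice zero outside the one length of
      \<open>e\<close> that matters, so that the choices assemble to a chain of total length
      \<open>Suc L\<close>.\<close>
    define Q where "Q = (\<lambda>e f. word_chain Y U (Suc p) f \<and> zero_mod Y B (\<lambda>w. cp e w - ins U f w) \<and>
        (length e + p \<noteq> L \<longrightarrow> f = (\<lambda>w. 0)))"
    have pL: "p < L" using Suc.hyps(2) by simp
    have ex: "\<exists>f. Q e f" if e: "e \<noteq> []" "set e \<subseteq> X" for e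
    proof (cases "length e + p = L")
      case True
      have wc: "word_chain Y U p (cp e)" using chain_word[OF cp_chain Y(1), of e] True by (metis add_diff_cancel_left')
      have "zero_mod Y B (ins U (cp e))"
        unfolding zero_mod_def
      proof
        fix w
        show "ins U (cp e) w \<in> Z (Y - set w) B"
        proof (cases "Suc (length w) = p")
          case False
          then have "ins U (cp e) w = 0" using word_chain_ins_0[OF wc] by blast
          then show ?thesis using subgrp_0[OF YZ] by simp
        next
          case len: True
          have "ins X (\<lambda>e. c e w) e = 0" by (rule ins_eq_0) (use len low in auto)
          moreover have "ins U (c e) w = ins U (cp e) w"
            by (rule ins_cong) (use len in \<open>auto simp: cp_def\<close>)
          ultimately have "tot U c e w = alt (length e) (ins U (cp e) w)" using e by (simp add: tot_def)
          then have "ins U (cp e) w = alt (length e) (tot U c e w)" by simp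
          also have "\<dots> \<in> Z (Y - set w) B"
            by (rule subgrp_alt[OF YZ]) (use c(2) in \<open>auto simp: null_def zero_mod_def\<close>)
          finally show ?thesis .
        qed
      qed
      then show ?thesis using word_exact[OF Y(1-5) _ wc] Y(6) pL True unfolding Q_def by auto
    next
      case False
      then have "cp e = (\<lambda>w. 0)" unfolding cp_def using chain_0[OF c(1)] by auto
      then show ?thesis using word_chain_zero[OF Y(1)] subgrp_0[OF YZ]
        by (intro exI[of _ "\<lambda>w. 0"]) (simp add: Q_def zero_mod_def)
    qed
    have QM: "f w \<in> M \<Omega>" if "Q e f" for e f w
      using that word_chain_M[of Y U "Suc p" f w] M_sub[of "Y - set w"] Y(1) by (auto simp: Q_def)
    have Qg: "Q (map ((\<circ>) g) e) (\<lambda>w. \<rho> g (f (map (inv g) w)))" if g: "g permutes U" and "e \<noteq> []" and Qf: "Q e f" for g e f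
    proof -
      have g\<Omega>: "g permutes \<Omega>" using perm_sub[OF g] Y(1,2) by auto
      have "cp (map ((\<circ>) g) e) w - ins U (\<lambda>w. \<rho> g (f (map (inv g) w))) w =
        \<rho> g ((\<lambda>w. cp e w - ins U f w) (map (inv g) w))" for w
      proof -
        have "cp (map ((\<circ>) g) e) w = \<rho> g (cp e (map (inv g) w))"
          using chain_eq[OF cp_chain g, of e "map (inv g) w"] by (simp only: map_inv_perm(1)[OF g])
        moreover have "cp e (map (inv g) w) \<in> M \<Omega>" by (rule chain_M\<Omega>[OF cp_chain Y(1)])
        moreover have "ins U f (map (inv g) w) \<in> M \<Omega>" by (rule ins_closed[OF M_subgrp[OF order_refl] QM[OF Qf]])
        moreover have "ins U (\<lambda>w. \<rho> g (f (map (inv g) w))) w = \<rho> g (ins U f (map (inv g) w))"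
          by (rule ins_perm[OF g Y(1,2)]) (rule QM[OF Qf])
        ultimately show ?thesis
          by (simp add: additive_on_diff[OF \<rho>_additive[OF g\<Omega>]])
      qed
      then show ?thesis
        using Qf word_chain_perm[OF _ g Y(1,2), of "Suc p" f] zero_mod_perm[OF _ g Y(1,2,4), of "\<lambda>w. cp e w - ins U f w"] g\<Omega>
        unfolding Q_def by auto
    qed
    obtain f where f: "\<And>e. e \<noteq> [] \<Longrightarrow> set e \<subseteq> X \<Longrightarrow> Q e (f e)"
      "\<And>e w. \<not> (e \<noteq> [] \<and> set e \<subseteq> X) \<Longrightarrow> f e w = 0" "equivariant U f"
    proof (rule equivariant_choice[where Q = Q and U = U])
      show "U \<subseteq> \<Omega>" using Y by auto
    next
      fix e assume "e \<noteq> []" "set e \<subseteq> X" then show "\<exists>f. Q e f" by (rule ex)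
    next
      fix e f w assume "Q e f" then show "f w \<in> M \<Omega>" by (rule QM)
    next
      fix g e f assume "g permutes U" "e \<noteq> []" "Q e f"
      then show "Q (map ((\<circ>) g) e) (\<lambda>w. \<rho> g (f (map (inv g) w)))" by (rule Qg)
    qed (rule that)
    have f0: "f e w = 0" if "\<not> (e \<noteq> [] \<and> set e \<subseteq> X \<and> distinct w \<and> set w \<subseteq> U \<and> length e + length w = Suc L \<and> length w = Suc p)" for e w
    proof (cases "e \<noteq> [] \<and> set e \<subseteq> X")
      case True
      then have "Q e (f e)" using f(1) by blast
      then show ?thesis using that True word_chain_0[of Y U "Suc p" "f e" w] by (auto simp: Q_def)
    qed (use f(2) in blast)
    \<comment> \<open>The sign cancels the one that \<open>tot\<close> puts before the word
      differential.\<close>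
    define b where "b = (\<lambda>e w. alt (length e) (f e w))"
    have b_chain: "chain Y U (Suc L) b"
    proof (rule chainI)
      fix e w assume "\<not> (e \<noteq> [] \<and> set e \<subseteq> X \<and> distinct w \<and> set w \<subseteq> U \<and> length e + length w = Suc L)"
      then show "b e w = 0" using f0[of e w] by (auto simp: b_def)
    next
      fix e :: "(nat \<Rightarrow> nat) list" and w assume "e \<noteq> []" "set e \<subseteq> X"
      then show "b e w \<in> M (Y - set w)" using f(1)[of e] word_chain_M[of Y U "Suc p" "f e" w]
        unfolding b_def Q_def by (auto intro!: subgrp_alt[OF YM])
    next
      fix g e w assume g: "g permutes U" "e \<noteq> []" "set e \<subseteq> X"
      then have "f e w \<in> M \<Omega>" using QM f(1) by blast
      moreover have "g permutes \<Omega>" using perm_sub[OF g(1)] Y(1,2) by auto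
      ultimately show "b (map ((\<circ>) g) e) (map g w) = \<rho> g (b e w)"
        using f(3) g(1) by (simp add: b_def equivariant_def additive_on_alt[OF \<rho>_additive])
    qed (use Y in auto)
    define c1 where "c1 = (\<lambda>e w. c e w - tot U b e w)"
    have tot_low: "tot U b e w = (if e \<noteq> [] \<and> length w = p then ins U (f e) w else 0)" if "length w \<le> p" for e w
    proof -
      have "ins X (\<lambda>e. b e w) e = 0" by (rule ins_eq_0) (use that f0 in \<open>auto simp: b_def\<close>)
      moreover have "ins U (b e) w = alt (length e) (ins U (f e) w)" by (simp add: b_def ins_alt)
      moreover have "ins U (f e) w = 0" if "length w \<noteq> p"
        by (rule ins_eq_0, rule f0) (use that in auto)
      ultimately show ?thesis by (simp add: tot_def)
    qed
    have c1_chain: "chain Y U L c1" unfolding c1_def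
      by (intro chain_diff c chain_tot b_chain Y)
    have c1_low: "c1 e w = 0" if "length w < p" for e w using tot_low low that by (simp add: c1_def)
    have c1_p: "c1 e w \<in> Z (Y - set w) B" if "length w = p" for e w
    proof (cases "e \<noteq> [] \<and> set e \<subseteq> X")
      case True
      then have "cp e w - ins U (f e) w \<in> Z (Y - set w) B" using f(1) unfolding Q_def zero_mod_def by blast
      then show ?thesis using that tot_low[of w e] True by (simp add: c1_def cp_def)
    next
      case False
      then have "c1 e w = 0" by (intro chain_0[OF c1_chain]) auto
      then show ?thesis using subgrp_0[OF YZ] by simp
    qed
    \<comment> \<open>At word length \<open>p\<close> only membership in \<open>Z\<close> has been
      reached. The truncation makes those values zero and moves them into a chain in
      \<open>Z\<close>.\<close>
    define c2 where "c2 = (\<lambda>e w. if length w > p then c1 e w else 0)"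
    have c2_chain: "chain Y U L c2" unfolding c2_def by (rule chain_restrict[OF c1_chain Y(1,2)])
    have c12: "null Y B (\<lambda>e w. c1 e w - c2 e w)"
      unfolding null_def zero_mod_def
    proof (intro allI)
      fix e w
      show "c1 e w - c2 e w \<in> Z (Y - set w) B"
        using c1_low[of w e] c1_p[of w e] subgrp_0[OF YZ, of "set w"]
        by (cases "length w" p rule: linorder_cases) (simp_all add: c2_def)
    qed
    have "tot U c2 e w = tot U c e w - tot U (\<lambda>e w. c1 e w - c2 e w) e w" for e w
      by (simp add: tot_diff c1_def tot_tot)
    then have "null Y B (tot U c2)"
      using null_diff[OF c(2) null_tot[OF c12 Y(1), of U] Y(1)] by presburger
    moreover have "k = L - Suc p" using Suc.hyps(2) by simp
    moreover have "c2 e w = 0" if "length w < Suc p" for e w using that by (simp add: c2_def)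
    ultimately obtain b2 where b2: "chain Y U (Suc L) b2" "null Y B (\<lambda>e w. c2 e w - tot U b2 e w)"
      using Suc.hyps(1)[of "Suc p" c2] c2_chain by blast
    have "(\<lambda>e w. c e w - tot U (\<lambda>e w. b e w + b2 e w) e w) = (\<lambda>e w. (c1 e w - c2 e w) + (c2 e w - tot U b2 e w))"
      by (simp add: c1_def tot_add fun_eq_iff diff_diff_eq)
    then have "null Y B (\<lambda>e w. c e w - tot U (\<lambda>e w. b e w + b2 e w) e w)"
      using null_add[OF c12 b2(2) Y(1)] by simp
    then show ?case using chain_add[OF b_chain b2(1) Y(1,2)] by blast
  qed
  then show ?thesis using c by (metis not_less_zero)
qed

end

lemma pris_closed:
  assumes "subgrp S" "\<And>e. e \<noteq> [] \<Longrightarrow> set e \<subseteq> X \<Longrightarrow> c e \<in> S"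
  shows "pris X f g c l \<in> S"
proof -
  \<comment> \<open>No membership is assumed at the empty tuple. Resetting the value there to 0
    leaves the prism unchanged.\<close>
  define c' where "c' = (\<lambda>e. if e = [] then 0 else c e)"
  have "pris X f g (\<lambda>e. c e - c' e) l = 0" by (rule pris_eq_0) (simp add: c'_def)
  then have "pris X f g c l = pris X f g c' l" by (simp add: pris_diff)
  moreover have "additive_on S (\<lambda>x. x)" using assms(1) by (simp add: additive_on_def)
  then have "pris X f g c' l \<in> S"
    by (rule pris_transport(1)[where \<gamma> = id and \<gamma>' = id and f' = f and g' = g and c' = c'])
       (use assms in \<open>auto simp: c'_def subgrp_0\<close>)
  ultimately show ?thesis by simp
qed

lemma ex_permutes_map:
  assumes "distinct w" "distinct w'" "length w = length w'" "set w \<subseteq> U" "set w' \<subseteq> U"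
  shows "\<exists>g. g permutes U \<and> map g w = w'"
  using assms
proof (induction w arbitrary: w')
  case (Cons x a)
  obtain y b where w': "w' = y # b" using Cons.prems(3) by (cases w') auto
  then obtain g where g: "g permutes U" "map g a = b" using Cons.IH[of b] Cons.prems by auto
  let ?t = "Transposition.transpose (g x) y"
  have "g x \<notin> set b"
    using g(2) Cons.prems(1) inj_eq[OF permutes_inj[OF g(1)]] by auto
  moreover have "y \<notin> set b" using w' Cons.prems(2) by auto
  ultimately have "map ?t b = b" by (intro map_idI) (auto simp: Transposition.transpose_def)
  moreover have "?t permutes U"
    using Cons.prems w' permutes_in_image[OF g(1)] by (intro permutes_swap_id) auto
  ultimately have "?t \<circ> g permutes U" "map ?t (map g a) = b" using g by (auto intro: permutes_compose)
  moreover from this w' have "map (?t \<circ> g) (x # a) = w'" by simp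
  ultimately show ?case by blast
qed (auto intro: permutes_id)

context poly_system
begin

section \<open>Reduction of the word differential to insertion in front\<close>

abbreviation swp :: "nat \<Rightarrow> nat \<Rightarrow> (nat \<Rightarrow> nat) \<Rightarrow> nat \<Rightarrow> nat" where
  "swp x y \<equiv> (\<circ>) (Transposition.transpose x y)"

text \<open>On homology, inserting a letter at positions \<open>2l - 1\<close> and \<open>2l\<close> gives the same map, because
  the two results differ by a transposition of letters that acts trivially on the coefficients.\<close>

fun hom2 :: "nat set \<Rightarrow> ((nat \<Rightarrow> nat) list \<Rightarrow> nat list \<Rightarrow> 'b) \<Rightarrow> (nat \<Rightarrow> nat) list \<Rightarrow> nat list \<Rightarrow> 'b" where
  "hom2 U c e [] = 0"
| "hom2 U c e [y] = 0"
| "hom2 U c e (y # z # w) = (\<Sum>x\<in>U. pris X id (swp x z) (\<lambda>e. c e (y # x # z # w)) e)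
     + hom2 U (\<lambda>e w. c e (y # z # w)) e w"

lemma swp_X:
  assumes "U \<subseteq> \<Omega>" "x \<in> U" "y \<in> U"
  shows "swp x y ` X \<subseteq> X" "h \<in> X \<Longrightarrow> swp x y h \<in> X" "swp x y (swp x y h) = h"
  using X_comp_iff[of "Transposition.transpose x y"] permutes_swap_id[of x \<Omega> y] assms
  by (auto simp: comp_assoc[symmetric])

text \<open>Even length matters: of the positions \<open>0, ..., length w\<close> the front one
  stays single, and the others form pairs with opposite signs. Within a pair the two insertions
  differ by translating \<open>e\<close> by a transposition, and the prism from \<open>id\<close> to
  that translation is the homotopy. Two letters are stripped at a time, so the recursion carries no
  sign.\<close>

lemma hom2_ins:
  assumes "U \<subseteq> \<Omega>"
    "\<And>u x y v e. x \<in> U \<Longrightarrow> y \<in> U \<Longrightarrow> x \<noteq> y \<Longrightarrow> c (map (swp x y) e) (u @ x # y # v) = c e (u @ y # x # v)"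
    "\<And>e w. \<not> distinct w \<Longrightarrow> c e w = 0" "set w \<subseteq> U" "even (length w)" "set e \<subseteq> X"
  shows "ins U (c e) w = (\<Sum>x\<in>U. c e (x # w)) + ins X (\<lambda>e. hom2 U c e w) e
    + hom2 U (\<lambda>e w. ins X (\<lambda>e. c e w) e) e w"
  using assms(2-5)
proof (induction w arbitrary: c rule: induct_list012)
  case (3 y z w)
  let ?c = "\<lambda>e w. c e (y # z # w)"
  let ?d = "\<lambda>x e. c e (y # x # z # w)"
  have sw: "c (map (swp a b) e) (u @ a # b # v) = c e (u @ b # a # v)" if "a \<in> U" "b \<in> U" "a \<noteq> b" for u v a b e
    using "3.prems"(1) that by blast
  have nd: "c e w = 0" if "\<not> distinct w" for e w using "3.prems"(2) that by blast
  have IH: "ins U (?c e) w = (\<Sum>x\<in>U. ?c e (x # w)) + ins X (\<lambda>e. hom2 U ?c e w) e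
    + hom2 U (\<lambda>e w. ins X (\<lambda>e. ?c e w) e) e w"
  proof (rule "3.IH"(1))
    fix u v a b e assume "a \<in> U" "b \<in> U" "a \<noteq> b"
    then show "c (map (swp a b) e) (y # z # u @ a # b # v) = c e (y # z # u @ b # a # v)"
      using sw[of a b e "y # z # u" v] by simp
  qed (use nd "3.prems" in auto)
  have pr: "ins X (pris X id (swp x z) (?d x)) e + pris X id (swp x z) (ins X (?d x)) e = c e (y # z # x # w) - ?d x e"
    if x: "x \<in> U" for x
  proof -
    have z: "z \<in> U" using "3.prems" by simp
    have "push_fwd X (swp x z) (?d x) e = ?d x (map (swp x z) e)"
      using swp_X[OF assms(1) x z] assms(6) by (intro push_fwd_bij) auto
    \<comment> \<open>For \<open>x = z\<close> both words repeat a letter and both values are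
      0.\<close>
    also have "\<dots> = c e (y # z # x # w)"
      using sw[OF x z, of e "[y]" w] nd[of "y # x # z # w"] nd[of "y # z # x # w"] by (cases "x = z") auto
    finally have 1: "push_fwd X (swp x z) (?d x) e = c e (y # z # x # w)" .
    have 2: "push_fwd X id (?d x) e = ?d x e"
      using push_fwd_bij[of X id id e "?d x"] assms(6) by simp
    show ?thesis using pris_ins[of X X id "swp x z" "?d x" e] swp_X(1)[OF assms(1) x z] 1 2 by simp
  qed
  have "(\<Sum>x\<in>U. ins X (pris X id (swp x z) (?d x)) e) + (\<Sum>x\<in>U. pris X id (swp x z) (ins X (?d x)) e)
     = (\<Sum>x\<in>U. c e (y # z # x # w)) - (\<Sum>x\<in>U. ?d x e)"
    by (simp add: sum.distrib[symmetric] sum_subtractf[symmetric] pr cong: sum.cong)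
  then have prs: "(\<Sum>x\<in>U. c e (y # z # x # w)) = (\<Sum>x\<in>U. ?d x e) +
     ((\<Sum>x\<in>U. ins X (pris X id (swp x z) (?d x)) e) + (\<Sum>x\<in>U. pris X id (swp x z) (ins X (?d x)) e))"
    by (simp add: algebra_simps)
  show ?case
    by (simp add: IH prs ins_add ins_sum algebra_simps)
qed auto

lemma hom2_diff: "hom2 U (\<lambda>e w. c e w - c' e w) e w = hom2 U c e w - hom2 U c' e w"
  by (induction w arbitrary: c c' rule: induct_list012) (auto simp: pris_diff sum_subtractf)

lemma hom2_closed:
  assumes "subgrp S" "\<And>e' w' x. x \<in> U \<Longrightarrow> set w' = insert x (set w) \<Longrightarrow> length w' = Suc (length w) \<Longrightarrow>
      e' \<noteq> [] \<Longrightarrow> set e' \<subseteq> X \<Longrightarrow> c e' w' \<in> S"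
  shows "hom2 U c e w \<in> S"
  using assms(2)
proof (induction w arbitrary: c rule: induct_list012)
  case (3 y z w)
  have "pris X id (swp x z) (\<lambda>e. c e (y # x # z # w)) e \<in> S" if "x \<in> U" for x
    by (rule pris_closed[OF assms(1)], rule "3.prems"[OF that]) auto
  moreover have "hom2 U (\<lambda>e w. c e (y # z # w)) e w \<in> S"
    by (rule "3.IH"(1), rule "3.prems") auto
  ultimately show ?case by (auto intro!: subgrp_add[OF assms(1)] subgrp_sum[OF assms(1)])
qed (use subgrp_0[OF assms(1)] in auto)

lemma hom2_eq_0:
  assumes "U \<subseteq> \<Omega>" "set w \<subseteq> U"
    "\<And>e' w' x. x \<in> U \<Longrightarrow> set w' = insert x (set w) \<Longrightarrow> length w' = Suc (length w) \<Longrightarrow>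
      e' \<noteq> [] \<Longrightarrow> set e' \<subseteq> X \<Longrightarrow> Suc (length e') = length e \<Longrightarrow> set e \<subseteq> X \<Longrightarrow> c e' w' = 0"
  shows "hom2 U c e w = 0"
  using assms(2,3)
proof (induction w arbitrary: c rule: induct_list012)
  case (3 y z w)
  have "pris X id (swp x z) (\<lambda>e. c e (y # x # z # w)) e = 0" if "x \<in> U" for x
  proof (cases "set e \<subseteq> X")
    case True
    show ?thesis
    proof (rule pris_eq_0)
      fix e' assume "Suc (length e') = length e" "e' \<noteq> []" "set e' \<subseteq> X"
      then show "c e' (y # x # z # w) = 0" using True that by (intro "3.prems"(2)[of x]) auto
    qed
  next
    case False
    have "z \<in> U" using "3.prems"(1) by simp
    then have "id ` X \<union> swp x z ` X \<subseteq> X" using swp_X(1)[OF assms(1) that, of z] by simp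
    then have "\<not> set e \<subseteq> id ` X \<union> swp x z ` X" using False order_trans by blast
    then show ?thesis using pris_supp[of X id "swp x z" "\<lambda>e. c e (y # x # z # w)" e] by argo
  qed
  moreover have "hom2 U (\<lambda>e w. c e (y # z # w)) e w = 0"
  proof (rule "3.IH"(1))
    fix e' w' x assume "x \<in> U" "set w' = insert x (set w)" "length w' = Suc (length w)"
      "e' \<noteq> []" "set e' \<subseteq> X" "Suc (length e') = length e" "set e \<subseteq> X"
    then show "c e' (y # z # w') = 0" by (intro "3.prems"(2)[of x]) auto
  qed (use "3.prems"(1) in auto)
  ultimately show ?case by simp
qed auto

lemma hom2_perm:
  assumes g: "g permutes U" "U \<subseteq> \<Omega>" and "set w \<subseteq> U"
    "\<And>e w. c e w \<in> M \<Omega>" "\<And>e w. c' (map ((\<circ>) g) e) (map g w) = \<rho> g (c e w)"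
  shows "hom2 U c' (map ((\<circ>) g) e) (map g w) = \<rho> g (hom2 U c e w)"
  using assms(3-5)
proof (induction w arbitrary: c c' rule: induct_list012)
  case (3 y z w)
  have g\<Omega>: "g permutes \<Omega>" by (rule perm_sub[OF g])
  note add = \<rho>_additive[OF g\<Omega>]
  have sw: "swp (g x) (g z) (g \<circ> h) = g \<circ> swp x z h" for x h
    using inj_eq[OF permutes_inj[OF g(1)]] by (auto simp: fun_eq_iff Transposition.transpose_def)
  have inj: "inj ((\<circ>) g :: (nat \<Rightarrow> nat) \<Rightarrow> _)"
    using permutes_inj[OF g(1)] by (auto simp: inj_def fun_eq_iff)
  have P: "pris X id (swp x z) (\<lambda>e. c e (y # x # z # w)) e \<in> M \<Omega> \<and>
    pris X id (swp (g x) (g z)) (\<lambda>e. c' e (g y # g x # g z # map g w)) (map ((\<circ>) g) e)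
     = \<rho> g (pris X id (swp x z) (\<lambda>e. c e (y # x # z # w)) e)" for x
  proof -
    have c': "c' (map ((\<circ>) g) e) (g y # g x # g z # map g w) = \<rho> g (c e (y # x # z # w))" for e
      using "3.prems"(3)[of e "y # x # z # w"] by (simp only: list.map)
    show ?thesis
      by (rule conjI; rule pris_transport[OF add bij_X[OF g\<Omega>] inj, where f' = id and g' = "swp (g x) (g z)" and
           c' = "\<lambda>e. c' e (g y # g x # g z # map g w)"]; (rule "3.prems"(2) | rule c' | rule sw | simp))
  qed
  have IH: "hom2 U (\<lambda>e w. c' e (g y # g z # w)) (map ((\<circ>) g) e) (map g w) = \<rho> g (hom2 U (\<lambda>e w. c e (y # z # w)) e w)"
    by (rule "3.IH"(1)) (use "3.prems"(1,2) "3.prems"(3)[of _ "y # z # _"] in auto)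
  have h: "hom2 U (\<lambda>e w. c e (y # z # w)) e w \<in> M \<Omega>"
    by (rule hom2_closed[OF M_subgrp[OF order_refl]]) (rule "3.prems"(2))
  have s: "(\<Sum>x\<in>U. pris X id (swp x z) (\<lambda>e. c e (y # x # z # w)) e) \<in> M \<Omega>"
    by (rule subgrp_sum[OF M_subgrp[OF order_refl]]) (use P in auto)
  have "(\<Sum>x\<in>U. pris X id (swp x (g z)) (\<lambda>e. c' e (g y # x # g z # map g w)) (map ((\<circ>) g) e))
     = (\<Sum>x\<in>U. pris X id (swp (g x) (g z)) (\<lambda>e. c' e (g y # g x # g z # map g w)) (map ((\<circ>) g) e))"
    using sum.reindex_bij_betw[OF permutes_imp_bij[OF g(1)],
      of "\<lambda>x. pris X id (swp x (g z)) (\<lambda>e. c' e (g y # x # g z # map g w)) (map ((\<circ>) g) e)"] by simp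
  also have "\<dots> = \<rho> g (\<Sum>x\<in>U. pris X id (swp x z) (\<lambda>e. c e (y # x # z # w)) e)"
    using P by (subst additive_on_sum[OF add]) auto
  finally show ?case by (simp only: list.map hom2.simps IH additive_on_add[OF add s h])
qed (use perm_sub[OF g] in auto)

text \<open>The transposition moves only \<open>x\<close> and \<open>y\<close>; both occur in the
  word and are therefore absent from the points that carry the coefficient.\<close>

lemma chain_swp:
  assumes c: "chain Y U L c" and Y: "Y \<subseteq> \<Omega>" "U \<subseteq> Y" and xy: "x \<in> U" "y \<in> U"
  shows "c (map (swp x y) e) (u @ x # y # v) = c e (u @ y # x # v)"
proof (cases "distinct (u @ y # x # v)")
  case True
  let ?t = "Transposition.transpose x y"
  have t: "?t permutes U" using xy by (intro permutes_swap_id)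
  have "map ?t u = u" "map ?t v = v"
    using True by (auto intro!: map_idI simp: Transposition.transpose_def)
  then have "map ?t (u @ y # x # v) = u @ x # y # v" by simp
  then have "c (map (swp x y) e) (u @ x # y # v) = \<rho> ?t (c e (u @ y # x # v))"
    using chain_eq[OF c t, of e "u @ y # x # v"] by simp
  also have "\<dots> = c e (u @ y # x # v)"
    using perm_sub[OF t] Y
    by (intro \<rho>_fix[OF _ _ chain_M[OF c]]) (auto simp: Transposition.transpose_def)
  finally show ?thesis .
next
  case False
  then show ?thesis by (subst (1 2) chain_0[OF c]) auto
qed

text \<open>\<open>hom2\<close> trades a letter of the word for an entry of the tuple, so the total
  length is kept.\<close>

lemma chain_hom2:
  assumes c: "chain Y U L c" and Y: "Y \<subseteq> \<Omega>" "U \<subseteq> Y"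
  shows "chain Y U L (\<lambda>e w. if length w = p \<and> set w \<subseteq> U then alt (length e) (hom2 U c e w) else 0)"
proof (rule chainI)
  fix e w assume *: "\<not> (e \<noteq> [] \<and> set e \<subseteq> X \<and> distinct w \<and> set w \<subseteq> U \<and> length e + length w = L)"
  have "hom2 U c e w = 0" if "set w \<subseteq> U"
  proof (rule hom2_eq_0)
    fix e' w' x assume w': "x \<in> U" "set w' = insert x (set w)" "length w' = Suc (length w)"
      "e' \<noteq> []" "set e' \<subseteq> X" "Suc (length e') = length e" "set e \<subseteq> X"
    then show "c e' w' = 0" using * that distinct_insertD[OF w'(2,3)] by (intro chain_0[OF c]) auto
  qed (use that Y in auto)
  then show "(if length w = p \<and> set w \<subseteq> U then alt (length e) (hom2 U c e w) else 0) = 0" by simp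
next
  fix e w
  have s: "subgrp (M (Y - set w))" using Y by (auto intro: M_subgrp)
  have "hom2 U c e w \<in> M (Y - set w)"
  proof (rule hom2_closed[OF s])
    fix e' w' x assume "set w' = insert x (set w)"
    then have "M (Y - set w') \<subseteq> M (Y - set w)" using Y by (intro M_mono) auto
    then show "c e' w' \<in> M (Y - set w)" using chain_M[OF c] by blast
  qed
  then show "(if length w = p \<and> set w \<subseteq> U then alt (length e) (hom2 U c e w) else 0) \<in> M (Y - set w)"
    using s by (auto intro: subgrp_alt subgrp_0)
next
  fix g w and e :: "(nat \<Rightarrow> nat) list" assume g: "g permutes U" and w: "set w \<subseteq> U"
  have U: "U \<subseteq> \<Omega>" using Y by auto
  have "hom2 U c (map ((\<circ>) g) e) (map g w) = \<rho> g (hom2 U c e w)"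
    by (rule hom2_perm[OF g U w]) (rule chain_M\<Omega>[OF c Y(1)], rule chain_eq[OF c g])
  moreover have "hom2 U c e w \<in> M \<Omega>"
    by (rule hom2_closed[OF M_subgrp[OF order_refl]]) (rule chain_M\<Omega>[OF c Y(1)])
  ultimately show "(if length (map g w) = p \<and> set (map g w) \<subseteq> U then alt (length (map ((\<circ>) g) e)) (hom2 U c (map ((\<circ>) g) e) (map g w)) else 0)
     = \<rho> g (if length w = p \<and> set w \<subseteq> U then alt (length e) (hom2 U c e w) else 0)"
    using perm_map_sub[OF g, of w] perm_sub[OF g U] w by (simp add: additive_on_alt[OF \<rho>_additive])
qed (use Y in auto)

section \<open>Stability when all relevant maps are injective\<close>

text \<open>\<open>stab L Y U B\<close>: the cone of the stabilization map, with coefficients \<open>M(- \<union> A) / Z(- \<union> A, B)\<close>,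
  \<open>A = Y - U\<close>, and groups \<open>Perm(U - {x}) \<subseteq> Perm(U)\<close>, is exact in degree \<open>L - 1\<close>.\<close>

definition stab :: "nat \<Rightarrow> nat set \<Rightarrow> nat set \<Rightarrow> nat set \<Rightarrow> bool" where
  "stab L Y U B \<longleftrightarrow> (\<forall>c. chain Y U L c \<and> (\<forall>e w. 1 < length w \<longrightarrow> c e w = 0) \<and> null Y B (tot U c) \<longrightarrow>
     (\<exists>b. chain Y U (Suc L) b \<and> (\<forall>e w. 1 < length w \<longrightarrow> b e w = 0) \<and> null Y B (\<lambda>e w. c e w - tot U b e w)))"

lemma stab_zero:
  assumes "Y \<subseteq> \<Omega>" "U \<subseteq> Y" "\<And>c e w. chain Y U L c \<Longrightarrow> 1 < length w \<or> c e w \<in> Z (Y - set w) B"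
  shows "stab L Y U B"
  unfolding stab_def
proof (intro allI impI)
  fix c assume c: "chain Y U L c \<and> (\<forall>e w. 1 < length w \<longrightarrow> c e w = 0) \<and> null Y B (tot U c)"
  have "c e w \<in> Z (Y - set w) B" for e w
  proof (cases "1 < length w")
    case True
    then have "c e w = 0" using c by blast
    then show ?thesis using assms(1) by (auto intro!: subgrp_0 Z_subgrp)
  qed (use assms(3)[of c w e] c in blast)
  then have "null Y B (\<lambda>e w. c e w - tot U (\<lambda>e w. 0) e w)"
    by (simp add: null_def zero_mod_def tot_def)
  then show "\<exists>b. chain Y U (Suc L) b \<and> (\<forall>e w. 1 < length w \<longrightarrow> b e w = 0) \<and> null Y B (\<lambda>e w. c e w - tot U b e w)"
    using chain_zero[OF assms(1,2)] by (intro exI[of _ "\<lambda>e w. 0"]) simp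
qed

lemma stab_0:
  assumes "Y \<subseteq> \<Omega>" "U \<subseteq> Y"
  shows "stab 0 Y U B"
proof (rule stab_zero[OF assms])
  fix c e w assume "chain Y U 0 c"
  then have "c e w = 0" by (rule chain_0) auto
  then show "1 < length w \<or> c e w \<in> Z (Y - set w) B"
    using assms by (auto intro!: subgrp_0 Z_subgrp)
qed

text \<open>Columns \<open>p\<close> and \<open>p + 1\<close> as a complex of their own, joined by
  front insertion alone. This is what the pairing of the other insertions leaves of
  \<open>tot\<close>.\<close>

definition tot_front :: "nat \<Rightarrow> nat set \<Rightarrow> ((nat \<Rightarrow> nat) list \<Rightarrow> nat list \<Rightarrow> 'b) \<Rightarrow> (nat \<Rightarrow> nat) list \<Rightarrow> nat list \<Rightarrow> 'b" where
  "tot_front p U c e w = (if e = [] then 0 else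
     ins X (\<lambda>e. c e w) e + (if length w = p then alt (length e) (\<Sum>x\<in>U. c e (x # w)) else 0))"

lemma tot_front_M:
  assumes "chain Y U L c" "Y \<subseteq> \<Omega>"
  shows "tot_front p U c e w \<in> M \<Omega>"
proof -
  note s = M_subgrp[OF order_refl] and m = chain_M\<Omega>[OF assms]
  have "ins X (\<lambda>e. c e w) e \<in> M \<Omega>" by (rule ins_closed[OF s m])
  moreover have "(\<Sum>x\<in>U. c e (x # w)) \<in> M \<Omega>" by (rule subgrp_sum[OF s m])
  ultimately show ?thesis using s by (auto simp: tot_front_def intro!: subgrp_add subgrp_alt subgrp_0)
qed

lemma tot_front_perm:
  assumes c: "chain Y U L c" "Y \<subseteq> \<Omega>" "U \<subseteq> Y" and g: "g permutes U"
  shows "tot_front p U c (map ((\<circ>) g) e) (map g w) = \<rho> g (tot_front p U c e w)"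
proof -
  have g\<Omega>: "g permutes \<Omega>" using perm_sub[OF g] c by auto
  note s = M_subgrp[OF order_refl] and m = chain_M\<Omega>[OF c(1,2)] and add = \<rho>_additive[OF g\<Omega>]
  have "ins X (\<lambda>e. c e (map g w)) (map ((\<circ>) g) e) = ins X (\<lambda>e. c (map ((\<circ>) g) e) (map g w)) e"
    by (rule ins_map[OF bij_X[OF g\<Omega>]])
  also have "\<dots> = \<rho> g (ins X (\<lambda>e. c e w) e)"
    unfolding chain_eq[OF c(1) g] by (rule ins_additive[OF add m])
  finally have 1: "ins X (\<lambda>e. c e (map g w)) (map ((\<circ>) g) e) = \<rho> g (ins X (\<lambda>e. c e w) e)" .
  have "(\<Sum>x\<in>U. c (map ((\<circ>) g) e) (x # map g w)) = (\<Sum>x\<in>U. c (map ((\<circ>) g) e) (map g (x # w)))"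
    using sum.reindex_bij_betw[OF permutes_imp_bij[OF g], of "\<lambda>x. c (map ((\<circ>) g) e) (x # map g w)"] by simp
  also have "\<dots> = (\<Sum>x\<in>U. \<rho> g (c e (x # w)))" unfolding chain_eq[OF c(1) g] ..
  also have "\<dots> = \<rho> g (\<Sum>x\<in>U. c e (x # w))" by (rule additive_on_sum[OF add m, symmetric])
  finally have 2: "(\<Sum>x\<in>U. c (map ((\<circ>) g) e) (x # map g w)) = \<rho> g (\<Sum>x\<in>U. c e (x # w))" .
  have 3: "ins X (\<lambda>e. c e w) e \<in> M \<Omega>" by (rule ins_closed[OF s m])
  have 4: "(\<Sum>x\<in>U. c e (x # w)) \<in> M \<Omega>" by (rule subgrp_sum[OF s m])
  show ?thesis
    unfolding tot_front_def length_map 1 2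
    using g\<Omega> 3 4 by (simp add: additive_on_add[OF add] additive_on_alt[OF add] subgrp_alt[OF s])
qed

text \<open>Front insertion never touches the last \<open>p\<close> letters, so the two columns
  split according to that suffix \<open>u\<close>, and over one suffix they form the cone for
  \<open>U - set u\<close> in total length \<open>L - p\<close>. The suffixes are permuted
  transitively, so a filling over one \<open>u\<close> extends by equivariance to all of
  them.\<close>

lemma front_exact:
  assumes Y: "Y \<subseteq> \<Omega>" "U \<subseteq> Y" "U \<inter> B = {}"
    and R: "\<And>u. distinct u \<Longrightarrow> set u \<subseteq> U \<Longrightarrow> length u = p \<Longrightarrow> stab (L - p) (Y - set u) (U - set u) B"
    and pL: "p \<le> L"
    and c: "chain Y U L c" "\<And>e w. c e w \<noteq> 0 \<Longrightarrow> length w = p \<or> length w = Suc p"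
    and cyc: "\<And>e w. tot_front p U c e w \<in> Z (Y - set w) B"
  shows "\<exists>b. chain Y U (Suc L) b \<and> (\<forall>e w. b e w \<noteq> 0 \<longrightarrow> length w = p \<or> length w = Suc p) \<and>
    (\<forall>e w. c e w - tot_front p U b e w \<in> Z (Y - set w) B)"
proof (cases "\<exists>u. distinct u \<and> set u \<subseteq> U \<and> length u = p")
  case False
  have "c e w = 0" for e w
  proof (rule ccontr)
    assume nz: "c e w \<noteq> 0"
    then have w: "distinct w" "set w \<subseteq> U" "p \<le> length w" using chain_0[OF c(1), of e w] c(2)[of e w] by auto
    then have "distinct (take p w)" "set (take p w) \<subseteq> U" "length (take p w) = p"
      using set_take_subset[of p w] by auto
    then show False using False by blast
  qed
  then have "\<forall>e w. c e w - tot_front p U (\<lambda>e w. 0) e w \<in> Z (Y - set w) B"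
    using Y(1) by (auto simp: tot_front_def intro!: subgrp_0 Z_subgrp)
  then show ?thesis using chain_zero[OF Y(1,2)] by (intro exI[of _ "\<lambda>e w. 0"]) simp
next
  case True
  then obtain u where u: "distinct u" "set u \<subseteq> U" "length u = p" by blast
  have U\<Omega>: "U \<subseteq> \<Omega>" using Y by auto
  have fU: "finite U" using fin_sub[OF U\<Omega>] .
  define c0 where "c0 = (\<lambda>e v. c e (v @ u))"
  have Y': "Y - set u \<subseteq> \<Omega>" "U - set u \<subseteq> Y - set u" using Y by auto
  have Yv: "Y - set u - set v = Y - set (v @ u)" for v by auto
  have permU: "g permutes U" if "g permutes (U - set u)" for g by (rule permutes_subset[OF that]) auto
  have fixu: "map g u = u" if "g permutes (U - set u)" for g
    using that by (intro map_idI) (auto simp: permutes_def)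
  have c0: "chain (Y - set u) (U - set u) (L - p) c0"
  proof (rule chainI)
    fix e v assume *: "\<not> (e \<noteq> [] \<and> set e \<subseteq> X \<and> distinct v \<and> set v \<subseteq> U - set u \<and> length e + length v = L - p)"
    then show "c0 e v = 0" unfolding c0_def using u by (intro chain_0[OF c(1)]) auto
  next
    fix e v show "c0 e v \<in> M (Y - set u - set v)" unfolding Yv c0_def by (rule chain_M[OF c(1)])
  next
    fix g e v assume g: "g permutes U - set u"
    show "c0 (map ((\<circ>) g) e) (map g v) = \<rho> g (c0 e v)"
      unfolding c0_def using chain_eq[OF c(1) permU[OF g], of e "v @ u"] fixu[OF g] by simp
  qed (use Y' in auto)
  have c0_long: "c0 e v = 0" if "1 < length v" for e v
    using c(2)[of e "v @ u"] that u(3) unfolding c0_def by fastforce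
  \<comment> \<open>With \<open>v\<close> of length at most 1, the total differential over
    \<open>v\<close> and the front differential over \<open>v @ u\<close> have the same terms: into
    the empty word there is only one position to insert.\<close>
  have tot0: "tot (U - set u) b e v = tot_front p U (\<lambda>e w. b' e w) e (v @ u)"
    if bb': "\<And>e v. b e v = b' e (v @ u)" and long: "\<And>e v. 1 < length v \<Longrightarrow> b e v = 0"
      and supp: "\<And>e v. \<not> set v \<inter> set u = {} \<Longrightarrow> b e v = 0" for b b' e v
  proof (cases v)
    case Nil
    have "(\<Sum>x\<in>U. b e [x]) = (\<Sum>x\<in>U - set u. b e [x])"
      by (rule sum.mono_neutral_right) (use fU supp in auto)
    then show ?thesis using Nil u(3) bb'[of _ "[]"] bb'[of _ "[_]"] by (simp add: tot_def tot_front_def)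
  next
    case (Cons x v')
    have "ins (U - set u) (b e) v = 0" by (rule ins_eq_0) (use Cons long in auto)
    then show ?thesis using Cons u(3) bb'[of _ v] by (simp add: tot_def tot_front_def)
  qed
  have c0_supp: "c0 e v = 0" if "\<not> set v \<inter> set u = {}" for e v
    using that by (intro chain_0[OF c0]) auto
  have "null (Y - set u) B (tot (U - set u) c0)"
    unfolding null_def zero_mod_def Yv
  proof (intro allI)
    fix e v
    have "tot (U - set u) c0 e v = tot_front p U c e (v @ u)"
      by (rule tot0[OF _ c0_long c0_supp]) (simp add: c0_def)
    then show "tot (U - set u) c0 e v \<in> Z (Y - set (v @ u)) B" using cyc[of e "v @ u"] by simp
  qed
  then obtain b0 where b0: "chain (Y - set u) (U - set u) (Suc (L - p)) b0" "\<And>e v. 1 < length v \<Longrightarrow> b0 e v = 0"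
    "null (Y - set u) B (\<lambda>e v. c0 e v - tot (U - set u) b0 e v)"
    using R[OF u] c0 c0_long unfolding stab_def by blast
  define t where "t = (\<lambda>w. SOME g. g permutes U \<and> map g u = w)"
  have t: "t w permutes U \<and> map (t w) u = w" if "distinct w" "set w \<subseteq> U" "length w = p" for w
    unfolding t_def using someI_ex[OF ex_permutes_map[OF u(1) that(1) _ u(2) that(2)]] by (simp add: u(3) that(3))
  define good where "good = (\<lambda>w. p \<le> length w \<and> distinct w \<and> set w \<subseteq> U)"
  define tl' where "tl' = (\<lambda>w :: nat list. drop (length w - p) w)"
  define hd' where "hd' = (\<lambda>w :: nat list. take (length w - p) w)"
  define b where "b = (\<lambda>e w. if good w then let g = t (tl' w) in
      \<rho> g (b0 (map ((\<circ>) (inv g)) e) (map (inv g) (hd' w))) else 0)"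
  have split: "tl' (map g (v @ u)) = map g u" "hd' (map g (v @ u)) = map g v" for g v
    by (simp_all add: tl'_def hd'_def u(3))
  \<comment> \<open>Independence of the choice in \<open>t\<close>: two permutations carrying
    \<open>u\<close> to the same suffix differ by a permutation of \<open>U - set u\<close>, under
    which \<open>b0\<close> is equivariant.\<close>
  have key: "b (map ((\<circ>) g) e) (map g (v @ u)) = \<rho> g (b0 e v)" if g: "g permutes U" for g e v
  proof (cases "distinct (v @ u) \<and> set (v @ u) \<subseteq> U")
    case False
    have g\<Omega>: "g permutes \<Omega>" using perm_sub[OF g U\<Omega>] .
    have "\<not> good (map g (v @ u))"
      using False perm_map_distinct[OF g, of "v @ u"] perm_map_sub[OF g, of "v @ u"] unfolding good_def by blast
    moreover have "b0 e v = 0" using False u by (intro chain_0[OF b0(1)]) auto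
    ultimately show ?thesis using g\<Omega> by (simp add: b_def)
  next
    case True
    let ?w = "map g u"
    have w: "distinct ?w" "set ?w \<subseteq> U" "length ?w = p"
      using perm_map_distinct[OF g, of u] perm_map_sub[OF g, of u] u by auto
    define h where "h = t ?w"
    have h: "h permutes U" "map h u = ?w" using t[OF w] by (auto simp: h_def)
    define s where "s = inv h \<circ> g"
    have sU: "s permutes U" unfolding s_def by (intro permutes_compose g permutes_inv h)
    have su: "s x = x" if "x \<in> set u" for x
      using h(2) that permutes_inverses(2)[OF h(1)] by (auto simp: s_def) (metis map_eq_conv)
    have s: "s permutes U - set u"
      using sU su by (auto simp: permutes_def)
    have hs: "h \<circ> s = g" unfolding s_def using permutes_inv_o(1)[OF h(1)] by (simp add: comp_assoc[symmetric])
    have good: "good (map g (v @ u))"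
      using True perm_map_distinct[OF g, of "v @ u"] perm_map_sub[OF g, of "v @ u"] u(3) unfolding good_def by simp
    have e: "map ((\<circ>) (inv h)) (map ((\<circ>) g) e) = map ((\<circ>) s) e" by (simp add: s_def comp_assoc)
    have v: "map (inv h) (map g v) = map s v" by (simp add: s_def)
    have "b (map ((\<circ>) g) e) (map g (v @ u)) = \<rho> h (b0 (map ((\<circ>) s) e) (map s v))"
      using good unfolding b_def split Let_def h_def[symmetric] e v by simp
    also have "\<dots> = \<rho> h (\<rho> s (b0 e v))" by (simp only: chain_eq[OF b0(1) s])
    also have "\<dots> = \<rho> g (b0 e v)"
      using \<rho>_comp[OF perm_sub[OF h(1) U\<Omega>] perm_sub[OF sU U\<Omega>] chain_M\<Omega>[OF b0(1) Y'(1)]] hs by simp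
    finally show ?thesis .
  qed
  have form: "\<exists>g e' v. g permutes U \<and> e = map ((\<circ>) g) e' \<and> w = map g (v @ u)" if "good w" for e :: "(nat \<Rightarrow> nat) list" and w
  proof -
    have "distinct (tl' w)" "set (tl' w) \<subseteq> U" "length (tl' w) = p"
      using that set_drop_subset[of "length w - p" w] by (auto simp: good_def tl'_def)
    then have g: "t (tl' w) permutes U" "map (t (tl' w)) u = tl' w" using t by auto
    let ?g = "t (tl' w)"
    have "e = map ((\<circ>) ?g) (map ((\<circ>) (inv ?g)) e)" by (rule map_inv_perm(3)[OF g(1), symmetric])
    moreover have "w = map ?g (map (inv ?g) (hd' w) @ u)"
      unfolding map_append map_inv_perm(1)[OF g(1)] g(2) by (simp add: hd'_def tl'_def)
    ultimately show ?thesis using g(1) by blast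
  qed
  have b_u: "b e (v @ u) = b0 e v" for e v
  proof -
    have "map ((\<circ>) id) e = e" by (rule map_idI) simp
    then show ?thesis using key[OF permutes_id, of e v] \<rho>_id[OF chain_M\<Omega>[OF b0(1) Y'(1)]] by simp
  qed
  have b_chain: "chain Y U (Suc L) b"
  proof (rule chainI)
    fix e w assume *: "\<not> (e \<noteq> [] \<and> set e \<subseteq> X \<and> distinct w \<and> set w \<subseteq> U \<and> length e + length w = Suc L)"
    show "b e w = 0"
    proof (cases "good w")
      case True
      then obtain g e' v where g: "g permutes U" "e = map ((\<circ>) g) e'" "w = map g (v @ u)" using form by blast
      have g\<Omega>: "g permutes \<Omega>" using perm_sub[OF g(1) U\<Omega>] .
      have "b0 e' v = 0"
        using * True pL set_map_X[OF g\<Omega>, of e'] u(3) unfolding g(2,3) good_def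
        by (intro chain_0[OF b0(1)]) auto
      then show ?thesis using key[OF g(1), of e' v] g(2,3) g\<Omega> by simp
    qed (simp add: b_def)
  next
    fix e :: "(nat \<Rightarrow> nat) list" and w
    show "b e w \<in> M (Y - set w)"
    proof (cases "good w")
      case True
      then obtain g e' v where g: "g permutes U" "e = map ((\<circ>) g) e'" "w = map g (v @ u)" using form by blast
      have "\<rho> g (b0 e' v) \<in> M (g ` (Y - set u - set v))"
        using Y' by (intro \<rho>_M perm_sub[OF g(1) U\<Omega>] chain_M[OF b0(1)]) auto
      then show ?thesis unfolding Yv perm_image[OF g(1) Y(2)] using key[OF g(1)] g(2,3) by simp
    next
      case False
      then show ?thesis using Y(1) by (auto simp: b_def intro!: subgrp_0 M_subgrp)
    qed
  next
    fix h and e :: "(nat \<Rightarrow> nat) list" and w assume h: "h permutes U"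
    show "b (map ((\<circ>) h) e) (map h w) = \<rho> h (b e w)"
    proof (cases "good w")
      case True
      then obtain g e' v where g: "g permutes U" "e = map ((\<circ>) g) e'" "w = map g (v @ u)" using form by blast
      have "b (map ((\<circ>) (h \<circ> g)) e') (map (h \<circ> g) (v @ u)) = \<rho> (h \<circ> g) (b0 e' v)"
        by (rule key[OF permutes_compose[OF g(1) h]])
      also have "\<dots> = \<rho> h (\<rho> g (b0 e' v))"
        by (intro \<rho>_comp perm_sub[OF h U\<Omega>] perm_sub[OF g(1) U\<Omega>] chain_M\<Omega>[OF b0(1) Y'(1)])
      also have "\<rho> g (b0 e' v) = b e w" using key[OF g(1)] g(2,3) by simp
      finally show ?thesis unfolding g(2,3) by (simp add: comp_assoc comp_def)
    next
      case False
      then have "\<not> good (map h w)" using perm_map_distinct[OF h] perm_map_sub[OF h] unfolding good_def by auto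
      then show ?thesis using False perm_sub[OF h U\<Omega>] by (simp add: b_def)
    qed
  qed (use Y in auto)
  have b_supp: "length w = p \<or> length w = Suc p" if "b e w \<noteq> 0" for e w
  proof -
    have good: "good w" using that unfolding b_def by metis
    then obtain g e' v where g: "g permutes U" "e = map ((\<circ>) g) e'" "w = map g (v @ u)" using form by blast
    have "b0 e' v \<noteq> 0" using that key[OF g(1)] g(2,3) perm_sub[OF g(1) U\<Omega>] by auto
    then have "length v \<le> 1" using b0(2) by (meson not_less)
    then have "length v = 0 \<or> length v = 1" by linarith
    then show ?thesis using g(3) u(3) by auto
  qed
  have b0_supp: "b0 e v = 0" if "\<not> set v \<inter> set u = {}" for e v
    using that by (intro chain_0[OF b0(1)]) auto
  have "c e w - tot_front p U b e w \<in> Z (Y - set w) B" for e w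
  proof (cases "good w")
    case True
    then obtain g e' v where g: "g permutes U" "e = map ((\<circ>) g) e'" "w = map g (v @ u)" using form by blast
    have g\<Omega>: "g permutes \<Omega>" using perm_sub[OF g(1) U\<Omega>] .
    have "c e w - tot_front p U b e w = \<rho> g (c e' (v @ u)) - \<rho> g (tot_front p U b e' (v @ u))"
      unfolding g(2,3) chain_eq[OF c(1) g(1)] tot_front_perm[OF b_chain Y(1,2) g(1)] ..
    also have "\<dots> = \<rho> g (c e' (v @ u) - tot_front p U b e' (v @ u))"
      by (intro additive_on_diff[OF \<rho>_additive[OF g\<Omega>], symmetric] chain_M\<Omega>[OF c(1) Y(1)] tot_front_M[OF b_chain Y(1)])
    finally have eq: "c e w - tot_front p U b e w = \<rho> g (c e' (v @ u) - tot_front p U b e' (v @ u))" .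
    have "tot (U - set u) b0 e' v = tot_front p U b e' (v @ u)"
      using tot0[of b0 b e' v, OF _ b0(2) b0_supp] b_u by simp
    moreover have "c0 e' v - tot (U - set u) b0 e' v \<in> Z (Y - set (v @ u)) B"
      using b0(3) unfolding null_def zero_mod_def Yv by blast
    ultimately have "c e' (v @ u) - tot_front p U b e' (v @ u) \<in> Z (Y - set (v @ u)) B" by (simp add: c0_def)
    moreover have "\<forall>x\<in>B. g x = x" using g(1) Y(3) by (auto simp: permutes_def)
    ultimately have "\<rho> g (c e' (v @ u) - tot_front p U b e' (v @ u)) \<in> Z (g ` (Y - set (v @ u))) B"
      using Y(1) by (intro \<rho>_Z g\<Omega>) auto
    then show ?thesis unfolding eq perm_image[OF g(1) Y(2)] g(3)[symmetric] .
  next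
    case False
    have short: "c' e w = 0" if "chain Y U L' c'" "\<And>e w. c' e w \<noteq> 0 \<Longrightarrow> length w = p \<or> length w = Suc p" for c' L' e
    proof (rule ccontr)
      assume nz: "c' e w \<noteq> 0"
      then show False using False chain_0[OF that(1), of e w] that(2)[OF nz] unfolding good_def by fastforce
    qed
    have "ins X (\<lambda>e. b e w) e = 0" by (rule ins_eq_0, rule short[OF b_chain], rule b_supp)
    moreover have "b e (x # w) = 0" if "length w = p" for x
      using False that by (intro chain_0[OF b_chain]) (auto simp: good_def)
    moreover have "c e w = 0" by (rule short[OF c(1)], rule c(2))
    ultimately have "c e w - tot_front p U b e w = 0" by (simp add: tot_front_def)
    then show ?thesis using Y(1) by (auto intro!: subgrp_0 Z_subgrp)
  qed
  then show ?thesis using b_chain b_supp by blast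
qed

text \<open>The change of coordinates \<open>1 - K\<close> turns the honest differential between
  columns \<open>p\<close> and \<open>p + 1\<close> into front insertion, modulo \<open>Z\<close>.
  Only word lengths from \<open>p\<close> on are tested: what leaves column \<open>p\<close>
  downwards concerns the remaining columns.\<close>

lemma level_exact:
  assumes Y: "Y \<subseteq> \<Omega>" "U \<subseteq> Y" "U \<inter> B = {}"
    and R: "\<And>u. distinct u \<Longrightarrow> set u \<subseteq> U \<Longrightarrow> length u = p \<Longrightarrow> stab (L - p) (Y - set u) (U - set u) B"
    and p: "p \<le> L" "even p"
    and c: "chain Y U L c" "\<And>e w. c e w \<noteq> 0 \<Longrightarrow> length w = p \<or> length w = Suc p"
    and cyc: "\<And>e w. p \<le> length w \<Longrightarrow> tot U c e w \<in> Z (Y - set w) B"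
  shows "\<exists>b. chain Y U (Suc L) b \<and> (\<forall>e w. b e w \<noteq> 0 \<longrightarrow> length w = p \<or> length w = Suc p) \<and>
    (\<forall>e w. p \<le> length w \<longrightarrow> c e w - tot U b e w \<in> Z (Y - set w) B)"
proof -
  have U\<Omega>: "U \<subseteq> \<Omega>" using Y by auto
  have YZ: "subgrp (Z (Y - A) B)" for A using Y(1) by (auto intro!: Z_subgrp)
  \<comment> \<open>\<open>K\<close> maps column \<open>p + 1\<close> to column \<open>p\<close> and
    squares to zero, so the passage to \<open>c - K c\<close> below is undone by
    \<open>a + K a\<close> at the end.\<close>
  define K where "K = (\<lambda>c e w. if length w = p \<and> set w \<subseteq> U then alt (length e) (hom2 U c e w) else 0)"
  have K_chain: "chain Y U L' (K b)" if "chain Y U L' b" for L' b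
    unfolding K_def by (rule chain_hom2[OF that Y(1,2)])
  have K_supp: "K b e w = 0" if "length w \<noteq> p" for b e w using that by (simp add: K_def)
  have hZ: "hom2 U b e w \<in> Z (Y - set w) B"
    if "\<And>e' w'. length w' = Suc (length w) \<Longrightarrow> e' \<noteq> [] \<Longrightarrow> b e' w' \<in> Z (Y - set w') B" for b e w
  proof (rule hom2_closed[OF YZ])
    fix e' :: "(nat \<Rightarrow> nat) list" and w' x
    assume *: "x \<in> U" "set w' = insert x (set w)" "length w' = Suc (length w)" "e' \<noteq> []"
    have "Z (Y - set w') B \<subseteq> Z (Y - set w) B" using Y(1) * by (intro Z_mono) auto
    then show "b e' w' \<in> Z (Y - set w) B" using that[of w' e'] * by auto
  qed
  define \<delta> where "\<delta> = (\<lambda>b e (w :: nat list). ins X (\<lambda>e. b e w) e :: 'b)"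
  have H1: "tot U b e w = tot_front p U b e w + alt (length e) (\<delta> (hom2 U b) e w) + alt (length e) (hom2 U (\<delta> b) e w)"
    if b: "chain Y U L' b" and "length w = p" "set w \<subseteq> U" "set e \<subseteq> X" "e \<noteq> []" for b L' e w
  proof -
    have "ins U (b e) w = (\<Sum>x\<in>U. b e (x # w)) + ins X (\<lambda>e. hom2 U b e w) e
       + hom2 U (\<lambda>e w. ins X (\<lambda>e. b e w) e) e w"
    proof (rule hom2_ins[OF U\<Omega>])
      fix u v x y e assume "x \<in> U" "y \<in> U"
      then show "b (map (swp x y) e) (u @ x # y # v) = b e (u @ y # x # v)" by (rule chain_swp[OF b Y(1,2)])
    next
      fix e and w :: "nat list" assume "\<not> distinct w" then show "b e w = 0" by (intro chain_0[OF b]) auto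
    qed (use that p in auto)
    then show ?thesis using that by (simp add: tot_def tot_front_def \<delta>_def alt_add)
  qed
  have H2: "\<delta> (K b) e w = - alt (length e) (\<delta> (hom2 U b) e w)" if "length w = p" "set w \<subseteq> U" for b e w
  proof -
    have "\<delta> (K b) e w = ins X (\<lambda>e'. alt (Suc (length e)) (hom2 U b e' w)) e"
      unfolding \<delta>_def by (rule ins_cong) (use that in \<open>auto simp: K_def\<close>)
    then show ?thesis by (simp add: \<delta>_def ins_uminus ins_alt)
  qed
  have triv: "tot U b e w = 0" "tot_front p U b e w = 0" "b e w = 0"
    if b: "chain Y U (Suc L') b" and "\<not> (e \<noteq> [] \<and> set e \<subseteq> X \<and> set w \<subseteq> U)" for b L' e w
  proof -
    show "b e w = 0" using that(2) by (intro chain_0[OF b]) auto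
    show "tot U b e w = 0" using that(2) by (intro chain_0[OF chain_tot[OF b Y(1,2)]]) auto
    have "ins X (\<lambda>e. b e w) e = 0" if "e \<noteq> []"
      by (rule ins_eq_0, rule chain_0[OF b]) (use that \<open>\<not> (e \<noteq> [] \<and> set e \<subseteq> X \<and> set w \<subseteq> U)\<close> in auto)
    moreover have "(\<Sum>x\<in>U. b e (x # w)) = 0"
      using that(2) by (intro sum.neutral ballI chain_0[OF b]) auto
    ultimately show "tot_front p U b e w = 0" by (simp add: tot_front_def)
  qed
  have long: "tot U b e w = tot_front p U b e w"
    if "\<And>e w. b e w \<noteq> 0 \<Longrightarrow> length w = p \<or> length w = Suc p" "p < length w" for b e w
  proof -
    have "ins U (b e) w = 0" by (rule ins_eq_0) (use that in fastforce)
    then show ?thesis using that(2) by (simp add: tot_def tot_front_def)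
  qed
  \<comment> \<open>\<open>triv\<close> is about positive total length. For \<open>L = 0\<close> the
    chain is zero, and zero is a chain of total length 1 as well.\<close>
  obtain L0 where L: "chain Y U (Suc L0) c"
  proof (cases L)
    case 0
    then have "chain Y U (Suc 0) c" using c(1) chain_0[OF c(1)] unfolding chain_def by (metis add_is_0 length_0_conv)
    then show thesis by (rule that)
  qed (use c(1) that in blast)
  define c1 where "c1 = (\<lambda>e w. c e w - K c e w)"
  have c1: "chain Y U L c1" unfolding c1_def by (intro chain_diff c K_chain Y)
  have L1: "chain Y U (Suc L0) c1" unfolding c1_def by (intro chain_diff L K_chain Y)
  have c1_supp: "length w = p \<or> length w = Suc p" if "c1 e w \<noteq> 0" for e w
    using that c(2)[of e w] K_supp[of w c e] by (cases "length w = p") (auto simp: c1_def)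
  have \<delta>c: "\<delta> c e w \<in> Z (Y - set w) B" if "length w = Suc p" "e \<noteq> []" for e w
    using cyc[of w e] long[OF c(2), where e = e and w = w] that by (simp add: \<delta>_def tot_front_def)
  have c1_cyc: "tot_front p U c1 e w \<in> Z (Y - set w) B" for e w
  proof (cases "e \<noteq> [] \<and> set e \<subseteq> X \<and> set w \<subseteq> U")
    case False
    then show ?thesis using triv(2)[OF L1] subgrp_0[OF YZ] by simp
  next
    case ew: True
    show ?thesis
    proof (cases "length w = p")
      case True
      have "(\<Sum>x\<in>U. c1 e (x # w)) = (\<Sum>x\<in>U. c e (x # w))" using True by (simp add: c1_def K_supp)
      moreover have "ins X (\<lambda>e. c1 e w) e = \<delta> c e w - \<delta> (K c) e w" by (simp add: c1_def \<delta>_def ins_diff)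
      ultimately have "tot_front p U c1 e w = tot_front p U c e w - \<delta> (K c) e w"
        using True ew by (simp add: tot_front_def \<delta>_def)
      \<comment> \<open>The term with \<open>\<delta>\<close> outside \<open>hom2\<close> cancels
        against \<open>\<delta> (K c)\<close>; the one with \<open>\<delta>\<close> inside lies in
        \<open>Z\<close> because \<open>\<delta> c\<close> does on column
        \<open>p + 1\<close>.\<close>
      also have "\<dots> = tot U c e w - alt (length e) (hom2 U (\<delta> c) e w)"
        using H1[OF c(1) True] H2[OF True, of c e] ew by simp
      also have "\<dots> \<in> Z (Y - set w) B"
        using cyc[of w e] True by (intro subgrp_diff[OF YZ] subgrp_alt[OF YZ] hZ) (auto intro: \<delta>c)
      finally show ?thesis .
    next
      case False
      have eq: "tot_front p U c1 e w = \<delta> c e w"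
        using False ew by (simp add: tot_front_def \<delta>_def c1_def ins_diff K_supp)
      show ?thesis
      proof (cases "length w = Suc p")
        case True
        then show ?thesis using \<delta>c ew eq by simp
      next
        case F: False
        have "\<delta> c e w = 0" unfolding \<delta>_def by (rule ins_eq_0) (use c(2) F False in blast)
        then show ?thesis using eq subgrp_0[OF YZ] by simp
      qed
    qed
  qed
  obtain a where a: "chain Y U (Suc L) a" "\<And>e w. a e w \<noteq> 0 \<Longrightarrow> length w = p \<or> length w = Suc p"
    "\<And>e w. c1 e w - tot_front p U a e w \<in> Z (Y - set w) B"
  proof -
    have "\<exists>a. chain Y U (Suc L) a \<and> (\<forall>e w. a e w \<noteq> 0 \<longrightarrow> length w = p \<or> length w = Suc p) \<and>
      (\<forall>e w. c1 e w - tot_front p U a e w \<in> Z (Y - set w) B)"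
    proof (rule front_exact[OF Y _ p(1) c1])
      fix u assume "distinct u" "set u \<subseteq> U" "length u = p"
      then show "stab (L - p) (Y - set u) (U - set u) B" by (rule R)
    next
      fix e w assume "c1 e w \<noteq> 0" then show "length w = p \<or> length w = Suc p" by (rule c1_supp)
    qed (rule c1_cyc)
    then show thesis using that by blast
  qed
  define b where "b = (\<lambda>e w. a e w + K a e w)"
  have b: "chain Y U (Suc L) b" unfolding b_def by (intro chain_add a K_chain Y)
  have b_supp: "length w = p \<or> length w = Suc p" if "b e w \<noteq> 0" for e w
    using that a(2)[of e w] K_supp[of w a e] by (cases "length w = p") (auto simp: b_def)
  have "c e w - tot U b e w \<in> Z (Y - set w) B" if pw: "p \<le> length w" for e w
  proof (cases "e \<noteq> [] \<and> set e \<subseteq> X \<and> set w \<subseteq> U")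
    case False
    then show ?thesis using triv(1)[OF b] triv(3)[OF L] subgrp_0[OF YZ] by simp
  next
    case ew: True
    show ?thesis
    proof (cases "length w = p")
      case False
      then have pw: "p < length w" using pw by simp
      have "tot_front p U b e w = tot_front p U a e w"
        using False by (simp add: tot_front_def b_def ins_add K_supp)
      moreover have "c1 e w = c e w" using False by (simp add: c1_def K_supp)
      ultimately show ?thesis using a(3)[of e w] long[OF b_supp pw, where e = e] by simp
    next
      case True
      have "ins U (K a e) w = 0" by (rule ins_eq_0) (use True K_supp in auto)
      then have "tot U (K a) e w = \<delta> (K a) e w" using ew by (simp add: tot_def \<delta>_def)
      then have "tot U b e w = tot_front p U a e w + alt (length e) (hom2 U (\<delta> a) e w)"
        unfolding b_def tot_add using H1[OF a(1) True, of e] H2[OF True, of a e] ew by simp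
      moreover have "K c e w = alt (length e) (hom2 U c e w)" using True ew by (simp add: K_def)
      ultimately have "c e w - tot U b e w = (c1 e w - tot_front p U a e w) +
          alt (length e) (hom2 U (\<lambda>e w. c e w - \<delta> a e w) e w)"
        by (simp add: c1_def hom2_diff alt_diff)
      also have "\<dots> \<in> Z (Y - set w) B"
      proof (intro subgrp_add[OF YZ] a(3) subgrp_alt[OF YZ] hZ)
        fix e' :: "(nat \<Rightarrow> nat) list" and w' :: "nat list" assume *: "length w' = Suc (length w)" "e' \<noteq> []"
        then show "c e' w' - \<delta> a e' w' \<in> Z (Y - set w') B"
          using a(3)[of e' w'] True by (simp add: c1_def K_supp tot_front_def \<delta>_def)
      qed
      finally show ?thesis .
    qed
  qed
  then show ?thesis using b b_supp by blast
qed

text \<open>The cycle is filled in the whole complex of words, and the columns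
  \<open>2j + 2, 2j + 3\<close> of the filling are then removed from the top down. The topmost pair
  is a cycle up to lower columns, and \<open>level_exact\<close> makes it a boundary, using the
  statement for smaller \<open>L\<close>. The tightest case is \<open>j = 0\<close>, where both
  sides of the bound drop by exactly 2.\<close>

lemma stab_injective:
  assumes "Y \<subseteq> \<Omega>" "U \<subseteq> Y" "B \<subseteq> Y" "U \<inter> B = {}" "m \<le> card (Y - U)" "2 * L + q \<le> card U + card B + 2"
  shows "stab L Y U B"
  using assms
proof (induction L arbitrary: Y U rule: less_induct)
  case (less L)
  note Y = less.prems(1-4)
  show ?case
  proof (cases "L = 0")
    case True
    then show ?thesis using stab_0[OF Y(1,2)] by simp
  next
    case False
    have YZ: "subgrp (Z (Y - A) B)" for A using Y(1) by (auto intro!: Z_subgrp)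
    show ?thesis unfolding stab_def
    proof (intro allI impI)
      fix c assume c: "chain Y U L c \<and> (\<forall>e w. 1 < length w \<longrightarrow> c e w = 0) \<and> null Y B (tot U c)"
      have "L + q \<le> Suc (card U + card B)" using less.prems(6) False by linarith
      then obtain b0 where b0: "chain Y U (Suc L) b0" "null Y B (\<lambda>e w. c e w - tot U b0 e w)"
        using chain_exact[OF Y less.prems(5), of L c] c by blast
      have "\<exists>b'. chain Y U (Suc L) b' \<and> (\<forall>e w. 1 < length w \<longrightarrow> b' e w = 0) \<and> null Y B (\<lambda>e w. c e w - tot U b' e w)"
        if "chain Y U (Suc L) b" "null Y B (\<lambda>e w. c e w - tot U b e w)" "\<And>e w. 2 * j + 1 < length w \<Longrightarrow> b e w = 0" for b j
        using that
      proof (induction j arbitrary: b)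
        case 0
        then show ?case by auto
      next
        case (Suc j)
        note b = Suc.prems(1,2)
        define p where "p = 2 * j + 2"
        show ?case
        proof (cases "p \<le> Suc L")
          case False
          then have "b e w = 0" if "2 * j + 1 < length w" for e w
            using that by (intro chain_0[OF b(1)]) (auto simp: p_def)
          then show ?thesis using Suc.IH b by blast
        next
          case pL: True
          define bj where "bj = (\<lambda>e w. if p \<le> length w then b e w else 0)"
          have bj: "chain Y U (Suc L) bj" unfolding bj_def by (rule chain_restrict[OF b(1) Y(1,2)])
          have bj_supp: "length w = p \<or> length w = Suc p" if "bj e w \<noteq> 0" for e w
          proof -
            have "b e w \<noteq> 0" "p \<le> length w" using that by (auto simp: bj_def split: if_splits)
            then have "length w \<le> Suc p" using Suc.prems(3)[of w e] by (auto simp: p_def intro: leI)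
            then show ?thesis using \<open>p \<le> length w\<close> by linarith
          qed
          have tot_bj: "tot U bj e w = tot U b e w" if "p \<le> length w" for e w
          proof -
            have "ins U (bj e) w = ins U (b e) w" by (rule ins_cong) (use that in \<open>auto simp: bj_def\<close>)
            then show ?thesis using that by (simp add: tot_def bj_def)
          qed
          \<comment> \<open>\<open>c\<close> lives in word lengths 0 and 1, so from
            \<open>p \<ge> 2\<close> on the boundary of the filling is itself in
            \<open>Z\<close>.\<close>
          have cyc: "tot U bj e w \<in> Z (Y - set w) B" if "p \<le> length w" for e w
          proof -
            have "c e w = 0" using c that by (auto simp: p_def)
            then have "- tot U b e w \<in> Z (Y - set w) B" using b(2) unfolding null_def zero_mod_def by (metis diff_0)
            then show ?thesis using subgrp_uminus[OF YZ, of "- tot U b e w"] tot_bj[OF that] by simp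
          qed
          have st: "stab (Suc L - p) (Y - set u) (U - set u) B" if u: "distinct u" "set u \<subseteq> U" "length u = p" for u
          proof (rule less.IH)
            have fU: "finite U" using fin_sub Y by blast
            have cu: "card (set u) = p" using u distinct_card by metis
            show "Suc L - p < L" using False by (simp add: p_def)
            show "Y - set u \<subseteq> \<Omega>" "U - set u \<subseteq> Y - set u" "B \<subseteq> Y - set u" "(U - set u) \<inter> B = {}"
              using Y u by auto
            have "Y - set u - (U - set u) = Y - U" using u by auto
            then show "m \<le> card (Y - set u - (U - set u))" using less.prems(5) by simp
            have "card (U - set u) = card U - p" "p \<le> card U"
              using card_Diff_subset[of "set u" U] card_mono[OF fU u(2)] u(2) cu by auto
            \<comment> \<open>The left side drops by \<open>2p - 2\<close>, the right side by
              \<open>p\<close>; \<open>p \<ge> 2\<close> is just enough.\<close>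
            then show "2 * (Suc L - p) + q \<le> card (U - set u) + card B + 2"
              using less.prems(6) pL p_def by simp
          qed
          have "even p" by (simp add: p_def)
          have "\<exists>a. chain Y U (Suc (Suc L)) a \<and> (\<forall>e w. a e w \<noteq> 0 \<longrightarrow> length w = p \<or> length w = Suc p) \<and>
            (\<forall>e w. p \<le> length w \<longrightarrow> bj e w - tot U a e w \<in> Z (Y - set w) B)"
          proof (rule level_exact[OF Y(1,2,4) _ pL \<open>even p\<close> bj])
            fix u assume "distinct u" "set u \<subseteq> U" "length u = p"
            then show "stab (Suc L - p) (Y - set u) (U - set u) B" by (rule st)
          next
            fix e w assume "bj e w \<noteq> 0" then show "length w = p \<or> length w = Suc p" by (rule bj_supp)
          next
            fix e w assume "p \<le> length (w :: nat list)" then show "tot U bj e w \<in> Z (Y - set w) B" by (rule cyc)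
          qed
          then obtain a where a: "chain Y U (Suc (Suc L)) a"
            "\<And>e w. p \<le> length w \<Longrightarrow> bj e w - tot U a e w \<in> Z (Y - set w) B" by blast
          define b1 where "b1 = (\<lambda>e w. b e w - tot U a e w)"
          have b1: "chain Y U (Suc L) b1" unfolding b1_def by (intro chain_diff b chain_tot a Y)
          define b2 where "b2 = (\<lambda>e w. if length w < p then b1 e w else 0)"
          have b2: "chain Y U (Suc L) b2" unfolding b2_def by (rule chain_restrict[OF b1 Y(1,2)])
          have b12: "null Y B (\<lambda>e w. b1 e w - b2 e w)"
            unfolding null_def zero_mod_def
          proof (intro allI)
            fix e w show "b1 e w - b2 e w \<in> Z (Y - set w) B"
              using a(2)[of w e] subgrp_0[OF YZ, of "set w"] by (auto simp: b1_def b2_def bj_def)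
          qed
          have "c e w - tot U b2 e w = (c e w - tot U b e w) + tot U (\<lambda>e w. b1 e w - b2 e w) e w" for e w
            by (simp add: tot_diff b1_def tot_tot)
          then have "null Y B (\<lambda>e w. c e w - tot U b2 e w)"
            using null_add[OF b(2) null_tot[OF b12 Y(1)] Y(1)] by presburger
          moreover have "b2 e w = 0" if "2 * j + 1 < length w" for e w using that by (simp add: b2_def p_def)
          ultimately show ?thesis using Suc.IH[OF b2] by blast
        qed
      qed
      moreover have "b0 e w = 0" if "2 * L + 1 < length w" for e w using that by (intro chain_0[OF b0(1)]) auto
      ultimately show "\<exists>b. chain Y U (Suc L) b \<and> (\<forall>e w. 1 < length w \<longrightarrow> b e w = 0) \<and> null Y B (\<lambda>e w. c e w - tot U b e w)"
        using b0 by blast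
    qed
  qed
qed

text \<open>The long exact sequence of \<open>0 \<rightarrow> N \<rightarrow> \<Sigma>N \<rightarrow> DN \<rightarrow> 0\<close>, \<open>\<Sigma>\<close> the shift by \<open>x\<close>.\<close>

lemma stab_shift:
  assumes Y: "insert x Y \<subseteq> \<Omega>" "x \<notin> Y" "U \<subseteq> Y" "B \<subseteq> Y" "U \<inter> B = {}" "m < card Y"
    and shift: "stab L (insert x Y) U B" and der: "stab (Suc L) (insert x Y) U (insert x B)"
  shows "stab L Y U B"
  unfolding stab_def
proof (intro allI impI)
  fix c assume c: "chain Y U L c \<and> (\<forall>e w. 1 < length w \<longrightarrow> c e w = 0) \<and> null Y B (tot U c)"
  define Y' where "Y' = insert x Y"
  have Y\<Omega>: "Y \<subseteq> \<Omega>" and Y'\<Omega>: "Y' \<subseteq> \<Omega>" and UY': "U \<subseteq> Y'" and U\<Omega>: "U \<subseteq> \<Omega>" using Y by (auto simp: Y'_def)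
  have fB: "finite B" using fin_sub[OF Y\<Omega>] Y(4) finite_subset by blast
  have xB: "x \<notin> B" "x \<notin> U" using Y by auto
  have YY': "Y' - set w - {x} = Y - set w" for w using Y(2) by (auto simp: Y'_def)
  have M': "M (Y - set w) \<subseteq> M (Y' - set w)" for w using Y'\<Omega> by (intro M_mono) (auto simp: Y'_def)
  have Z': "Z (Y - set w) B \<subseteq> Z (Y' - set w) B" for w using Y'\<Omega> by (intro Z_mono) (auto simp: Y'_def)
  have Z'': "Z (Y' - set w) B \<subseteq> Z (Y' - set w) (insert x B)" for w
    using Y'\<Omega> fB by (intro Z_insert_mono) auto
  have Y'Z: "subgrp (Z (Y' - A) (insert x B))" "subgrp (Z (Y' - A) B)" for A using Y'\<Omega> by (auto intro!: Z_subgrp)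
  have MZ: "M (Y - set w) \<subseteq> Z (Y' - set w) (insert x B)" for w
  proof
    fix v assume "v \<in> M (Y - set w)"
    then show "v \<in> Z (Y' - set w) (insert x B)"
      unfolding Z_insert[OF fB xB(1)] YY' using subgrp_0[OF Y'Z(2)] by (intro bexI[of _ v] bexI[of _ 0]) auto
  qed
  have cY': "chain Y' U L c"
    using c M' unfolding chain_def by blast
  have "null Y' B (tot U c)" using c Z' unfolding null_def zero_mod_def by blast
  then obtain b where b: "chain Y' U (Suc L) b" "\<And>e w. 1 < length w \<Longrightarrow> b e w = 0"
    "null Y' B (\<lambda>e w. c e w - tot U b e w)"
    using shift cY' c unfolding stab_def Y'_def by blast
  \<comment> \<open>In the derived coefficients \<open>c\<close> becomes zero, its values lying in
    \<open>M (Y - set w)\<close>. Hence \<open>b\<close> is a cycle there.\<close>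
  have "null Y' (insert x B) (tot U b)"
    unfolding null_def zero_mod_def
  proof (intro allI)
    fix e w
    have "c e w \<in> Z (Y' - set w) (insert x B)" using MZ chain_M[of Y U L c e w] c by blast
    moreover have "c e w - tot U b e w \<in> Z (Y' - set w) (insert x B)"
      using b(3) Z'' unfolding null_def zero_mod_def by blast
    ultimately show "tot U b e w \<in> Z (Y' - set w) (insert x B)"
      using subgrp_diff[OF Y'Z(1), of "c e w" "set w" "c e w - tot U b e w"] by simp
  qed
  then obtain u where u: "chain Y' U (Suc (Suc L)) u" "\<And>e w. 1 < length w \<Longrightarrow> u e w = 0"
    "null Y' (insert x B) (\<lambda>e w. b e w - tot U u e w)"
    using der b unfolding stab_def Y'_def by blast
  define d where "d = (\<lambda>e w. b e w - tot U u e w)"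
  have d: "chain Y' U (Suc L) d" unfolding d_def by (intro chain_diff b chain_tot u Y'\<Omega> UY')
  have d_long: "d e w = 0" if "1 < length w" for e w
  proof -
    have "ins X (\<lambda>e. u e w) e = 0" "ins U (u e) w = 0"
      by (rule ins_eq_0, rule u(2), use that in auto)+
    then show ?thesis using b(2)[OF that] by (simp add: d_def tot_def)
  qed
  define good where "good = (\<lambda>(e :: (nat \<Rightarrow> nat) list) w. distinct w \<and> set w \<subseteq> U \<and> length e + length w = Suc L \<and> length w \<le> 1)"
  \<comment> \<open>\<open>d\<close> has values in \<open>M (Y - set w) + Z (Y' - set w) B\<close>;
    the choice extracts the first summand, which is a chain over \<open>Y\<close>.\<close>
  define Q where "Q = (\<lambda>e f. \<forall>w. f w \<in> M (Y - set w) \<and> d e w - f w \<in> Z (Y' - set w) B \<and> (\<not> good e w \<longrightarrow> f w = 0))"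
  obtain \<epsilon> where \<epsilon>: "\<And>e. e \<noteq> [] \<Longrightarrow> set e \<subseteq> X \<Longrightarrow> Q e (\<epsilon> e)"
      "\<And>e w. \<not> (e \<noteq> [] \<and> set e \<subseteq> X) \<Longrightarrow> \<epsilon> e w = 0" "equivariant U \<epsilon>"
  proof (rule equivariant_choice[where Q = Q and U = U])
    fix e
    show "\<exists>f. Q e f" unfolding Q_def
    proof (rule choice, rule allI)
      fix w
      show "\<exists>f. f \<in> M (Y - set w) \<and> d e w - f \<in> Z (Y' - set w) B \<and> (\<not> good e w \<longrightarrow> f = 0)"
      proof (cases "good e w")
        case True
        obtain a z where "a \<in> M (Y' - set w - {x})" "z \<in> Z (Y' - set w) B" "d e w = a + z"
          using u(3) Z_insert[OF fB xB(1), of _ "Y' - set w"] unfolding null_def zero_mod_def d_def by blast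
        then show ?thesis using True YY' by (intro exI[of _ a]) auto
      next
        case False
        then have "d e w = 0" using d_long[of w e] chain_0[OF d, of e w] by (auto simp: good_def)
        then show ?thesis using subgrp_0[OF Y'Z(2), of "set w"] subgrp_0[OF M_subgrp, of "Y - set w"] Y\<Omega>
          by (intro exI[of _ 0]) auto
      qed
    qed
  next
    fix e f w assume "Q e f"
    then show "f w \<in> M \<Omega>" using M_sub[of "Y - set w" "f w"] Y\<Omega> by (auto simp: Q_def)
  next
    fix g e f assume g: "g permutes U" and Q: "Q e f"
    have g\<Omega>: "g permutes \<Omega>" using perm_sub[OF g U\<Omega>] .
    note i = permutes_inv[OF g]
    show "Q (map ((\<circ>) g) e) (\<lambda>w. \<rho> g (f (map (inv g) w)))"
      unfolding Q_def
    proof (intro allI conjI impI)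
      fix w
      let ?w = "map (inv g) w"
      have f: "f ?w \<in> M (Y - set ?w)" "d e ?w - f ?w \<in> Z (Y' - set ?w) B" "\<not> good e ?w \<Longrightarrow> f ?w = 0"
        using Q unfolding Q_def by blast+
      have "\<rho> g (f ?w) \<in> M (g ` (Y - set ?w))" by (intro \<rho>_M g\<Omega> f) (use Y\<Omega> in auto)
      then show "\<rho> g (f ?w) \<in> M (Y - set w)" unfolding perm_image[OF g Y(3)] map_inv_perm(1)[OF g] .
      have "d (map ((\<circ>) g) e) w = \<rho> g (d e ?w)"
        using chain_eq[OF d g, of e ?w] unfolding map_inv_perm(1)[OF g] .
      moreover have "Y - set ?w \<subseteq> \<Omega>" using Y\<Omega> by blast
      ultimately have "d (map ((\<circ>) g) e) w - \<rho> g (f ?w) = \<rho> g (d e ?w - f ?w)"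
        using additive_on_diff[OF \<rho>_additive[OF g\<Omega>] chain_M\<Omega>[OF d Y'\<Omega>] M_sub[OF _ f(1)]] by simp
      also have "\<dots> \<in> Z (g ` (Y' - set ?w)) B"
        by (rule \<rho>_Z[OF g\<Omega> _ _ f(2)]) (use g Y(5) Y'\<Omega> in \<open>auto simp: permutes_def\<close>)
      finally show "d (map ((\<circ>) g) e) w - \<rho> g (f ?w) \<in> Z (Y' - set w) B"
        unfolding perm_image[OF g UY'] map_inv_perm(1)[OF g] .
      assume "\<not> good (map ((\<circ>) g) e) w"
      then have "\<not> good e ?w" using perm_map_sub[OF i, of w] perm_map_distinct[OF i, of w] by (auto simp: good_def)
      then show "\<rho> g (f ?w) = 0" using f(3) g\<Omega> by simp
    qed
  qed (use U\<Omega> in auto)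
  have \<epsilon>_chain: "chain Y U (Suc L) \<epsilon>"
  proof (rule chainI)
    fix e w assume "\<not> (e \<noteq> [] \<and> set e \<subseteq> X \<and> distinct w \<and> set w \<subseteq> U \<and> length e + length w = Suc L)"
    then show "\<epsilon> e w = 0" using \<epsilon>(1)[of e] \<epsilon>(2)[of e w] unfolding Q_def good_def by blast
  next
    fix e :: "(nat \<Rightarrow> nat) list" and w assume "e \<noteq> []" "set e \<subseteq> X"
    then show "\<epsilon> e w \<in> M (Y - set w)" using \<epsilon>(1)[of e] unfolding Q_def by blast
  qed (use \<epsilon>(3) Y\<Omega> Y(3) in \<open>auto simp: equivariant_def\<close>)
  have \<epsilon>_long: "\<epsilon> e w = 0" if "1 < length w" for e w
    using \<epsilon>(1)[of e] \<epsilon>(2)[of e w] that unfolding Q_def good_def by force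
  have d\<epsilon>: "null Y' B (\<lambda>e w. d e w - \<epsilon> e w)"
    unfolding null_def zero_mod_def
  proof (intro allI)
    fix e w
    show "d e w - \<epsilon> e w \<in> Z (Y' - set w) B"
    proof (cases "e \<noteq> [] \<and> set e \<subseteq> X")
      case False
      then have "d e w = 0" "\<epsilon> e w = 0" using chain_0[OF d] \<epsilon>(2) by blast+
      then show ?thesis using subgrp_0[OF Y'Z(2)] by simp
    qed (use \<epsilon>(1) in \<open>auto simp: Q_def\<close>)
  qed
  have eq: "c e w - tot U \<epsilon> e w = (c e w - tot U b e w) + tot U (\<lambda>e w. d e w - \<epsilon> e w) e w" for e w
    by (simp add: tot_diff d_def tot_tot)
  have res: "null Y' B (\<lambda>e w. c e w - tot U \<epsilon> e w)"
    unfolding eq using null_add[OF b(3) null_tot[OF d\<epsilon> Y'\<Omega>] Y'\<Omega>] .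
  have c': "chain Y U L (\<lambda>e w. c e w - tot U \<epsilon> e w)"
    using c by (intro chain_diff chain_tot \<epsilon>_chain Y\<Omega> Y(3)) auto
  have "null Y B (\<lambda>e w. c e w - tot U \<epsilon> e w)"
    unfolding null_def zero_mod_def
  proof (intro allI)
    fix e w
    let ?v = "c e w - tot U \<epsilon> e w"
    have YZ: "0 \<in> Z (Y - set w) B" using Y\<Omega> by (auto intro!: subgrp_0 Z_subgrp)
    show "?v \<in> Z (Y - set w) B"
    proof (cases "set w \<subseteq> U \<and> length w \<le> 1")
      case True
      have fY: "finite Y" by (rule fin_sub[OF Y\<Omega>])
      have "card (set w) \<le> 1" using card_length[of w] True by linarith
      \<comment> \<open>At most one letter is removed from the more than \<open>m\<close> points of
        \<open>Y\<close>; together with \<open>x\<close> there are more than \<open>m\<close> again,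
        as \<open>inj_mod\<close> demands.\<close>
      then have "m \<le> card (Y - set w)" using Y(6) card_Diff_subset[of "set w" Y] True Y(3) by auto
      moreover have "Y' - set w = insert x (Y - set w)" "x \<notin> Y - set w" using Y(2) xB True by (auto simp: Y'_def)
      ultimately have "m < card (Y' - set w)" using fY by simp
      moreover have "x \<in> Y' - set w" using xB True by (auto simp: Y'_def)
      moreover have "B \<subseteq> Y' - set w" using Y True by (auto simp: Y'_def)
      moreover have "?v \<in> M (Y' - set w - {x})" using chain_M[OF c', of e w] unfolding YY' .
      moreover have "?v \<in> Z (Y' - set w) B" using res unfolding null_def zero_mod_def by blast
      ultimately have "?v \<in> Z (Y' - set w - {x}) B"
        using Y'\<Omega> xB by (intro inj_mod) auto
      then show ?thesis unfolding YY' .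
    next
      case False
      have "?v = 0"
      proof (cases "set w \<subseteq> U")
        case True
        then have "1 < length w" using False by auto
        then have "ins X (\<lambda>e. \<epsilon> e w) e = 0" "ins U (\<epsilon> e) w = 0"
          by - (rule ins_eq_0, rule \<epsilon>_long, auto)+
        then show ?thesis using c \<open>1 < length w\<close> by (simp add: tot_def)
      qed (use chain_0[OF c'] in blast)
      then show ?thesis using YZ by simp
    qed
  qed
  then show "\<exists>b. chain Y U (Suc L) b \<and> (\<forall>e w. 1 < length w \<longrightarrow> b e w = 0) \<and> null Y B (\<lambda>e w. c e w - tot U b e w)"
    using \<epsilon>_chain \<epsilon>_long by blast
qed

text \<open>Induction on the number of shifts still missing until
  \<open>m \<le> card (Y - U)\<close>. The shifted term keeps the bound; the derived term adds 1 to
  both \<open>L\<close> and \<open>card B\<close>, which moves both sides by 2. The factor 2 at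
  \<open>q\<close> is the price of these derivations.\<close>

lemma stability:
  assumes "Y \<subseteq> \<Omega>" "U \<subseteq> Y" "B \<subseteq> Y" "U \<inter> B = {}" "m < card Y" "m \<le> card (Y - U) + card (\<Omega> - Y)"
    "2 * L + 2 * q \<le> card U + 2 * card B + 3"
  shows "stab L Y U B"
  using assms
proof (induction "m - card (Y - U)" arbitrary: Y B L)
  case 0
  note Y = "0.prems"(1-4)
  have fY: "finite Y" by (rule fin_sub[OF Y(1)])
  show ?case
  proof (cases "q \<le> card B")
    case True
    show ?thesis
    proof (rule stab_zero[OF Y(1,2)])
      fix c e w assume c: "chain Y U L c"
      show "1 < length w \<or> c e w \<in> Z (Y - set w) B"
      proof (cases "set w \<subseteq> U")
        case w: True
        have "card (Y - U) \<le> card (Y - set w)" using fY w by (intro card_mono) auto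
        then have "m \<le> card (Y - set w)" using "0.hyps" by linarith
        then show ?thesis using vanish[of "Y - set w" B] True w Y chain_M[OF c, of e w] by blast
      next
        case False
        then have "c e w = 0" using chain_0[OF c] by blast
        then show ?thesis using Y(1) by (auto intro!: subgrp_0 Z_subgrp)
      qed
    qed
  next
    case False
    \<comment> \<open>Here \<open>card B < q\<close>, so one \<open>q\<close> on the left may be
      traded for \<open>Suc (card B)\<close>, which gives the bound of
      \<open>stab_injective\<close>.\<close>
    then show ?thesis using stab_injective[OF Y] "0.hyps" "0.prems"(7) by simp
  qed
next
  case (Suc k)
  note Y = Suc.prems(1-4)
  have fY: "finite Y" by (rule fin_sub[OF Y(1)])
  have lt: "card (Y - U) < m" using Suc.hyps(2) by simp
  then have "card (\<Omega> - Y) \<noteq> 0" using Suc.prems(6) by linarith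
  then have "\<Omega> - Y \<noteq> {}" by (intro notI) simp
  then obtain x where x: "x \<in> \<Omega>" "x \<notin> Y" by blast
  have fB: "finite B" "x \<notin> B" using Y x fY finite_subset by auto
  have c1: "card (insert x Y - U) = Suc (card (Y - U))"
  proof -
    have "insert x Y - U = insert x (Y - U)" "x \<notin> Y - U" using x Y(2) by auto
    then show ?thesis using fY by simp
  qed
  have c2: "Suc (card (\<Omega> - insert x Y)) = card (\<Omega> - Y)"
  proof -
    have "\<Omega> - Y = insert x (\<Omega> - insert x Y)" "x \<notin> \<Omega> - insert x Y" using x by auto
    then show ?thesis using fin by (metis card_insert_disjoint finite_Diff)
  qed
  have k: "k = m - card (insert x Y - U)" using Suc.hyps(2) c1 by simp
  have cY: "card (insert x Y) = Suc (card Y)" using fY x by simp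
  have mY: "m < card (insert x Y)" "m \<le> card (insert x Y - U) + card (\<Omega> - insert x Y)"
    using Suc.prems(5,6) cY c1 c2 by linarith+
  have sub: "insert x Y \<subseteq> \<Omega>" "U \<subseteq> insert x Y" "B \<subseteq> insert x Y" "insert x B \<subseteq> insert x Y" "U \<inter> insert x B = {}"
    using Y x by blast+
  have "2 * Suc L + 2 * q \<le> card U + 2 * card (insert x B) + 3" using Suc.prems(7) fB by simp
  note shifts = Suc.hyps(1)[OF k sub(1,2,3) Y(4) mY Suc.prems(7)] Suc.hyps(1)[OF k sub(1,2,4,5) mY this]
  show ?case by (rule stab_shift[OF sub(1) x(2) Y(2,3,4) Suc.prems(5) shifts])
qed

end

section \<open>Polynomial FI-modules\<close>

locale fi_mod =
  fixes scale :: "'k::comm_ring_1 \<Rightarrow> 'b::ab_group_add \<Rightarrow> 'b"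
    and V :: "nat set \<Rightarrow> 'b set" and act :: "nat set \<Rightarrow> nat set \<Rightarrow> (nat \<Rightarrow> nat) \<Rightarrow> 'b \<Rightarrow> 'b"
  assumes fi: "fi_module scale V act"
begin

lemma V_subgrp:
  assumes "finite S" shows "subgrp (V S)"
  unfolding subgrp_def
proof (intro conjI ballI)
  have m: "module scale" by (rule fi[unfolded fi_module_def, THEN conjunct1])
  have *: "0 \<in> V S" "\<And>x y. x \<in> V S \<Longrightarrow> y \<in> V S \<Longrightarrow> x + y \<in> V S"
    "\<And>c x. x \<in> V S \<Longrightarrow> scale c x \<in> V S"
    using fi[unfolded fi_module_def, THEN conjunct2, THEN conjunct1, THEN spec[of _ S], THEN mp, OF assms] by blast+
  show "0 \<in> V S" by fact
  fix a b assume "a \<in> V S" "b \<in> V S"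
  then have "a + scale (- 1) b \<in> V S" using * by blast
  also have "a + scale (- 1) b = a - b"
    using module.scale_minus_left[OF m, of 1 b] module.scale_one[OF m, of b] by simp
  finally show "a - b \<in> V S" .
qed

lemma act_axioms:
  assumes "FI_mor S T f"
  shows act_V: "x \<in> V S \<Longrightarrow> act S T f x \<in> V T"
    and act_add: "x \<in> V S \<Longrightarrow> y \<in> V S \<Longrightarrow> act S T f (x + y) = act S T f x + act S T f y"
    and act_cong: "(\<And>s. s \<in> S \<Longrightarrow> f s = g s) \<Longrightarrow> x \<in> V S \<Longrightarrow> act S T f x = act S T g x"
  using fi[unfolded fi_module_def, THEN conjunct2, THEN conjunct2, THEN conjunct1,
      THEN spec[of _ S], THEN spec[of _ T], THEN spec[of _ f], THEN mp, OF assms] by blast+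

lemma act_id: "finite S \<Longrightarrow> x \<in> V S \<Longrightarrow> act S S id x = x"
  using fi[unfolded fi_module_def, THEN conjunct2, THEN conjunct2, THEN conjunct2, THEN conjunct1] by blast

lemma act_comp: "FI_mor S T f \<Longrightarrow> FI_mor T U g \<Longrightarrow> x \<in> V S \<Longrightarrow> act S U (g \<circ> f) x = act T U g (act S T f x)"
  using fi[unfolded fi_module_def, THEN conjunct2, THEN conjunct2, THEN conjunct2, THEN conjunct2,
      THEN spec[of _ S], THEN spec[of _ T], THEN spec[of _ U], THEN spec[of _ f], THEN spec[of _ g]] by blast

lemma act_additive: "FI_mor S T f \<Longrightarrow> additive_on (V S) (act S T f)"
  using act_add V_subgrp[of S] by (auto simp: additive_on_def FI_mor_def)

text \<open>\<open>f\<close> factors as a bijection onto its image followed by the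
  inclusion.\<close>

lemma act_image:
  assumes "FI_mor A U f"
  shows "act A U f ` V A = act (f ` A) U id ` V (f ` A)"
proof -
  let ?A = "f ` A" and ?h = "inv_into A f"
  have fA: "finite A" "inj_on f A" "?A \<subseteq> U" "finite U" using assms by (auto simp: FI_mor_def)
  have 1: "FI_mor A ?A f" "FI_mor ?A U id" using fA by (auto simp: FI_mor_def)
  have 2: "FI_mor ?A A ?h" using fA by (auto simp: FI_mor_def inj_on_inv_into inv_into_into)
  show ?thesis
  proof (intro equalityI subsetI)
    fix v assume "v \<in> act A U f ` V A"
    then obtain x where x: "x \<in> V A" "v = act A U f x" by blast
    have "v = act ?A U id (act A ?A f x)" using act_comp[OF 1 x(1)] x(2) by simp
    then show "v \<in> act ?A U id ` V ?A" using act_V[OF 1(1) x(1)] by blast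
  next
    fix v assume "v \<in> act ?A U id ` V ?A"
    then obtain x where x: "x \<in> V ?A" "v = act ?A U id x" by blast
    have "act A U f (act ?A A ?h x) = act ?A U (f \<circ> ?h) x" using act_comp[OF 2 assms x(1)] by simp
    also have "\<dots> = act ?A U id x"
    proof (rule act_cong[symmetric])
      show "id s = (f \<circ> ?h) s" if "s \<in> ?A" for s using that by (simp add: f_inv_into_f)
    qed (use 1 x in auto)
    finally show "v \<in> act A U f ` V A" using act_V[OF 2 x(1)] x(2) by (metis image_eqI)
  qed
qed

text \<open>The relations \<open>Z\<close> before everything is embedded into the ambient module;
  \<open>derived_pZ\<close> identifies them with what iterated derivation divides out when
  \<open>B\<close> is the set of new points.\<close>

definition ZV :: "nat set \<Rightarrow> nat set \<Rightarrow> 'b set" where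
  "ZV U B = {\<Sum>b\<in>B. act (U - {b}) U id (f b) |f. \<forall>b\<in>B. f b \<in> V (U - {b})}"

lemma ZV_empty [simp]: "ZV U {} = {0}"
  by (auto simp: ZV_def)

lemma mor_del: "finite U \<Longrightarrow> FI_mor (U - {b}) U id"
  by (auto simp: FI_mor_def)

lemma act_0: "FI_mor S T f \<Longrightarrow> act S T f 0 = 0"
  by (rule additive_on_0[OF act_additive])

lemma ZV_insert:
  assumes "finite B" "x \<notin> B"
  shows "v \<in> ZV U (insert x B) \<longleftrightarrow> (\<exists>a\<in>V (U - {x}). \<exists>b\<in>ZV U B. v = b + act (U - {x}) U id a)"
proof
  assume "v \<in> ZV U (insert x B)"
  then obtain f where "v = (\<Sum>b\<in>insert x B. act (U - {b}) U id (f b))" "\<forall>b\<in>insert x B. f b \<in> V (U - {b})"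
    unfolding ZV_def by auto
  then have "f x \<in> V (U - {x})" "(\<Sum>b\<in>B. act (U - {b}) U id (f b)) \<in> ZV U B"
    "v = (\<Sum>b\<in>B. act (U - {b}) U id (f b)) + act (U - {x}) U id (f x)"
    using assms unfolding ZV_def by (auto simp: add.commute)
  then show "\<exists>a\<in>V (U - {x}). \<exists>b\<in>ZV U B. v = b + act (U - {x}) U id a" by blast
next
  assume "\<exists>a\<in>V (U - {x}). \<exists>b\<in>ZV U B. v = b + act (U - {x}) U id a"
  then obtain a f where *: "a \<in> V (U - {x})" "\<forall>b\<in>B. f b \<in> V (U - {b})"
    "v = (\<Sum>b\<in>B. act (U - {b}) U id (f b)) + act (U - {x}) U id a"
    unfolding ZV_def by auto
  have "(\<Sum>b\<in>B. act (U - {b}) U id (f b)) = (\<Sum>b\<in>B. act (U - {b}) U id ((f(x := a)) b))"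
    using assms by (intro sum.cong) auto
  then have "v = (\<Sum>b\<in>insert x B. act (U - {b}) U id ((f(x := a)) b))" using * assms by (simp add: add.commute)
  moreover have "\<forall>b\<in>insert x B. (f(x := a)) b \<in> V (U - {b})" using * by auto
  ultimately show "v \<in> ZV U (insert x B)" unfolding ZV_def by blast
qed

lemma ZV_mono:
  assumes "finite U" "B \<subseteq> B'" "finite B'"
  shows "ZV U B \<subseteq> ZV U B'"
proof
  fix v assume "v \<in> ZV U B"
  then obtain f where f: "v = (\<Sum>b\<in>B. act (U - {b}) U id (f b))" "\<forall>b\<in>B. f b \<in> V (U - {b})"
    unfolding ZV_def by auto
  define f' where "f' = (\<lambda>b. if b \<in> B then f b else 0)"
  have "v = (\<Sum>b\<in>B'. act (U - {b}) U id (f' b))"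
    unfolding f(1) by (rule sum.mono_neutral_cong_left)
      (use assms act_0[OF mor_del[OF assms(1)]] in \<open>auto simp: f'_def\<close>)
  moreover have "\<forall>b\<in>B'. f' b \<in> V (U - {b})"
    using f(2) V_subgrp[of "U - {_}"] assms(1) by (auto simp: f'_def subgrp_0)
  ultimately show "v \<in> ZV U B'" unfolding ZV_def by blast
qed

lemma ZV_transport:
  assumes "finite U" "bij_betw \<beta> U U'" "B \<subseteq> U" "v \<in> ZV U B"
  shows "act U U' \<beta> v \<in> ZV U' (\<beta> ` B)"
proof -
  obtain f where f: "v = (\<Sum>b\<in>B. act (U - {b}) U id (f b))" "\<And>b. b \<in> B \<Longrightarrow> f b \<in> V (U - {b})"
    using assms(4) unfolding ZV_def by auto
  have inj: "inj_on \<beta> U" and im: "\<beta> ` U = U'" using assms(2) by (auto simp: bij_betw_def)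
  have fU': "finite U'" using assms(1) im by blast
  have mor: "FI_mor U U' \<beta>" using assms(1) fU' inj im by (auto simp: FI_mor_def)
  have mor1: "FI_mor (U - {b}) (U' - {\<beta> b}) \<beta>" if "b \<in> B" for b
    using assms(1,3) fU' inj im that by (auto simp: FI_mor_def inj_on_def)
  define g where "g = (\<lambda>b'. let b = inv_into U \<beta> b' in act (U - {b}) (U' - {\<beta> b}) \<beta> (f b))"
  have g: "g (\<beta> b) = act (U - {b}) (U' - {\<beta> b}) \<beta> (f b)" if "b \<in> B" for b
    using that assms(3) inj by (auto simp: g_def)
  have "act U U' \<beta> v = (\<Sum>b\<in>B. act U U' \<beta> (act (U - {b}) U id (f b)))"
    unfolding f(1) using f(2) act_V[OF mor_del[OF assms(1)]] by (intro additive_on_sum[OF act_additive[OF mor]]) auto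
  also have "\<dots> = (\<Sum>b\<in>B. act (U' - {\<beta> b}) U' id (g (\<beta> b)))"
  proof (rule sum.cong[OF refl])
    fix b assume b: "b \<in> B"
    show "act U U' \<beta> (act (U - {b}) U id (f b)) = act (U' - {\<beta> b}) U' id (g (\<beta> b))"
      using act_comp[OF mor_del[OF assms(1)] mor f(2)[OF b]] act_comp[OF mor1[OF b] mor_del[OF fU'] f(2)[OF b]] g[OF b]
      by simp
  qed
  also have "\<dots> = (\<Sum>b'\<in>\<beta> ` B. act (U' - {b'}) U' id (g b'))"
    using sum.reindex[of \<beta> B "\<lambda>b'. act (U' - {b'}) U' id (g b')"] inj_on_subset[OF inj assms(3)] by simp
  finally have "act U U' \<beta> v = (\<Sum>b'\<in>\<beta> ` B. act (U' - {b'}) U' id (g b'))" .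
  moreover have "\<forall>b'\<in>\<beta> ` B. g b' \<in> V (U' - {b'})"
    using g act_V[OF mor1] f(2) by auto
  ultimately show ?thesis unfolding ZV_def by blast
qed

lemma ZV_transport_back:
  assumes "finite U" "bij_betw \<beta> U U'" "B \<subseteq> U" "v \<in> V U" "act U U' \<beta> v \<in> ZV U' (\<beta> ` B)"
  shows "v \<in> ZV U B"
proof -
  let ?h = "inv_into U \<beta>"
  have inj: "inj_on \<beta> U" and im: "\<beta> ` U = U'" using assms(2) by (auto simp: bij_betw_def)
  have fU': "finite U'" using assms(1) im by blast
  have mor: "FI_mor U U' \<beta>" using assms(1) fU' inj im by (auto simp: FI_mor_def)
  have h: "bij_betw ?h U' U" by (rule bij_betw_inv_into[OF assms(2)])
  then have mor': "FI_mor U' U ?h" using assms(1) fU' by (auto simp: FI_mor_def bij_betw_def)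
  have "act U' U ?h (act U U' \<beta> v) \<in> ZV U (?h ` (\<beta> ` B))"
    using assms(3) im by (intro ZV_transport[OF fU' h _ assms(5)]) auto
  moreover have "?h ` (\<beta> ` B) = B" using assms(3) inj by (rule inv_into_image_cancel[rotated])
  moreover have "act U' U ?h (act U U' \<beta> v) = v"
  proof -
    have "act U' U ?h (act U U' \<beta> v) = act U U (?h \<circ> \<beta>) v" by (rule act_comp[OF mor mor' assms(4), symmetric])
    also have "\<dots> = act U U id v"
    proof (rule act_cong[symmetric])
      show "FI_mor U U id" using assms(1) by (simp add: FI_mor_def)
    qed (use inj assms(4) in auto)
    finally show ?thesis using act_id assms(1,4) by simp
  qed
  ultimately show ?thesis by simp
qed

end

section \<open>Iterated derived modules and their canonical new points\<close>

fun pls :: "nat \<Rightarrow> nat set \<Rightarrow> nat set" where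
  "pls 0 S = S"
| "pls (Suc j) S = pls j (plus_star S)"

fun ext_pls :: "nat \<Rightarrow> nat set \<Rightarrow> nat set \<Rightarrow> (nat \<Rightarrow> nat) \<Rightarrow> nat \<Rightarrow> nat" where
  "ext_pls 0 S T f = f"
| "ext_pls (Suc j) S T f = ext_pls j (plus_star S) (plus_star T) (ext_star S T f)"

lemma star_notin:
  assumes "finite S" shows "star S \<notin> S"
  unfolding star_def by (rule LeastI_ex, rule ex_new_if_finite[OF infinite_UNIV_nat assms])

lemma finite_plus_star [simp]: "finite (plus_star S) \<longleftrightarrow> finite S"
  by (simp add: plus_star_def)

lemma FI_mor_ext_star:
  assumes "FI_mor S T f"
  shows "FI_mor (plus_star S) (plus_star T) (ext_star S T f)"
proof -
  have "star S \<notin> S" "star T \<notin> T" using assms star_notin by (auto simp: FI_mor_def)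
  moreover from this have on_S: "ext_star S T f x = f x" if "x \<in> S" for x using that by (auto simp: ext_star_def)
  then have "ext_star S T f ` S = f ` S" "inj_on (ext_star S T f) S \<longleftrightarrow> inj_on f S"
    by (auto cong: inj_on_cong)
  moreover have "ext_star S T f (star S) = star T" by (simp add: ext_star_def)
  ultimately show ?thesis
    using assms unfolding FI_mor_def plus_star_def by auto
qed

lemma pls_props:
  assumes "finite S"
  shows "finite (pls j S)" "S \<subseteq> pls j S" "card (pls j S - S) = j"
proof -
  have "finite (pls j S) \<and> S \<subseteq> pls j S \<and> card (pls j S) = card S + j"
    using assms
  proof (induction j arbitrary: S)
    case (Suc j)
    have "card (plus_star S) = Suc (card S)" using star_notin[OF Suc.prems] Suc.prems by (simp add: plus_star_def)
    then show ?case using Suc.IH[of "plus_star S"] Suc.prems by (auto simp: plus_star_def)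
  qed simp
  then show "finite (pls j S)" "S \<subseteq> pls j S" "card (pls j S - S) = j"
    using assms by (auto simp: card_Diff_subset)
qed

lemma ext_pls_props:
  assumes "FI_mor S T f"
  shows "FI_mor (pls j S) (pls j T) (ext_pls j S T f)" "\<And>s. s \<in> S \<Longrightarrow> ext_pls j S T f s = f s"
    "ext_pls j S T f ` (pls j S - S) = pls j T - T"
proof -
  have "FI_mor (pls j S) (pls j T) (ext_pls j S T f) \<and> (\<forall>s\<in>S. ext_pls j S T f s = f s) \<and>
    ext_pls j S T f ` (pls j S - S) = pls j T - T"
    using assms
  proof (induction j arbitrary: S T f)
    case (Suc j)
    have fS: "finite S" "finite T" using Suc.prems by (auto simp: FI_mor_def)
    note s = star_notin[OF fS(1)] star_notin[OF fS(2)]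
    let ?F = "ext_pls (Suc j) S T f"
    have IH: "FI_mor (pls (Suc j) S) (pls (Suc j) T) ?F" "\<forall>s\<in>plus_star S. ?F s = ext_star S T f s"
      "?F ` (pls (Suc j) S - plus_star S) = pls (Suc j) T - plus_star T"
      using Suc.IH[OF FI_mor_ext_star[OF Suc.prems]] by auto
    have star: "?F (star S) = star T" using IH(2) by (simp add: plus_star_def ext_star_def)
    have "plus_star S \<subseteq> pls (Suc j) S" "plus_star T \<subseteq> pls (Suc j) T"
      using pls_props(2)[of "plus_star S" j] pls_props(2)[of "plus_star T" j] fS by auto
    then have dec: "pls (Suc j) S - S = insert (star S) (pls (Suc j) S - plus_star S)"
      "pls (Suc j) T - T = insert (star T) (pls (Suc j) T - plus_star T)"
      using s unfolding plus_star_def by auto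
    have "\<forall>s\<in>S. ?F s = f s" using IH(2) s by (auto simp: plus_star_def ext_star_def)
    moreover have "?F ` (pls (Suc j) S - S) = pls (Suc j) T - T" unfolding dec image_insert star IH(3) ..
    ultimately show ?case using IH(1) by blast
  qed auto
  then show "FI_mor (pls j S) (pls j T) (ext_pls j S T f)" "\<And>s. s \<in> S \<Longrightarrow> ext_pls j S T f s = f s"
    "ext_pls j S T f ` (pls j S - S) = pls j T - T" by blast+
qed

text \<open>The recursion unrolled: level \<open>j\<close> speaks about the \<open>j\<close>-fold
  derived presentation, with the start lowered \<open>j\<close> times.\<close>

lemma poly_pres_iff:
  "poly_pres e m P \<longleftrightarrow>
    (\<forall>j<e. \<forall>S T f. FI_mor S T f \<and> int (card S) \<ge> m - int j \<longrightarrow>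
        (\<forall>x\<in>pV ((derived ^^ j) P) S. pact ((derived ^^ j) P) S T f x \<in> pZ ((derived ^^ j) P) T \<longrightarrow> x \<in> pZ ((derived ^^ j) P) S)) \<and>
    (\<forall>S. finite S \<and> int (card S) \<ge> m - int e \<longrightarrow> pV ((derived ^^ e) P) S \<subseteq> pZ ((derived ^^ e) P) S)"
proof (induction e arbitrary: m P)
  case (Suc e)
  have *: "(\<forall>j<Suc e. A j) \<longleftrightarrow> A 0 \<and> (\<forall>j<e. A (Suc j))" for A
    by (auto simp: less_Suc_eq_0_disj)
  have **: "(derived ^^ j) (derived P) = (derived ^^ Suc j) P" for j
    by (simp only: funpow_Suc_right o_apply)
  show ?case unfolding poly_pres.simps Suc.IH * ** by (simp add: algebra_simps)
qed auto

context fi_mod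
begin

abbreviation P0 :: "'b fipres" where "P0 \<equiv> \<lparr> pV = V, pZ = (\<lambda>_. {0}), pact = act \<rparr>"

lemma derived_pV: "pV ((derived ^^ j) P0) S = V (pls j S)"
  by (induction j arbitrary: S) (auto simp: derived_def)

lemma derived_pact: "pact ((derived ^^ j) P0) S T f = act (pls j S) (pls j T) (ext_pls j S T f)"
  by (induction j arbitrary: S T f) (auto simp: derived_def)

text \<open>One step of \<open>derived\<close> adds the image of a map that need not be an
  inclusion, because new points get renamed. By \<open>act_image\<close> this image depends only on
  the set of points hit, which is everything except \<open>star S\<close>; so the relation added is
  the one for deleting \<open>star S\<close>.\<close>

lemma derived_pZ:
  assumes "finite S"
  shows "pZ ((derived ^^ j) P0) S = ZV (pls j S) (pls j S - S)"
  using assms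
proof (induction j arbitrary: S)
  case (Suc j)
  let ?S = "plus_star S" and ?U = "pls j (plus_star S)" and ?F = "ext_pls j S (plus_star S) id"
  have fS: "finite ?S" using Suc.prems by simp
  have s: "star S \<notin> S" by (rule star_notin[OF Suc.prems])
  have sub: "S \<subseteq> pls j S" "?S \<subseteq> ?U" using pls_props(2) Suc.prems fS by blast+
  have mor: "FI_mor S ?S id" using Suc.prems by (auto simp: FI_mor_def plus_star_def)
  note F = ext_pls_props[OF mor, where j = j]
  have "?F ` pls j S = ?F ` S \<union> ?F ` (pls j S - S)" using sub by auto
  also have "?F ` S = S" using image_cong[OF refl F(2), of S] by simp
  finally have "?F ` pls j S = S \<union> (?U - ?S)" unfolding F(3) .
  also have "\<dots> = ?U - {star S}" using sub s by (auto simp: plus_star_def)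
  finally have im: "?F ` pls j S = ?U - {star S}" .
  have dec: "?U - S = insert (star S) (?U - ?S)" using sub s by (auto simp: plus_star_def)
  have fin: "finite (?U - ?S)" "star S \<notin> ?U - ?S" using pls_props(1)[OF fS] by (auto simp: plus_star_def)
  have img: "act (pls j S) ?U ?F ` V (pls j S) = act (?U - {star S}) ?U id ` V (?U - {star S})"
    using act_image[OF F(1)] unfolding im .
  have "v \<in> pZ ((derived ^^ Suc j) P0) S \<longleftrightarrow> v \<in> ZV ?U (?U - S)" for v
  proof -
    have "v \<in> pZ ((derived ^^ Suc j) P0) S \<longleftrightarrow>
      (\<exists>z\<in>ZV ?U (?U - ?S). \<exists>y\<in>act (pls j S) ?U ?F ` V (pls j S). v = z + y)"
      by (auto simp: derived_def Suc.IH[OF fS] derived_pV derived_pact)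
    also have "\<dots> \<longleftrightarrow> v \<in> ZV ?U (?U - S)" unfolding img dec ZV_insert[OF fin] by blast
    finally show ?thesis .
  qed
  then show ?case by auto
qed simp

text \<open>Polynomiality is phrased with the labels chosen by \<open>star\<close>, the argument
  above with arbitrary points \<open>B\<close>; \<open>\<beta>\<close> renames the latter and leaves
  the rest alone.\<close>

lemma ex_star_labels:
  assumes "finite U" "B \<subseteq> U"
  obtains \<beta> where "bij_betw \<beta> U (pls (card B) (U - B))" "\<beta> ` B = pls (card B) (U - B) - (U - B)"
    "\<And>u. u \<in> U - B \<Longrightarrow> \<beta> u = u"
proof -
  let ?S = "U - B" and ?W = "pls (card B) (U - B)"
  have fS: "finite ?S" using assms by simp
  note p = pls_props[OF fS, of "card B"]
  have "finite B" using assms finite_subset by blast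
  then obtain h where h: "bij_betw h B (?W - ?S)"
    using finite_same_card_bij[of B "?W - ?S"] p by auto
  define \<beta> where "\<beta> = (\<lambda>u. if u \<in> B then h u else u)"
  have im: "\<beta> ` B = ?W - ?S" using h by (auto simp: \<beta>_def bij_betw_def)
  have "bij_betw \<beta> B (?W - ?S)" using h by (simp add: \<beta>_def cong: bij_betw_cong)
  moreover have "bij_betw \<beta> ?S ?S" by (auto simp: \<beta>_def bij_betw_def inj_on_def)
  ultimately have "bij_betw \<beta> (B \<union> ?S) ((?W - ?S) \<union> ?S)" by (intro bij_betw_combine) auto
  moreover have "B \<union> ?S = U" "(?W - ?S) \<union> ?S = ?W" using assms p by auto
  ultimately show thesis using that[of \<beta>] im by (auto simp: \<beta>_def)
qed

text \<open>Injectivity of the \<open>card B\<close>-fold derived module from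
  \<open>U - {x} - B\<close> to \<open>U - B\<close>, in arbitrary labels. Its start
  \<open>m - card B\<close> and the size \<open>card U - 1 - card B\<close> of the smaller set
  combine to \<open>m < card U\<close>.\<close>

lemma inj_V:
  assumes poly: "poly_pres e m P0" and U: "finite U" "B \<subseteq> U" "x \<in> U" "x \<notin> B" "card B < e" "m < int (card U)"
    and v: "v \<in> V (U - {x})" "act (U - {x}) U id v \<in> ZV U B"
  shows "v \<in> ZV (U - {x}) B"
proof -
  let ?j = "card B" and ?T = "U - B" and ?S = "U - {x} - B"
  have fin: "finite B" "finite ?S" "finite ?T" using finite_subset[OF U(2,1)] U(1) by simp_all
  obtain \<beta> where \<beta>: "bij_betw \<beta> U (pls ?j ?T)" "\<beta> ` B = pls ?j ?T - ?T" "\<And>u. u \<in> ?T \<Longrightarrow> \<beta> u = u"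
    using ex_star_labels[OF U(1,2)] by blast
  have mor: "FI_mor ?S ?T id" using U by (auto simp: FI_mor_def)
  let ?F = "ext_pls ?j ?S ?T id"
  note F = ext_pls_props[OF mor, where j = ?j]
  note pS = pls_props[OF fin(2), of ?j] and pT = pls_props[OF fin(3), of ?j]
  have FS: "?F ` ?S = ?S" using image_cong[OF refl F(2), of ?S] by simp
  have "U - {x} = ?S \<union> B" using U by auto
  moreover have "\<beta> ` ?S = ?S" using \<beta>(3) by force
  ultimately have "\<beta> ` (U - {x}) = ?S \<union> (pls ?j ?T - ?T)" using \<beta>(2) by (metis image_Un)
  also have "\<dots> = ?F ` ?S \<union> ?F ` (pls ?j ?S - ?S)" unfolding F(3) FS ..
  also have "\<dots> = ?F ` pls ?j ?S" using pS(2) by auto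
  finally have im: "\<beta> ` (U - {x}) = ?F ` pls ?j ?S" .
  have injF: "inj_on ?F (pls ?j ?S)" using F(1) by (simp add: FI_mor_def)
  have inj\<beta>: "inj_on \<beta> (U - {x})" using \<beta>(1) by (auto simp: bij_betw_def inj_on_def)
  \<comment> \<open>\<open>\<beta>\<close> labels \<open>U\<close> by the new points over
    \<open>?T\<close>, while the source needs those over \<open>?S\<close>. Pulling
    \<open>\<beta>\<close> back along the embedding \<open>?F\<close> makes the square
    commute.\<close>
  define \<sigma> where "\<sigma> = inv_into (pls ?j ?S) ?F \<circ> \<beta>"
  have "bij_betw (inv_into (pls ?j ?S) ?F) (\<beta> ` (U - {x})) (pls ?j ?S)"
    unfolding im by (rule bij_betw_inv_into) (use injF in \<open>simp add: bij_betw_def\<close>)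
  then have \<sigma>: "bij_betw \<sigma> (U - {x}) (pls ?j ?S)"
    unfolding \<sigma>_def by (intro bij_betw_trans[of \<beta>]) (use inj\<beta> in \<open>simp_all add: bij_betw_def\<close>)
  have F\<sigma>: "?F (\<sigma> u) = \<beta> u" if "u \<in> U - {x}" for u
  proof -
    have "\<beta> u \<in> ?F ` pls ?j ?S" using that unfolding im[symmetric] by blast
    then show ?thesis unfolding \<sigma>_def comp_apply by (rule f_inv_into_f)
  qed
  have \<sigma>B: "\<sigma> ` B = pls ?j ?S - ?S"
  proof -
    have "\<sigma> ` B = inv_into (pls ?j ?S) ?F ` (?F ` (pls ?j ?S - ?S))"
      unfolding F(3) \<beta>(2)[symmetric] \<sigma>_def by (simp add: image_comp)
    then show ?thesis using inv_into_image_cancel[OF injF, of "pls ?j ?S - ?S"] by simp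
  qed
  have mor\<sigma>: "FI_mor (U - {x}) (pls ?j ?S) \<sigma>" using \<sigma> U(1) pS(1) by (auto simp: FI_mor_def bij_betw_def)
  have mor\<beta>: "FI_mor U (pls ?j ?T) \<beta>" using \<beta>(1) U(1) pT(1) by (auto simp: FI_mor_def bij_betw_def)
  define v' where "v' = act (U - {x}) (pls ?j ?S) \<sigma> v"
  have v'V: "v' \<in> V (pls ?j ?S)" unfolding v'_def by (rule act_V[OF mor\<sigma> v(1)])
  have "act (pls ?j ?S) (pls ?j ?T) ?F v' = act (U - {x}) (pls ?j ?T) (?F \<circ> \<sigma>) v"
    unfolding v'_def by (rule act_comp[OF mor\<sigma> F(1) v(1), symmetric])
  also have "\<dots> = act (U - {x}) (pls ?j ?T) (\<beta> \<circ> id) v"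
  proof (rule act_cong[symmetric])
    show "FI_mor (U - {x}) (pls ?j ?T) (\<beta> \<circ> id)" using mor\<beta> by (auto simp: FI_mor_def inj_on_def)
    show "(\<beta> \<circ> id) s = (?F \<circ> \<sigma>) s" if "s \<in> U - {x}" for s using F\<sigma>[OF that] by simp
  qed (rule v(1))
  also have "\<dots> = act U (pls ?j ?T) \<beta> (act (U - {x}) U id v)"
    by (rule act_comp[OF mor_del[OF U(1)] mor\<beta> v(1)])
  also have "\<dots> \<in> ZV (pls ?j ?T) (pls ?j ?T - ?T)"
    using ZV_transport[OF U(1) \<beta>(1) U(2) v(2)] unfolding \<beta>(2) .
  finally have "act (pls ?j ?S) (pls ?j ?T) ?F v' \<in> ZV (pls ?j ?T) (pls ?j ?T - ?T)" .
  moreover have "int (card ?S) \<ge> m - int ?j"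
  proof -
    have "card ?S = card U - 1 - card B"
      using U fin(1) by (subst card_Diff_subset) auto
    moreover have "card (insert x B) \<le> card U" using U by (intro card_mono) auto
    ultimately show ?thesis using U(4,6) fin(1) by simp
  qed
  moreover have "\<forall>y\<in>pV ((derived ^^ ?j) P0) ?S. pact ((derived ^^ ?j) P0) ?S ?T id y \<in> pZ ((derived ^^ ?j) P0) ?T
      \<longrightarrow> y \<in> pZ ((derived ^^ ?j) P0) ?S"
    by (rule poly[unfolded poly_pres_iff, THEN conjunct1, THEN spec[of _ ?j], THEN mp, OF U(5), THEN spec[of _ ?S],
          THEN spec[of _ ?T], THEN spec[of _ id], THEN mp]) (use mor calculation in blast)
  ultimately have "v' \<in> ZV (pls ?j ?S) (pls ?j ?S - ?S)"
    using v'V unfolding derived_pV derived_pact derived_pZ[OF fin(2)] derived_pZ[OF fin(3)] by blast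
  then show ?thesis
    unfolding \<sigma>B[symmetric] v'_def using ZV_transport_back[OF _ \<sigma> _ v(1)] U by blast
qed

text \<open>Vanishing is known for the derived module of order exactly \<open>e\<close>. It is
  applied to \<open>e\<close> of the points of \<open>B\<close>; further points only add
  relations.\<close>

lemma vanish_V:
  assumes poly: "poly_pres e m P0" and U: "finite U" "B \<subseteq> U" "e \<le> card B" "m \<le> int (card U)"
  shows "V U \<subseteq> ZV U B"
proof
  fix v assume v: "v \<in> V U"
  have fB: "finite B" using U finite_subset by blast
  obtain B' where B': "B' \<subseteq> B" "card B' = e" by (rule obtain_subset_with_card_n[OF U(3)])
  have B'U: "B' \<subseteq> U" "finite B'" using B'(1) U(2) finite_subset[OF B'(1) fB] by blast+
  let ?S = "U - B'"
  have fS: "finite ?S" using U by simp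
  obtain \<beta> where \<beta>: "bij_betw \<beta> U (pls e ?S)" "\<beta> ` B' = pls e ?S - ?S"
    by (rule ex_star_labels[OF U(1) B'U(1), unfolded B'(2)])
  have "card ?S = card U - e" "e \<le> card U"
    using card_Diff_subset[OF B'U(2,1)] card_mono[OF U(1) B'U(1)] B'(2) by auto
  then have "int (card ?S) \<ge> m - int e" using U(4) by simp
  then have "pV ((derived ^^ e) P0) ?S \<subseteq> pZ ((derived ^^ e) P0) ?S"
    using fS poly[unfolded poly_pres_iff, THEN conjunct2, THEN spec[of _ ?S], THEN mp] by blast
  then have "V (pls e ?S) \<subseteq> ZV (pls e ?S) (pls e ?S - ?S)"
    unfolding derived_pV derived_pZ[OF fS] .
  moreover have "FI_mor U (pls e ?S) \<beta>"
    using \<beta>(1) U(1) pls_props(1)[OF fS, of e] by (simp add: FI_mor_def bij_betw_def)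
  then have "act U (pls e ?S) \<beta> v \<in> V (pls e ?S)" using v by (rule act_V)
  ultimately have "act U (pls e ?S) \<beta> v \<in> ZV (pls e ?S) (\<beta> ` B')" unfolding \<beta>(2) by blast
  then have "v \<in> ZV U B'" by (rule ZV_transport_back[OF U(1) \<beta>(1) B'U(1) v])
  then show "v \<in> ZV U B" using ZV_mono[OF U(1) B'(1) fB] by blast
qed

text \<open>Points are added one by one, each by \<open>inj_V\<close> with \<open>B = {}\<close>.
  For \<open>e = 0\<close> that lemma says nothing, but then \<open>V U\<close> itself is
  zero.\<close>

lemma inj_incl:
  assumes poly: "poly_pres e m P0" and U: "finite W" "U \<subseteq> W" "m \<le> int (card U)"
    and v: "v \<in> V U" "act U W id v = 0"
  shows "v = 0"
proof -
  have "v = 0" if "U \<subseteq> W" "m \<le> int (card U)" "v \<in> V U" "act U W id v = 0" for U v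
    using that
  proof (induction "card (W - U)" arbitrary: U v)
    case 0
    then have "U = W" using U(1) by auto
    then show ?case using 0 act_id[of W v] U(1) by (simp add: id_def)
  next
    case (Suc k)
    then have "W - U \<noteq> {}" by (intro notI) simp
    then obtain x where x: "x \<in> W" "x \<notin> U" by blast
    let ?U = "insert x U"
    have fU: "finite ?U" "finite U" using finite_subset[OF Suc.prems(1) U(1)] by simp_all
    have eq: "?U - {x} = U" using x by auto
    have mor: "FI_mor U ?U id" "FI_mor ?U W id" using fU x Suc.prems(1) U(1) by (auto simp: FI_mor_def)
    have "k = card (W - ?U)"
    proof -
      have "W - U = insert x (W - ?U)" "x \<notin> W - ?U" using x by auto
      then show ?thesis using Suc.hyps(2) U(1) by (metis card_insert_disjoint finite_Diff nat.inject)
    qed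
    moreover have "?U \<subseteq> W" using Suc.prems(1) x by blast
    moreover have "m \<le> int (card ?U)" using Suc.prems(2) fU x by simp
    moreover have "act U ?U id v \<in> V ?U" by (rule act_V[OF mor(1) Suc.prems(3)])
    moreover have "act ?U W id (act U ?U id v) = 0"
      using act_comp[OF mor Suc.prems(3)] Suc.prems(4) by (simp only: id_o)
    ultimately have z: "act U ?U id v = 0" by (rule Suc.hyps(1))
    show ?case
    proof (cases "0 < e")
      case True
      have "v \<in> ZV (?U - {x}) {}"
      proof (rule inj_V[OF poly fU(1)])
        show "m < int (card ?U)" using fU(2) x Suc.prems(2) by simp
        show "v \<in> V (?U - {x})" "act (?U - {x}) ?U id v \<in> ZV ?U {}" unfolding eq using Suc.prems(3) z by simp_all
      qed (use True in simp_all)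
      then show ?thesis by simp
    next
      case False
      then have "V U \<subseteq> ZV U {}" using Suc.prems(2) by (intro vanish_V[OF poly fU(2)]) simp_all
      then have "v \<in> ZV U {}" using Suc.prems(3) by blast
      then show ?thesis by simp
    qed
  qed
  then show ?thesis using U v by blast
qed

definition sub_img :: "nat set \<Rightarrow> nat set \<Rightarrow> 'b set" where
  "sub_img W U = act U W id ` V U"

lemma sub_img_self: "finite W \<Longrightarrow> sub_img W W = V W"
  unfolding sub_img_def using image_cong[of "V W" "V W" "act W W id" id] act_id by simp

lemma mor_incl: "finite W \<Longrightarrow> U \<subseteq> W \<Longrightarrow> FI_mor U W id"
  by (auto simp: FI_mor_def finite_subset)

lemma mor_perm: "finite W \<Longrightarrow> g permutes W \<Longrightarrow> FI_mor W W g"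
  by (auto simp: FI_mor_def permutes_inj_on permutes_image)

text \<open>Relations may be formed before or after embedding, since the maps into \<open>W\<close>
  factor through \<open>U\<close>.\<close>

lemma sub_img_Z:
  assumes "finite W" "U \<subseteq> W"
  shows "{\<Sum>b\<in>B. f b |f. \<forall>b\<in>B. f b \<in> sub_img W (U - {b})} = act U W id ` ZV U B"
proof -
  have fU: "finite U" using assms finite_subset by blast
  note mU = mor_incl[OF assms] and md = mor_del[OF fU]
  have comp: "act (U - {b}) W id a = act U W id (act (U - {b}) U id a)" if "a \<in> V (U - {b})" for a b
    using act_comp[OF md mU that] by simp
  have sum: "act U W id (\<Sum>b\<in>B. act (U - {b}) U id (h b)) = (\<Sum>b\<in>B. act (U - {b}) W id (h b))"
    if "\<forall>b\<in>B. h b \<in> V (U - {b})" for h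
  proof -
    have "act U W id (\<Sum>b\<in>B. act (U - {b}) U id (h b)) = (\<Sum>b\<in>B. act U W id (act (U - {b}) U id (h b)))"
      by (rule additive_on_sum[OF act_additive[OF mU]]) (use that act_V[OF md] in blast)
    then show ?thesis using comp that by simp
  qed
  show ?thesis
  proof (intro equalityI subsetI)
    fix v assume "v \<in> {\<Sum>b\<in>B. f b |f. \<forall>b\<in>B. f b \<in> sub_img W (U - {b})}"
    then obtain f where f: "v = sum f B" "\<forall>b\<in>B. \<exists>a. a \<in> V (U - {b}) \<and> f b = act (U - {b}) W id a"
      unfolding sub_img_def by blast
    then obtain h where h: "\<forall>b\<in>B. h b \<in> V (U - {b}) \<and> f b = act (U - {b}) W id (h b)" by metis
    then have "v = act U W id (\<Sum>b\<in>B. act (U - {b}) U id (h b))" using sum[of h] f(1) by simp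
    moreover have "(\<Sum>b\<in>B. act (U - {b}) U id (h b)) \<in> ZV U B" using h unfolding ZV_def by blast
    ultimately show "v \<in> act U W id ` ZV U B" by blast
  next
    fix v assume "v \<in> act U W id ` ZV U B"
    then obtain h where h: "\<forall>b\<in>B. h b \<in> V (U - {b})" "v = act U W id (\<Sum>b\<in>B. act (U - {b}) U id (h b))"
      unfolding ZV_def by blast
    then have "v = (\<Sum>b\<in>B. act (U - {b}) W id (h b))" using sum by simp
    then show "v \<in> {\<Sum>b\<in>B. f b |f. \<forall>b\<in>B. f b \<in> sub_img W (U - {b})}"
      using h(1) unfolding sub_img_def by (auto intro!: exI[of _ "\<lambda>b. act (U - {b}) W id (h b)"])
  qed
qed

lemma ZV_sub_V:
  assumes "finite U" shows "ZV U B \<subseteq> V U"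
  unfolding ZV_def using act_V[OF mor_del[OF assms]] by (auto intro!: subgrp_sum[OF V_subgrp[OF assms]])

text \<open>\<open>inj_mod\<close> is stated for images inside \<open>V W\<close>; it comes down to
  a statement about \<open>V U\<close> because the map from \<open>V U\<close> to \<open>V W\<close>
  is injective for \<open>m \<le> card U\<close>. For smaller \<open>U\<close> the image may be a
  proper quotient of \<open>V U\<close>.\<close>

lemma poly_system:
  assumes poly: "poly_pres e (int m) P0" and W: "finite W"
  shows "poly_system W (sub_img W) (act W W) m e"
proof
  show "finite W" by fact
next
  fix U assume U: "U \<subseteq> W"
  then have fU: "finite U" using W finite_subset by blast
  note add = act_additive[OF mor_incl[OF W U]]
  show "subgrp (sub_img W U)"
    unfolding subgrp_def
  proof (intro conjI ballI)
    show "0 \<in> sub_img W U"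
      unfolding sub_img_def using additive_on_0[OF add] subgrp_0[OF V_subgrp[OF fU]] by (metis image_eqI)
    fix a b assume "a \<in> sub_img W U" "b \<in> sub_img W U"
    then obtain x y where "x \<in> V U" "y \<in> V U" "a = act U W id x" "b = act U W id y" by (auto simp: sub_img_def)
    then show "a - b \<in> sub_img W U"
      unfolding sub_img_def using additive_on_diff[OF add, of x y] subgrp_diff[OF V_subgrp[OF fU], of x y] by (metis image_eqI)
  qed
next
  fix U U' assume U: "U \<subseteq> U'" "U' \<subseteq> W"
  then have "finite U'" using W finite_subset by blast
  then have mor: "FI_mor U U' id" using U(1) by (rule mor_incl)
  show "sub_img W U \<subseteq> sub_img W U'"
    unfolding sub_img_def using act_comp[OF mor mor_incl[OF W U(2)]] act_V[OF mor] by auto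
next
  fix g U v assume g: "g permutes W" and U: "U \<subseteq> W" and v: "v \<in> sub_img W U"
  note mU = mor_incl[OF W U] and mg = mor_perm[OF W g]
  obtain a where a: "a \<in> V U" "v = act U W id a" using v by (auto simp: sub_img_def)
  have eq: "act W W g v = act U W g a" using act_comp[OF mU mg a(1)] a(2) by simp
  have mor: "FI_mor U W g" using mU mg U by (auto simp: FI_mor_def inj_on_def image_subset_iff)
  show "act W W g v \<in> sub_img W (g ` U)"
    unfolding eq sub_img_def act_image[OF mor, symmetric] using a(1) by blast
  show "act W W g v = v" if "\<forall>u\<in>U. g u = u"
  proof -
    have "act U W g a = act U W id a" by (rule act_cong[OF mor _ a(1)]) (use that in simp)
    then show ?thesis using eq a(2) by simp
  qed
next
  fix g v w assume g: "g permutes W" and vw: "v \<in> sub_img W W" "w \<in> sub_img W W"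
  note full = sub_img_self[OF W]
  show "act W W g (v + w) = act W W g v + act W W g w"
    by (rule act_add[OF mor_perm[OF W g] vw[unfolded full]])
next
  fix g h v assume gh: "g permutes W" "h permutes W" and v: "v \<in> sub_img W W"
  note full = sub_img_self[OF W]
  show "act W W (g \<circ> h) v = act W W g (act W W h v)"
    by (rule act_comp[OF mor_perm[OF W gh(2)] mor_perm[OF W gh(1)] v[unfolded full]])
next
  fix U B x v assume U: "U \<subseteq> W" "B \<subseteq> U" "x \<in> U" "x \<notin> B" "m < card U" and v: "v \<in> sub_img W (U - {x})"
    and "v \<in> {\<Sum>b\<in>B. f b |f. \<forall>b\<in>B. f b \<in> sub_img W (U - {b})}"
  then obtain z where z: "z \<in> ZV U B" "v = act U W id z" using sub_img_Z[OF W U(1)] by auto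
  obtain a where a: "a \<in> V (U - {x})" "v = act (U - {x}) W id a" using v by (auto simp: sub_img_def)
  have fU: "finite U" using W U(1) finite_subset by blast
  note mU = mor_incl[OF W U(1)] and md = mor_del[OF fU]
  have aV: "act (U - {x}) U id a \<in> V U" by (rule act_V[OF md a(1)])
  have zV: "z \<in> V U" using ZV_sub_V[OF fU] z(1) by blast
  have "v = act U W id (act (U - {x}) U id a)" using act_comp[OF md mU a(1)] a(2) by simp
  then have "act U W id (act (U - {x}) U id a - z) = 0"
    using additive_on_diff[OF act_additive[OF mU] aV zV] z(2) by simp
  then have "act (U - {x}) U id a - z = 0"
    by (rule inj_incl[OF poly W U(1) _ subgrp_diff[OF V_subgrp[OF fU] aV zV], rotated]) (use U(5) in simp)
  then have az: "act (U - {x}) U id a \<in> ZV U B" using z(1) by simp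
  have "a \<in> ZV (U - {x}) B"
  proof (cases "card B < e")
    case True
    show ?thesis by (rule inj_V[OF poly fU U(2,3,4) True _ a(1) az]) (use U(5) in simp)
  next
    case False
    have "m \<le> card (U - {x})" using U(3,5) fU by simp
    then have "V (U - {x}) \<subseteq> ZV (U - {x}) B" by (intro vanish_V[OF poly]) (use False U fU in auto)
    then show ?thesis using a(1) by blast
  qed
  moreover have "U - {x} \<subseteq> W" using U(1) by auto
  ultimately show "v \<in> {\<Sum>b\<in>B. f b |f. \<forall>b\<in>B. f b \<in> sub_img W (U - {x} - {b})}"
    using sub_img_Z[OF W, of "U - {x}" B] a(2) by blast
next
  fix U B assume U: "U \<subseteq> W" "B \<subseteq> U" "m \<le> card U" "e \<le> card B"
  have fU: "finite U" using W U(1) finite_subset by blast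
  show "sub_img W U \<subseteq> {\<Sum>b\<in>B. f b |f. \<forall>b\<in>B. f b \<in> sub_img W (U - {b})}"
    unfolding sub_img_Z[OF W U(1)]
    unfolding sub_img_def using U(3) by (intro image_mono vanish_V[OF poly fU U(2,4)]) simp
qed

end

section \<open>Vanishing of relative homology for pairs of equivariant functions\<close>

lemma short_word_cases:
  obtains (Nil) "w = []" | (single) x where "w = [x]" | (long) "1 < length w"
proof (cases w)
  case (Cons x v)
  then show thesis using that by (cases v) auto
qed (use that in blast)

context poly_system
begin

text \<open>\<open>a\<close> is the column of empty words, a chain of the large group;
  \<open>u\<close> is the column of one-letter words, which by Shapiro's lemma amounts to a chain of
  the stabilizer of one letter. At \<open>B = {}\<close> the relations are zero, so exactness modulo
  \<open>Z\<close> becomes equality.\<close>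

lemma stable_cone:
  assumes U: "U \<subseteq> \<Omega>" "m < card U" "m \<le> card (\<Omega> - U)" "2 * L + 2 * q \<le> card U + 3"
    and a: "\<And>e. a e \<noteq> 0 \<Longrightarrow> e \<noteq> [] \<and> set e \<subseteq> X \<and> length e = L" "\<And>e. a e \<in> M U"
      "\<And>g e. g permutes U \<Longrightarrow> a (map ((\<circ>) g) e) = \<rho> g (a e)"
    and u: "\<And>e x. u e x \<noteq> 0 \<Longrightarrow> e \<noteq> [] \<and> set e \<subseteq> X \<and> x \<in> U \<and> Suc (length e) = L" "\<And>e x. u e x \<in> M (U - {x})"
      "\<And>g e x. g permutes U \<Longrightarrow> u (map ((\<circ>) g) e) (g x) = \<rho> g (u e x)"
    and cyc: "\<And>e. e \<noteq> [] \<Longrightarrow> ins X a e + alt (length e) (\<Sum>x\<in>U. u e x) = 0"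
      "\<And>e x. e \<noteq> [] \<Longrightarrow> ins X (\<lambda>e. u e x) e = 0"
  obtains a' u' where "\<And>e. a' e \<in> M U" "\<And>g e. g permutes U \<Longrightarrow> a' (map ((\<circ>) g) e) = \<rho> g (a' e)"
    "\<And>e x. u' e x \<in> M (U - {x})" "\<And>g e x. g permutes U \<Longrightarrow> u' (map ((\<circ>) g) e) (g x) = \<rho> g (u' e x)"
    "\<And>e. e \<noteq> [] \<Longrightarrow> a e = ins X a' e + alt (length e) (\<Sum>x\<in>U. u' e x)"
    "\<And>e x. e \<noteq> [] \<Longrightarrow> u e x = ins X (\<lambda>e. u' e x) e"
proof -
  define c where "c = (\<lambda>e w. case w of [] \<Rightarrow> a e | [x] \<Rightarrow> u e x | _ \<Rightarrow> 0)"
  have c_simps: "c e [] = a e" "c e [x] = u e x" for e x by (simp_all add: c_def)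
  have c_long: "c e w = 0" if "1 < length w" for e w
    using that by (cases w; cases "tl w") (auto simp: c_def)
  have c: "chain U U L c"
  proof (rule chainI)
    fix e w assume *: "\<not> (e \<noteq> [] \<and> set e \<subseteq> X \<and> distinct w \<and> set w \<subseteq> U \<and> length e + length w = L)"
    show "c e w = 0"
    proof (cases w rule: short_word_cases)
      case Nil
      have "a e = 0" using * a(1)[of e] Nil by auto
      then show ?thesis using Nil c_simps by simp
    next
      case (single x)
      have "u e x = 0" using * u(1)[of e x] single by auto
      then show ?thesis using single c_simps by simp
    qed (rule c_long)
  next
    fix e w
    show "c e w \<in> M (U - set w)"
    proof (cases w rule: short_word_cases)
      case long
      then show ?thesis using c_long U(1) by (auto intro!: subgrp_0 M_subgrp)
    next
      case Nil then show ?thesis using a(2) by (simp add: c_simps)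
    next
      case (single x) then show ?thesis using u(2) by (simp add: c_simps)
    qed
  next
    fix g w and e :: "(nat \<Rightarrow> nat) list" assume g: "g permutes U"
    have g0: "\<rho> g 0 = 0" using perm_sub[OF g U(1)] by simp
    show "c (map ((\<circ>) g) e) (map g w) = \<rho> g (c e w)"
    proof (cases w rule: short_word_cases)
      case long
      then show ?thesis using c_long[of "map g w"] c_long[of w] g0 by simp
    next
      case Nil then show ?thesis using a(3)[OF g] c_simps(1) by (simp only: list.map)
    next
      case (single x) then show ?thesis using u(3)[OF g] c_simps(2) by (simp only: list.map)
    qed
  qed (use U in auto)
  have tot1: "tot U b e [] = (if e = [] then 0 else ins X (\<lambda>e. b e []) e + alt (length e) (\<Sum>x\<in>U. b e [x]))" for b e
    by (simp add: tot_def)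
  have tot2: "tot U b e [x] = (if e = [] then 0 else ins X (\<lambda>e. b e [x]) e)"
    if "\<And>e w. 1 < length w \<Longrightarrow> b e w = 0" for b e x
  proof -
    have "ins U (b e) [x] = 0" by (rule ins_eq_0, rule that) auto
    then show ?thesis by (simp add: tot_def)
  qed
  have "tot U c e w = 0" for e w
  proof -
    show ?thesis
    proof (cases w rule: short_word_cases)
      case Nil
      then show ?thesis using cyc(1)[of e] by (simp add: tot1 c_simps)
    next
      case (single x)
      then show ?thesis using cyc(2)[of e x] by (simp add: tot2[OF c_long] c_simps)
    next
      case long
      have "ins X (\<lambda>e. c e w) e = 0" by (rule ins_eq_0, rule c_long) (rule long)
      moreover have "ins U (c e) w = 0" by (rule ins_eq_0, rule c_long) (use long in auto)
      ultimately show ?thesis by (simp add: tot_def)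
    qed
  qed
  then have "null U {} (tot U c)" by (simp add: null_def zero_mod_def)
  \<comment> \<open>No point is kept away at the outset, as \<open>Y = U\<close>; the points of
    \<open>\<Omega> - U\<close> provide the \<open>m\<close> shifts.\<close>
  moreover have "stab L U U {}" using U by (intro stability[OF U(1) order_refl]) simp_all
  ultimately obtain b where b: "chain U U (Suc L) b" "\<And>e w. 1 < length w \<Longrightarrow> b e w = 0"
    "null U {} (\<lambda>e w. c e w - tot U b e w)"
    using c c_long unfolding stab_def by blast
  have eq: "c e w = tot U b e w" for e w using b(3) by (simp add: null_def zero_mod_def)
  show thesis
  proof (rule that[of "\<lambda>e. b e []" "\<lambda>e x. b e [x]"])
    show "b e [] \<in> M U" "b e [x] \<in> M (U - {x})" for e x using chain_M[OF b(1), of e "[]"] chain_M[OF b(1), of e "[x]"] by auto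
    show "b (map ((\<circ>) g) e) [] = \<rho> g (b e [])" "b (map ((\<circ>) g) e) [g x] = \<rho> g (b e [x])" if "g permutes U" for g e x
      using chain_eq[OF b(1) that, of e "[]"] chain_eq[OF b(1) that, of e "[x]"] by auto
    fix e :: "(nat \<Rightarrow> nat) list" and x assume e: "e \<noteq> []"
    show "a e = ins X (\<lambda>e. b e []) e + alt (length e) (\<Sum>x\<in>U. b e [x])"
      using eq[of e "[]"] e by (simp add: tot1 c_simps)
    show "u e x = ins X (\<lambda>e. b e [x]) e"
      using eq[of e "[x]"] e by (simp add: tot2[OF b(2)] c_simps)
  qed
qed

end

section \<open>The bar complex in homogeneous coordinates\<close>

fun ratios :: "(nat \<Rightarrow> nat) list \<Rightarrow> (nat \<Rightarrow> nat) list" where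
  "ratios (x # y # l) = (inv x \<circ> y) # ratios (y # l)"
| "ratios _ = []"

fun path :: "(nat \<Rightarrow> nat) \<Rightarrow> (nat \<Rightarrow> nat) list \<Rightarrow> (nat \<Rightarrow> nat) list" where
  "path p [] = [p]"
| "path p (g # gs) = p # path (p \<circ> g) gs"

text \<open>The faces of index at least 1 in the bar differential, from the side of the target: an
  entry \<open>h\<close> arises from the pairs \<open>x, inv x \<circ> h\<close>, or an arbitrary
  last entry was dropped.\<close>

fun faces :: "(nat \<Rightarrow> nat) set \<Rightarrow> ((nat \<Rightarrow> nat) list \<Rightarrow> 'b::ab_group_add) \<Rightarrow> (nat \<Rightarrow> nat) list \<Rightarrow> 'b" where
  "faces G c [] = - (\<Sum>x\<in>G. c [x])"
| "faces G c (h # hs) = - (\<Sum>x\<in>G. c (x # (inv x \<circ> h) # hs)) - faces G (\<lambda>l. c (h # l)) hs"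

lemma Sym_iff: "p \<in> Sym n \<longleftrightarrow> p permutes {1..n}"
  by (simp add: Sym_def)

lemma finite_Sym [simp]: "finite (Sym n)"
  unfolding Sym_def by (rule finite_permutations) simp

lemma Sym_comp: "p \<in> Sym n \<Longrightarrow> g \<in> Sym n \<Longrightarrow> p \<circ> g \<in> Sym n"
  and Sym_inv: "p \<in> Sym n \<Longrightarrow> inv p \<in> Sym n"
  and Sym_id: "id \<in> Sym n"
  unfolding Sym_iff by (rule permutes_compose, assumption+, rule permutes_inv, assumption, rule permutes_id)

lemma Sym_inv_comp: "p \<in> Sym n \<Longrightarrow> inv p \<circ> (p \<circ> g) = g" "p \<in> Sym n \<Longrightarrow> p \<circ> (inv p \<circ> g) = g"
    "p \<in> Sym n \<Longrightarrow> inv (inv p) = p"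
  unfolding Sym_iff by (simp_all add: comp_assoc[symmetric] permutes_inv_o permutes_inv_inv)

lemma Sym_comp_iff: "p \<in> Sym n \<Longrightarrow> p \<circ> g \<in> Sym n \<longleftrightarrow> g \<in> Sym n"
  unfolding Sym_iff by (rule permutes_comp_iff)

lemma bij_Sym: "p \<in> Sym n \<Longrightarrow> bij_betw ((\<circ>) p) (Sym n) (Sym n)"
  by (rule bij_betwI[where g = "(\<circ>) (inv p)"]) (auto simp: Sym_inv_comp Sym_comp Sym_inv)

lemma bij_Sym_inv: "p \<in> Sym n \<Longrightarrow> bij_betw (\<lambda>x. p \<circ> inv x) (Sym n) (Sym n)"
proof (rule bij_betwI[where g = "\<lambda>x. inv x \<circ> p"])
  assume p: "p \<in> Sym n"
  show "(\<lambda>x. p \<circ> inv x) \<in> Sym n \<rightarrow> Sym n" "(\<lambda>x. inv x \<circ> p) \<in> Sym n \<rightarrow> Sym n"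
    using p by (auto simp: Sym_comp Sym_inv)
  fix x assume x: "x \<in> Sym n"
  have b: "bij p" "bij x" using p x unfolding Sym_iff by (auto intro: permutes_bij)
  show "inv (p \<circ> inv x) \<circ> p = x"
    using o_inv_distrib[OF b(1) bij_imp_bij_inv[OF b(2)]] Sym_inv_comp(1)[OF p, of id] Sym_inv_comp(3)[OF x]
    by (simp add: comp_assoc)
  show "p \<circ> inv (inv x \<circ> p) = x"
    using o_inv_distrib[OF bij_imp_bij_inv[OF b(2)] b(1)] Sym_inv_comp(2)[OF p] Sym_inv_comp(3)[OF x]
    by simp
qed

lemma path_props:
  assumes "p \<in> Sym n" "set gs \<subseteq> Sym n"
  shows "ratios (path p gs) = gs" "hd (path p gs) = p" "path p gs \<noteq> []" "set (path p gs) \<subseteq> Sym n"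
    "length (path p gs) = Suc (length gs)"
proof -
  have "ratios (path p gs) = gs \<and> hd (path p gs) = p \<and> path p gs \<noteq> [] \<and> set (path p gs) \<subseteq> Sym n \<and> length (path p gs) = Suc (length gs)"
    using assms
  proof (induction gs arbitrary: p)
    case (Cons g gs)
    have pg: "p \<circ> g \<in> Sym n" using Cons.prems by (auto intro: Sym_comp)
    then have IH: "ratios (path (p \<circ> g) gs) = gs \<and> hd (path (p \<circ> g) gs) = p \<circ> g \<and> path (p \<circ> g) gs \<noteq> [] \<and>
       set (path (p \<circ> g) gs) \<subseteq> Sym n \<and> length (path (p \<circ> g) gs) = Suc (length gs)" using Cons by auto
    then obtain l where l: "path (p \<circ> g) gs = (p \<circ> g) # l" by (metis list.collapse)
    show ?case using IH Cons.prems by (simp add: l Sym_inv_comp)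
  qed auto
  then show "ratios (path p gs) = gs" "hd (path p gs) = p" "path p gs \<noteq> []" "set (path p gs) \<subseteq> Sym n"
    "length (path p gs) = Suc (length gs)" by auto
qed

lemma ratios_props:
  assumes "e \<noteq> []" "set e \<subseteq> Sym n"
  shows "set (ratios e) \<subseteq> Sym n" "Suc (length (ratios e)) = length e" "map ((\<circ>) (hd e)) (path id (ratios e)) = e"
proof -
  have mp: "map ((\<circ>) p) (path q gs) = path (p \<circ> q) gs" for p q gs
    by (induction gs arbitrary: q) (auto simp: comp_assoc)
  have "set (ratios e) \<subseteq> Sym n \<and> Suc (length (ratios e)) = length e \<and> path (hd e) (ratios e) = e"
    using assms
  proof (induction e rule: ratios.induct)
    case (1 x y l)
    then show ?case by (auto simp: Sym_inv_comp Sym_comp Sym_inv)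
  qed auto
  then show "set (ratios e) \<subseteq> Sym n" "Suc (length (ratios e)) = length e" "map ((\<circ>) (hd e)) (path id (ratios e)) = e"
    by (auto simp: mp)
qed

lemma ratios_map:
  assumes "g \<in> Sym n" "set e \<subseteq> Sym n"
  shows "ratios (map ((\<circ>) g) e) = ratios e"
  using assms(2)
proof (induction e rule: ratios.induct)
  case (1 x y l)
  have "bij g" "bij x" using assms(1) 1(2) unfolding Sym_def by (auto intro: permutes_bij)
  then have eq: "inv (g \<circ> x) \<circ> (g \<circ> y) = inv x \<circ> y"
    by (simp add: o_inv_distrib comp_assoc Sym_inv_comp(1)[OF assms(1)])
  have "ratios (map ((\<circ>) g) (y # l)) = ratios (y # l)" by (rule 1(1)) (use 1(2) in simp)
  then show ?case using eq by (simp only: list.map ratios.simps)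
qed auto

lemma tuples_iff: "gs \<in> tuples n k \<longleftrightarrow> length gs = k \<and> set gs \<subseteq> Sym n"
  by (simp add: tuples_def)

lemma finite_tuples: "finite (tuples n k)"
  using finite_lists_length_eq[of "Sym n" k] by (simp add: tuples_def conj_commute)

lemma tuples_0: "tuples n 0 = {[]}"
  by (auto simp: tuples_def)

lemma sum_tuples_Suc: "(\<Sum>gs\<in>tuples n (Suc k). f gs) = (\<Sum>x\<in>Sym n. \<Sum>l\<in>tuples n k. f (x # l))"
proof -
  have "bij_betw (\<lambda>(x, l). x # l) (Sym n \<times> tuples n k) (tuples n (Suc k))"
  proof (rule bij_betwI[where g = "\<lambda>gs. (hd gs, tl gs)"])
    show "(\<lambda>gs. (hd gs, tl gs)) \<in> tuples n (Suc k) \<rightarrow> Sym n \<times> tuples n k"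
      by (auto simp: tuples_def length_Suc_conv)
    show "(case (hd gs, tl gs) of (x, l) \<Rightarrow> x # l) = gs" if "gs \<in> tuples n (Suc k)" for gs
      using that by (auto simp: tuples_def length_Suc_conv)
  qed (auto simp: tuples_def)
  then have "(\<Sum>gs\<in>tuples n (Suc k). f gs) = (\<Sum>p\<in>Sym n \<times> tuples n k. f (case p of (x, l) \<Rightarrow> x # l))"
    by (rule sum.reindex_bij_betw[symmetric])
  also have "\<dots> = (\<Sum>(x, l)\<in>Sym n \<times> tuples n k. f (x # l))" by (rule sum.cong) auto
  finally show ?thesis by (simp add: sum.cartesian_product)
qed

lemma face_Cons:
  assumes "1 \<le> i" "i \<le> k" "length gs = k"
  shows "face (Suc k) (Suc i) (x # gs) = x # face k i gs"
proof (cases "i = k")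
  case True
  then show ?thesis using assms by (auto simp: face_def)
next
  case False
  obtain i' where i: "i = Suc i'" using assms(1) by (cases i) auto
  then show ?thesis using False assms by (simp add: face_def)
qed

text \<open>Face 1 changes the first entry; every later face keeps it and is a face of the remaining
  tuple with index lowered by one, whence the sign in the recursion of \<open>faces\<close>.\<close>

lemma faces_eq:
  assumes "set hs \<subseteq> Sym n"
  shows "(\<Sum>gs\<in>tuples n (Suc (length hs)). \<Sum>i\<in>{1..Suc (length hs)}.
      if face (Suc (length hs)) i gs = hs then alt i (c gs) else 0) = faces (Sym n) c hs"
  using assms
proof (induction hs arbitrary: c)
  case Nil
  show ?case by (simp add: sum_tuples_Suc tuples_0 face_def sum_negf)
next
  case (Cons h hs)
  let ?k = "Suc (length hs)"
  have h: "h \<in> Sym n" and hs: "set hs \<subseteq> Sym n" "hs \<in> tuples n (length hs)" using Cons.prems by (auto simp: tuples_iff)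
  have split: "(\<Sum>i\<in>{1..Suc ?k}. if face (Suc ?k) i (x # gs) = h # hs then alt i (c (x # gs)) else 0) =
    (if face (Suc ?k) 1 (x # gs) = h # hs then - c (x # gs) else 0) +
    (if x = h then - (\<Sum>i\<in>{1..?k}. if face ?k i gs = hs then alt i (c (h # gs)) else 0) else 0)"
    if "gs \<in> tuples n ?k" for x gs
  proof -
    have "(\<Sum>i\<in>{1..Suc ?k}. if face (Suc ?k) i (x # gs) = h # hs then alt i (c (x # gs)) else 0) =
      (if face (Suc ?k) 1 (x # gs) = h # hs then alt 1 (c (x # gs)) else 0) +
      (\<Sum>i\<in>{1..?k}. if face (Suc ?k) (Suc i) (x # gs) = h # hs then alt (Suc i) (c (x # gs)) else 0)"
      by (simp add: sum.atLeast_Suc_atMost sum.shift_bounds_cl_Suc_ivl del: sum.cl_ivl_Suc)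
    also have "(\<Sum>i\<in>{1..?k}. if face (Suc ?k) (Suc i) (x # gs) = h # hs then alt (Suc i) (c (x # gs)) else 0)
      = (\<Sum>i\<in>{1..?k}. if x = h then - (if face ?k i gs = hs then alt i (c (h # gs)) else 0) else 0)"
    proof (rule sum.cong[OF refl])
      fix i assume "i \<in> {1..?k}"
      then have "face (Suc ?k) (Suc i) (x # gs) = x # face ?k i gs"
        using that by (intro face_Cons) (auto simp: tuples_iff)
      then show "(if face (Suc ?k) (Suc i) (x # gs) = h # hs then alt (Suc i) (c (x # gs)) else 0)
        = (if x = h then - (if face ?k i gs = hs then alt i (c (h # gs)) else 0) else 0)" by simp
    qed
    also have "\<dots> = (if x = h then - (\<Sum>i\<in>{1..?k}. if face ?k i gs = hs then alt i (c (h # gs)) else 0) else 0)"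
      by (simp add: sum_negf)
    finally show ?thesis by simp
  qed
  have first: "(\<Sum>gs\<in>tuples n ?k. if face (Suc ?k) 1 (x # gs) = h # hs then - c (x # gs) else 0) =
     - c (x # (inv x \<circ> h) # hs)" if x: "x \<in> Sym n" for x
  proof -
    have "(\<Sum>gs\<in>tuples n ?k. if face (Suc ?k) 1 (x # gs) = h # hs then - c (x # gs) else 0) =
      (\<Sum>y\<in>Sym n. \<Sum>l\<in>tuples n (length hs). if x \<circ> y = h \<and> l = hs then - c (x # y # l) else 0)"
      by (simp add: sum_tuples_Suc face_def)
    also have "\<dots> = (\<Sum>y\<in>Sym n. if x \<circ> y = h then - c (x # y # hs) else 0)"
    proof (rule sum.cong[OF refl])
      fix y
      have "(\<Sum>l\<in>tuples n (length hs). if x \<circ> y = h \<and> l = hs then - c (x # y # l) else 0) =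
        (\<Sum>l\<in>tuples n (length hs). if l = hs then (if x \<circ> y = h then - c (x # y # hs) else 0) else 0)"
        by (rule sum.cong) auto
      then show "(\<Sum>l\<in>tuples n (length hs). if x \<circ> y = h \<and> l = hs then - c (x # y # l) else 0) =
         (if x \<circ> y = h then - c (x # y # hs) else 0)"
        using hs(2) by (simp add: finite_tuples)
    qed
    also have "\<dots> = (\<Sum>y\<in>Sym n. if y = inv x \<circ> h then - c (x # (inv x \<circ> h) # hs) else 0)"
      by (rule sum.cong) (use x in \<open>auto simp: Sym_inv_comp\<close>)
    also have "\<dots> = - c (x # (inv x \<circ> h) # hs)" using x h by (simp add: Sym_comp Sym_inv)
    finally show ?thesis .
  qed
  have "(\<Sum>gs\<in>tuples n (Suc ?k). \<Sum>i\<in>{1..Suc ?k}. if face (Suc ?k) i gs = h # hs then alt i (c gs) else 0)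
    = (\<Sum>x\<in>Sym n. \<Sum>gs\<in>tuples n ?k. (if face (Suc ?k) 1 (x # gs) = h # hs then - c (x # gs) else 0) +
    (if x = h then - (\<Sum>i\<in>{1..?k}. if face ?k i gs = hs then alt i (c (h # gs)) else 0) else 0))"
    unfolding sum_tuples_Suc[of _ n ?k] by (intro sum.cong refl split)
  also have "\<dots> = (\<Sum>x\<in>Sym n. \<Sum>gs\<in>tuples n ?k. if face (Suc ?k) 1 (x # gs) = h # hs then - c (x # gs) else 0) +
     (\<Sum>x\<in>Sym n. \<Sum>gs\<in>tuples n ?k. if x = h then - (\<Sum>i\<in>{1..?k}. if face ?k i gs = hs then alt i (c (h # gs)) else 0) else 0)"
    by (simp only: sum.distrib)
  also have "(\<Sum>x\<in>Sym n. \<Sum>gs\<in>tuples n ?k. if face (Suc ?k) 1 (x # gs) = h # hs then - c (x # gs) else 0) =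
     (\<Sum>x\<in>Sym n. - c (x # (inv x \<circ> h) # hs))"
    by (rule sum.cong[OF refl first])
  also have "(\<Sum>x\<in>Sym n. \<Sum>gs\<in>tuples n ?k. if x = h then - (\<Sum>i\<in>{1..?k}. if face ?k i gs = hs then alt i (c (h # gs)) else 0) else 0)
    = (\<Sum>x\<in>Sym n. if x = h then - faces (Sym n) (\<lambda>l. c (h # l)) hs else 0)"
    unfolding Cons.IH[OF hs(1), symmetric]
  proof (rule sum.cong[OF refl])
    fix x
    show "(\<Sum>gs\<in>tuples n ?k. if x = h then - (\<Sum>i\<in>{1..?k}. if face ?k i gs = hs then alt i (c (h # gs)) else 0) else 0)
      = (if x = h then - (\<Sum>gs\<in>tuples n ?k. \<Sum>i\<in>{1..?k}. if face ?k i gs = hs then alt i (c (h # gs)) else 0) else 0)"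
      by (cases "x = h") (simp_all only: sum_negf if_True if_False sum.neutral_const simp_thms)
  qed
  also have "(\<Sum>x\<in>Sym n. - c (x # (inv x \<circ> h) # hs)) +
      (\<Sum>x\<in>Sym n. if x = h then - faces (Sym n) (\<lambda>l. c (h # l)) hs else 0) = faces (Sym n) c (h # hs)"
    using h by (simp add: sum_negf)
  finally show ?case by simp
qed

lemma bd_eq:
  assumes "hs \<in> tuples n k"
  shows "bd act n (Suc k) c hs = (\<Sum>x\<in>Sym n. act {1..n} {1..n} (inv x) (c (x # hs))) + faces (Sym n) c hs"
proof -
  have k: "length hs = k" "set hs \<subseteq> Sym n" using assms by (auto simp: tuples_iff)
  have "bd act n (Suc k) c hs = (\<Sum>gs\<in>tuples n (Suc k). \<Sum>i\<in>{0..Suc k}. if face (Suc k) i gs = hs then face_coeff act n i gs (c gs) else 0)"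
    using assms by (simp add: bd_def)
  also have "\<dots> = (\<Sum>gs\<in>tuples n (Suc k). (if tl gs = hs then act {1..n} {1..n} (inv (hd gs)) (c gs) else 0) +
     (\<Sum>i\<in>{1..Suc k}. if face (Suc k) i gs = hs then alt i (c gs) else 0))"
  proof (rule sum.cong[OF refl])
    fix gs
    have "(\<Sum>i\<in>{0..Suc k}. if face (Suc k) i gs = hs then face_coeff act n i gs (c gs) else 0) =
      (if face (Suc k) 0 gs = hs then face_coeff act n 0 gs (c gs) else 0) +
      (\<Sum>i\<in>{1..Suc k}. if face (Suc k) i gs = hs then face_coeff act n i gs (c gs) else 0)"
      by (simp add: sum.atLeast_Suc_atMost del: sum.cl_ivl_Suc)
    also have "(\<Sum>i\<in>{1..Suc k}. if face (Suc k) i gs = hs then face_coeff act n i gs (c gs) else 0)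
       = (\<Sum>i\<in>{1..Suc k}. if face (Suc k) i gs = hs then alt i (c gs) else 0)"
      by (rule sum.cong) (auto simp: face_coeff_def alt_def)
    finally show "(\<Sum>i\<in>{0..Suc k}. if face (Suc k) i gs = hs then face_coeff act n i gs (c gs) else 0) =
      (if tl gs = hs then act {1..n} {1..n} (inv (hd gs)) (c gs) else 0) +
     (\<Sum>i\<in>{1..Suc k}. if face (Suc k) i gs = hs then alt i (c gs) else 0)"
      by (simp add: face_def face_coeff_def)
  qed
  also have "\<dots> = (\<Sum>x\<in>Sym n. \<Sum>l\<in>tuples n k. if l = hs then act {1..n} {1..n} (inv x) (c (x # hs)) else 0) + faces (Sym n) c hs"
    using faces_eq[OF k(2), of c] k(1)
    by (simp add: sum.distrib) (simp add: sum_tuples_Suc cong: if_cong)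
  also have "\<dots> = (\<Sum>x\<in>Sym n. act {1..n} {1..n} (inv x) (c (x # hs))) + faces (Sym n) c hs"
    using assms by (simp add: finite_tuples)
  finally show ?thesis .
qed

lemma faces_additive:
  assumes "additive_on S F" "\<And>l. c l \<in> S"
  shows "faces G c hs \<in> S" "faces G (\<lambda>l. F (c l)) hs = F (faces G c hs)"
proof -
  note s = additive_on_subgrp[OF assms(1)]
  have sum: "(\<Sum>x\<in>G. f x) \<in> S" if "\<And>x. f x \<in> S" for f :: "(nat \<Rightarrow> nat) \<Rightarrow> _" by (rule subgrp_sum[OF s that])
  have "faces G c hs \<in> S \<and> faces G (\<lambda>l. F (c l)) hs = F (faces G c hs)"
    using assms(2)
  proof (induction hs arbitrary: c)
    case Nil
    then show ?case using sum[of "\<lambda>x. c [x]"]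
      by (auto simp: additive_on_uminus[OF assms(1)] additive_on_sum[OF assms(1)] intro: subgrp_uminus[OF s])
  next
    case (Cons h hs)
    have IH: "faces G (\<lambda>l. c (h # l)) hs \<in> S \<and> faces G (\<lambda>l. F (c (h # l))) hs = F (faces G (\<lambda>l. c (h # l)) hs)"
      by (rule Cons.IH) (rule Cons.prems)
    have m: "- (\<Sum>x\<in>G. c (x # (inv x \<circ> h) # hs)) \<in> S"
      by (intro subgrp_uminus[OF s] sum Cons.prems)
    have "F (- (\<Sum>x\<in>G. c (x # (inv x \<circ> h) # hs))) = - (\<Sum>x\<in>G. F (c (x # (inv x \<circ> h) # hs)))"
      using Cons.prems sum[of "\<lambda>x. c (x # (inv x \<circ> h) # hs)"]
      by (simp add: additive_on_uminus[OF assms(1)] additive_on_sum[OF assms(1)])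
    then show ?case using IH m by (auto simp: additive_on_diff[OF assms(1)] intro: subgrp_diff[OF s])
  qed
  then show "faces G c hs \<in> S" "faces G (\<lambda>l. F (c l)) hs = F (faces G c hs)" by auto
qed

text \<open>An entry inserted behind \<open>y\<close> splits a ratio in two or appends one;
  translating the summation variable matches the two sums. Insertion before \<open>y\<close> is kept
  apart because it changes the base point.\<close>

lemma ins_ratios:
  assumes "y \<in> Sym n" "set l \<subseteq> Sym n"
  shows "ins (Sym n) (\<lambda>l. c (ratios (y # l))) l = - faces (Sym n) c (ratios (y # l))"
  using assms
proof (induction l arbitrary: y c)
  case Nil
  then show ?case using sum.reindex_bij_betw[OF bij_Sym[OF Sym_inv[OF Nil(1)]], of "\<lambda>x. c [x]"] by simp
next
  case (Cons z l)
  have z: "z \<in> Sym n" "set l \<subseteq> Sym n" using Cons.prems by auto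
  have IH: "ins (Sym n) (\<lambda>l. c ((inv y \<circ> z) # ratios (z # l))) l = - faces (Sym n) (\<lambda>l. c ((inv y \<circ> z) # l)) (ratios (z # l))"
    by (rule Cons.IH[OF z])
  have "(\<Sum>x\<in>Sym n. c ((inv y \<circ> x) # (inv x \<circ> z) # ratios (z # l))) =
    (\<Sum>x\<in>Sym n. c ((inv y \<circ> (y \<circ> x)) # (inv (y \<circ> x) \<circ> z) # ratios (z # l)))"
    using sum.reindex_bij_betw[OF bij_Sym[OF Cons.prems(1)], of "\<lambda>x. c ((inv y \<circ> x) # (inv x \<circ> z) # ratios (z # l))"] by simp
  also have "\<dots> = (\<Sum>x\<in>Sym n. c (x # (inv x \<circ> (inv y \<circ> z)) # ratios (z # l)))"
  proof (rule sum.cong[OF refl])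
    fix x assume x: "x \<in> Sym n"
    have "bij y" "bij x" using Cons.prems(1) x unfolding Sym_iff by (auto intro: permutes_bij)
    then show "c ((inv y \<circ> (y \<circ> x)) # (inv (y \<circ> x) \<circ> z) # ratios (z # l)) = c (x # (inv x \<circ> (inv y \<circ> z)) # ratios (z # l))"
      by (simp add: o_inv_distrib comp_assoc Sym_inv_comp(1)[OF Cons.prems(1)])
  qed
  finally show ?case using IH by simp
qed

lemma push_fwd_cong:
  assumes "\<And>e. length e = length l \<Longrightarrow> c e = c' e"
  shows "push_fwd X f c l = push_fwd X f c' l"
proof -
  have "push_fwd X f (\<lambda>e. c e - c' e) l = 0" by (rule push_fwd_eq_0) (simp add: assms)
  then show ?thesis by (simp add: push_fwd_diff)
qed

lemma push_fwd_alt: "push_fwd X f (\<lambda>e. alt (length e) (c e)) l = alt (length l) (push_fwd X f c l)"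
proof -
  have "push_fwd X f (\<lambda>e. alt (length e) (c e)) l = push_fwd X f (\<lambda>e. alt (length l) (c e)) l"
    by (rule push_fwd_cong) simp
  also have "\<dots> = alt (length l) (push_fwd X f c l)"
    using push_fwd_diff[of X f "\<lambda>_. 0" c l] by (simp add: alt_def)
  finally show ?thesis .
qed

lemma push_fwd_closed:
  assumes "subgrp S" "\<And>e. c e \<in> S" shows "push_fwd X f c l \<in> S"
proof -
  have "additive_on S (\<lambda>x. x)" using assms(1) by (simp add: additive_on_def)
  then show ?thesis
    by (rule push_fwd_transport(1)[where \<gamma> = id and \<gamma>' = id and f' = f and c' = c]) (use assms(2) in auto)
qed

lemma Sym_Suc_iff: "g \<in> Sym n \<longleftrightarrow> g \<in> Sym (Suc n) \<and> g (Suc n) = Suc n"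
proof
  assume g: "g \<in> Sym n"
  have "g permutes {1..Suc n}" by (rule permutes_subset[OF g[unfolded Sym_iff]]) simp
  then show "g \<in> Sym (Suc n) \<and> g (Suc n) = Suc n"
    using permutes_not_in[OF g[unfolded Sym_iff], of "Suc n"] by (simp add: Sym_iff)
next
  assume g: "g \<in> Sym (Suc n) \<and> g (Suc n) = Suc n"
  have "x = Suc n" if "x \<in> {1..Suc n} - {1..n}" for x using that by auto
  then show "g \<in> Sym n" unfolding Sym_iff
    using permutes_superset[of g "{1..Suc n}" "{1..n}"] g[unfolded Sym_iff] by blast
qed

text \<open>The left coset of \<open>Sym n\<close> containing \<open>g\<close> is determined by
  \<open>g (Suc n)\<close>, and the ratios test whether all entries share a coset.\<close>

lemma ratios_Sym:
  assumes "l \<noteq> []" "set l \<subseteq> Sym (Suc n)"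
  shows "set (ratios l) \<subseteq> Sym n \<longleftrightarrow> (\<forall>g\<in>set l. g (Suc n) = hd l (Suc n))"
  using assms
proof (induction l rule: ratios.induct)
  case (1 x y l)
  have xy: "x \<in> Sym (Suc n)" "y \<in> Sym (Suc n)" using 1(3) by simp_all
  have "inv x (y (Suc n)) = Suc n \<longleftrightarrow> y (Suc n) = x (Suc n)"
    using permutes_inv_eq[OF xy(1)[unfolded Sym_iff], of "y (Suc n)" "Suc n"] by (simp add: eq_commute)
  then have "inv x \<circ> y \<in> Sym n \<longleftrightarrow> y (Suc n) = x (Suc n)"
    using Sym_comp[OF Sym_inv[OF xy(1)] xy(2)] Sym_Suc_iff[of "inv x \<circ> y" n] by simp
  moreover have "set (ratios (y # l)) \<subseteq> Sym n \<longleftrightarrow> (\<forall>g\<in>set (y # l). g (Suc n) = y (Suc n))"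
    using 1(1) 1(3) by simp
  moreover have "set (ratios (x # y # l)) = insert (inv x \<circ> y) (set (ratios (y # l)))" by simp
  ultimately have "set (ratios (x # y # l)) \<subseteq> Sym n \<longleftrightarrow> y (Suc n) = x (Suc n) \<and> (\<forall>g\<in>set (y # l). g (Suc n) = y (Suc n))"
    by (simp only: insert_subset)
  also have "\<dots> \<longleftrightarrow> (\<forall>g\<in>set (x # y # l). g (Suc n) = x (Suc n))" by auto
  finally show ?case by simp
qed simp_all

section \<open>Homogenization of bar chains\<close>

locale fi_poly = fi_mod +
  fixes m e :: nat and W :: "nat set"
  assumes poly: "poly_pres e (int m) P0" and W: "finite W"
begin

abbreviation \<rho> where "\<rho> \<equiv> act W W"

abbreviation G where "G \<equiv> {g. g permutes W}"

definition emb :: "nat \<Rightarrow> 'b \<Rightarrow> 'b" where "emb j = act {1..j} W id"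

text \<open>The equivariant function with value \<open>b gs\<close> at the tuple
  \<open>1, g1, g1 g2, ...\<close>, embedded into the ambient module and extended by 0 from tuples
  in \<open>Sym j\<close> to all tuples of permutations of \<open>W\<close>.\<close>

definition hat :: "nat \<Rightarrow> ((nat \<Rightarrow> nat) list \<Rightarrow> 'b) \<Rightarrow> (nat \<Rightarrow> nat) list \<Rightarrow> 'b" where
  "hat j b l = (if l \<noteq> [] \<and> set l \<subseteq> Sym j then \<rho> (hd l) (emb j (b (ratios l))) else 0)"

text \<open>Inhomogeneous coordinates recovered at the tuples based at \<open>id\<close>. The
  preimage under \<open>emb j\<close> is unique by \<open>emb_inj\<close> once
  \<open>m \<le> j\<close>.\<close>

definition unhat :: "nat \<Rightarrow> nat \<Rightarrow> ((nat \<Rightarrow> nat) list \<Rightarrow> 'b) \<Rightarrow> (nat \<Rightarrow> nat) list \<Rightarrow> 'b" where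
  "unhat j k f gs = (if gs \<in> tuples j k then inv_into (V {1..j}) (emb j) (f (path id gs)) else 0)"

lemmas ps = poly_system[OF poly W]

context
  fixes j assumes j: "{1..j} \<subseteq> W" "m \<le> j"
begin

lemma mor_j: "FI_mor {1..j} W id"
  by (rule mor_incl[OF W j(1)])

lemma Sym_W: "g \<in> Sym j \<Longrightarrow> g permutes W"
  unfolding Sym_iff by (rule permutes_subset[OF _ j(1)])

lemma Sym_G: "Sym j \<subseteq> G"
  using Sym_W by blast

lemma mor_Sym: "g \<in> Sym j \<Longrightarrow> FI_mor {1..j} {1..j} g"
  unfolding Sym_iff by (rule mor_perm) simp

lemma emb_img: "v \<in> V {1..j} \<Longrightarrow> emb j v \<in> sub_img W {1..j}"
  by (simp add: emb_def sub_img_def)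

lemma emb_W: "v \<in> V {1..j} \<Longrightarrow> emb j v \<in> V W"
  unfolding emb_def by (rule act_V[OF mor_j])

lemma emb_additive: "additive_on (V {1..j}) (emb j)"
  unfolding emb_def by (rule act_additive[OF mor_j])

lemma emb_inj: "inj_on (emb j) (V {1..j})"
proof (rule inj_onI)
  fix v w assume vw: "v \<in> V {1..j}" "w \<in> V {1..j}" "emb j v = emb j w"
  have "v - w = 0"
  proof (rule inj_incl[OF poly W j(1)])
    show "v - w \<in> V {1..j}" by (rule subgrp_diff[OF V_subgrp vw(1,2)]) simp
    show "act {1..j} W id (v - w) = 0"
      using additive_on_diff[OF emb_additive vw(1,2)] vw(3) by (simp add: emb_def)
  qed (use j in simp)
  then show "v = w" by simp
qed

lemma emb_perm:
  assumes "g \<in> Sym j" "v \<in> V {1..j}"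
  shows "\<rho> g (emb j v) = emb j (act {1..j} {1..j} g v)"
proof -
  have "\<rho> g (emb j v) = act {1..j} W (g \<circ> id) v"
    unfolding emb_def by (rule act_comp[OF mor_j mor_perm[OF W Sym_W[OF assms(1)]] assms(2), symmetric])
  also have "\<dots> = act {1..j} W (id \<circ> g) v" by simp
  also have "\<dots> = emb j (act {1..j} {1..j} g v)"
    unfolding emb_def by (rule act_comp[OF mor_Sym[OF assms(1)] mor_j assms(2)])
  finally show ?thesis .
qed

lemma \<rho>_add: "g permutes W \<Longrightarrow> additive_on (V W) (\<rho> g)"
  by (rule act_additive[OF mor_perm[OF W]])

lemma \<rho>_comp: "g permutes W \<Longrightarrow> h permutes W \<Longrightarrow> v \<in> V W \<Longrightarrow> \<rho> (g \<circ> h) v = \<rho> g (\<rho> h v)"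
  by (rule act_comp[OF mor_perm[OF W] mor_perm[OF W]])

lemma \<rho>_id: "v \<in> V W \<Longrightarrow> \<rho> id v = v"
  by (rule act_id[OF W])

lemma \<rho>_0: "g permutes W \<Longrightarrow> \<rho> g 0 = 0"
  by (rule act_0[OF mor_perm[OF W]])

lemma hat_img:
  assumes "\<And>gs. b gs \<in> V {1..j}" shows "hat j b l \<in> sub_img W {1..j}"
proof (cases "l \<noteq> [] \<and> set l \<subseteq> Sym j")
  case True
  then have h: "hd l \<in> Sym j" by (cases l) auto
  show ?thesis using True emb_img[OF act_V[OF mor_Sym[OF h] assms]] by (simp add: hat_def emb_perm[OF h assms])
next
  case False
  have "emb j 0 = 0" unfolding emb_def by (rule act_0[OF mor_j])
  moreover have "0 \<in> V {1..j}" by (rule subgrp_0[OF V_subgrp]) simp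
  ultimately have "0 \<in> sub_img W {1..j}" using emb_img by metis
  then show ?thesis using False unfolding hat_def by presburger
qed

lemma hat_perm:
  assumes "\<And>gs. b gs \<in> V {1..j}" "g \<in> Sym j" shows "hat j b (map ((\<circ>) g) l) = \<rho> g (hat j b l)"
proof -
  have sub: "set (map ((\<circ>) g) l) \<subseteq> Sym j \<longleftrightarrow> set l \<subseteq> Sym j"
    using Sym_comp_iff[OF assms(2)] by auto
  show ?thesis
  proof (cases "l \<noteq> [] \<and> set l \<subseteq> Sym j")
    case True
    then have h: "hd l \<in> Sym j" "hd (map ((\<circ>) g) l) = g \<circ> hd l" by (cases l; auto)+
    have "hat j b (map ((\<circ>) g) l) = \<rho> (g \<circ> hd l) (emb j (b (ratios l)))"
      using True sub h(2) ratios_map[OF assms(2), of l] unfolding hat_def by simp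
    also have "\<dots> = \<rho> g (hat j b l)"
      using True \<rho>_comp[OF Sym_W[OF assms(2)] Sym_W[OF h(1)] emb_W[OF assms(1)]] unfolding hat_def by simp
    finally show ?thesis .
  next
    case False
    then show ?thesis using sub \<rho>_0[OF Sym_W[OF assms(2)]] unfolding hat_def by auto
  qed
qed

text \<open>Entries inserted behind the first one give the faces of index at least 1. An entry
  inserted in front is written \<open>y \<circ> inv x\<close>: it is the new base point, its ratio
  to \<open>y\<close> is \<open>x\<close>, and the action of \<open>inv x\<close> is that of face
  0.\<close>

lemma ins_hat:
  assumes b: "\<And>gs. b gs \<in> V {1..j}" and l: "l \<noteq> []" "set l \<subseteq> Sym j"
  shows "ins (Sym j) (hat j b) l = \<rho> (hd l) (emb j (bd act j (length l) b (ratios l)))"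
proof -
  obtain y t where yt: "l = y # t" "y \<in> Sym j" "set t \<subseteq> Sym j" using l by (cases l) auto
  let ?h = "ratios (y # t)"
  note yW = Sym_W[OF yt(2)]
  have VW: "subgrp (V W)" and Vj: "subgrp (V {1..j})" using V_subgrp W by auto
  have h: "?h \<in> tuples j (length t)" using ratios_props[of l j] l yt(1) by (simp add: tuples_iff)
  have "additive_on (V {1..j}) (\<lambda>v. \<rho> y (emb j v))"
    unfolding additive_on_def
  proof (intro conjI ballI)
    fix v w assume "v \<in> V {1..j}" "w \<in> V {1..j}"
    then show "\<rho> y (emb j (v + w)) = \<rho> y (emb j v) + \<rho> y (emb j w)"
      by (simp add: additive_on_add[OF emb_additive] additive_on_add[OF \<rho>_add[OF yW]] emb_W)
  qed (rule Vj)
  note F = faces_additive(2)[OF this b, where G = "Sym j" and hs = ?h]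
    and Fm = faces_additive(1)[OF this b, where G = "Sym j" and hs = ?h]
  have "ins (Sym j) (\<lambda>t. hat j b (y # t)) t = ins (Sym j) (\<lambda>t. \<rho> y (emb j (b (ratios (y # t))))) t"
    by (rule ins_cong) (use yt in \<open>auto simp: hat_def\<close>)
  also have "\<dots> = - \<rho> y (emb j (faces (Sym j) b ?h))"
    unfolding ins_ratios[OF yt(2,3), of "\<lambda>l. \<rho> y (emb j (b l))"] F ..
  finally have 1: "ins (Sym j) (\<lambda>t. hat j b (y # t)) t = - \<rho> y (emb j (faces (Sym j) b ?h))" .
  let ?f = "\<lambda>x. act {1..j} {1..j} (inv x) (b (x # ?h))"
  have fV: "?f x \<in> V {1..j}" if "x \<in> Sym j" for x by (rule act_V[OF mor_Sym[OF Sym_inv[OF that]] b])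
  have "(\<Sum>x\<in>Sym j. hat j b (x # y # t)) = (\<Sum>x\<in>Sym j. hat j b ((y \<circ> inv x) # y # t))"
    by (rule sum.reindex_bij_betw[OF bij_Sym_inv[OF yt(2)], symmetric])
  also have "\<dots> = (\<Sum>x\<in>Sym j. \<rho> y (emb j (?f x)))"
  proof (rule sum.cong[OF refl])
    fix x assume x: "x \<in> Sym j"
    have yx: "y \<circ> inv x \<in> Sym j" by (intro Sym_comp Sym_inv yt(2) x)
    have "bij y" "bij x" using yt(2) x unfolding Sym_iff by (auto intro: permutes_bij)
    then have "inv (y \<circ> inv x) \<circ> y = x"
      by (simp add: o_inv_distrib bij_imp_bij_inv comp_assoc Sym_inv_comp(3)[OF x])
         (metis Sym_inv_comp(1) yt(2) comp_id)
    then have "hat j b ((y \<circ> inv x) # y # t) = \<rho> (y \<circ> inv x) (emb j (b (x # ?h)))"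
      using yx yt by (simp add: hat_def)
    also have "\<dots> = \<rho> y (\<rho> (inv x) (emb j (b (x # ?h))))"
      by (rule \<rho>_comp[OF yW Sym_W[OF Sym_inv[OF x]] emb_W[OF b]])
    finally show "hat j b ((y \<circ> inv x) # y # t) = \<rho> y (emb j (?f x))"
      by (simp add: emb_perm[OF Sym_inv[OF x] b])
  qed
  also have "\<dots> = \<rho> y (\<Sum>x\<in>Sym j. emb j (?f x))"
    by (rule additive_on_sum[OF \<rho>_add[OF yW], symmetric]) (rule emb_W[OF fV])
  also have "(\<Sum>x\<in>Sym j. emb j (?f x)) = emb j (\<Sum>x\<in>Sym j. ?f x)"
    by (rule additive_on_sum[OF emb_additive fV, symmetric])
  finally have 2: "(\<Sum>x\<in>Sym j. hat j b (x # y # t)) = \<rho> y (emb j (\<Sum>x\<in>Sym j. ?f x))" .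
  have s: "(\<Sum>x\<in>Sym j. ?f x) \<in> V {1..j}" by (rule subgrp_sum[OF Vj fV])
  have "bd act j (length l) b ?h = (\<Sum>x\<in>Sym j. ?f x) + faces (Sym j) b ?h"
    using bd_eq[OF h, of act b] yt(1) by simp
  then show ?thesis
    using 1 2 s Fm unfolding yt(1)
    by (simp add: additive_on_add[OF emb_additive] additive_on_add[OF \<rho>_add[OF yW]] emb_W del: ratios.simps)
qed

lemma unhat_chain:
  assumes "\<And>l. f l \<in> sub_img W {1..j}"
  shows "unhat j k f \<in> chains V j k" "\<And>gs. unhat j k f gs \<in> V {1..j}"
    "\<And>gs. gs \<in> tuples j k \<Longrightarrow> emb j (unhat j k f gs) = f (path id gs)"
proof -
  have im: "f l \<in> emb j ` V {1..j}" for l using assms unfolding sub_img_def emb_def .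
  have 0: "0 \<in> V {1..j}" by (rule subgrp_0[OF V_subgrp]) simp
  show *: "unhat j k f gs \<in> V {1..j}" for gs unfolding unhat_def using inv_into_into[OF im] 0 by auto
  have "unhat j k f gs = 0" if "gs \<notin> tuples j k" for gs using that by (simp add: unhat_def)
  then show "unhat j k f \<in> chains V j k" unfolding chains_def mem_Collect_eq using * by blast
  show "emb j (unhat j k f gs) = f (path id gs)" if "gs \<in> tuples j k" for gs
    using that f_inv_into_f[OF im] by (simp add: unhat_def)
qed

lemma hat_unhat:
  assumes f: "\<And>l. f l \<in> sub_img W {1..j}" "\<And>g l. g \<in> Sym j \<Longrightarrow> f (map ((\<circ>) g) l) = \<rho> g (f l)"
    and l: "set l \<subseteq> Sym j" "length l = Suc k"
  shows "hat j (unhat j k f) l = f l"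
proof -
  have ne: "l \<noteq> []" using l by auto
  then have h: "hd l \<in> Sym j" using l by (cases l) auto
  have t: "ratios l \<in> tuples j k" using ratios_props[OF ne l(1)] l(2) by (simp add: tuples_iff)
  have "hat j (unhat j k f) l = \<rho> (hd l) (f (path id (ratios l)))"
    using ne l unhat_chain(3)[OF f(1) t] by (simp add: hat_def)
  also have "\<dots> = f l" using f(2)[OF h, of "path id (ratios l)"] ratios_props(3)[OF ne l(1)] by simp
  finally show ?thesis .
qed

lemma bd_V:
  assumes "\<And>gs. b gs \<in> V {1..j}" shows "bd act j (Suc k) b hs \<in> V {1..j}"
proof (cases "hs \<in> tuples j k")
  case True
  show ?thesis unfolding bd_eq[OF True]
  proof (rule subgrp_add[OF V_subgrp])
    show "(\<Sum>x\<in>Sym j. act {1..j} {1..j} (inv x) (b (x # hs))) \<in> V {1..j}"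
      by (rule subgrp_sum[OF V_subgrp]) (use act_V[OF mor_Sym[OF Sym_inv] assms] in auto)
    have "additive_on (V {1..j}) (\<lambda>v. v)" using V_subgrp[of "{1..j}"] by (simp add: additive_on_def)
    then show "faces (Sym j) b hs \<in> V {1..j}" by (rule faces_additive(1)) (rule assms)
  qed simp
next
  case False
  then show ?thesis by (auto simp: bd_def intro!: subgrp_0 V_subgrp)
qed

lemma emb_bd:
  assumes b: "\<And>gs. b gs \<in> V {1..j}" and hs: "hs \<in> tuples j k"
  shows "emb j (bd act j (Suc k) b hs) = ins (Sym j) (hat j b) (path id hs)"
proof -
  note hs' = hs[unfolded tuples_iff]
  note p = path_props[OF Sym_id, of hs j]
  have ph: "path id hs \<noteq> []" "set (path id hs) \<subseteq> Sym j" "length (path id hs) = Suc k" using p hs' by auto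
  have "bd act j (Suc k) b hs \<in> V {1..j}" by (rule bd_V) (rule b)
  then show ?thesis
    using ins_hat[OF b ph(1,2)] ph(3) p hs' by (simp add: \<rho>_id[OF emb_W])
qed

lemma chains_V: "b \<in> chains V j k \<Longrightarrow> b gs \<in> V {1..j}"
  using subgrp_0[OF V_subgrp, of "{1..j}"] by (cases "gs \<in> tuples j k") (auto simp: chains_def)

lemma hat_supp:
  assumes "b \<in> chains V j k" "hat j b l \<noteq> 0"
  shows "l \<noteq> [] \<and> set l \<subseteq> Sym j \<and> length l = Suc k"
proof -
  have l: "l \<noteq> [] \<and> set l \<subseteq> Sym j" using assms(2) by (auto simp: hat_def split: if_splits)
  then have h: "hd l \<in> Sym j" by (cases l) auto
  have "length l = Suc k"
  proof (rule ccontr)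
    assume "length l \<noteq> Suc k"
    then have "ratios l \<notin> tuples j k" using ratios_props(2)[of l j] l by (auto simp: tuples_iff)
    then have "b (ratios l) = 0" using assms(1) by (auto simp: chains_def)
    moreover have "emb j 0 = 0" unfolding emb_def by (rule act_0[OF mor_j])
    ultimately show False using assms(2) l \<rho>_0[OF Sym_W[OF h]] by (simp add: hat_def)
  qed
  then show ?thesis using l by simp
qed

lemma ins_hat_G:
  assumes b: "b \<in> chains V j k" and l: "l \<noteq> []"
  shows "ins G (hat j b) l = (if set l \<subseteq> Sym j then ins (Sym j) (hat j b) l else 0)"
proof (cases "set l \<subseteq> Sym j")
  case True
  have "ins G (hat j b) l = ins (Sym j) (hat j b) l"
    by (rule ins_set_mono) (use finite_permutations[OF W] Sym_G in \<open>auto simp: hat_def\<close>)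
  then show ?thesis using True by simp
next
  case False
  have "ins G (hat j b) l = 0" by (rule ins_eq_0) (use False in \<open>auto simp: hat_def\<close>)
  then show ?thesis using False by simp
qed

lemma ins_hat_cycle:
  assumes b: "b \<in> cycles V act j k" and l: "l \<noteq> []"
  shows "ins G (hat j b) l = 0"
proof -
  have bc: "b \<in> chains V j k" and bz: "bd act j k b = (\<lambda>_. 0)" using b by (auto simp: cycles_def)
  show ?thesis
  proof (cases "length l = k \<and> set l \<subseteq> Sym j")
    case True
    then have h: "hd l permutes W" using l Sym_W by (cases l) auto
    have "emb j 0 = 0" unfolding emb_def by (rule act_0[OF mor_j])
    then show ?thesis using ins_hat_G[OF bc l] ins_hat[OF chains_V[OF bc] l] True bz \<rho>_0[OF h] by simp
  next
    case False
    show ?thesis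
    proof (cases "set l \<subseteq> Sym j")
      case True
      then have "ins G (hat j b) l = 0" using False hat_supp[OF bc] by (intro ins_eq_0) force
      then show ?thesis .
    qed (use ins_hat_G[OF bc l] in simp)
  qed
qed

end

text \<open>\<open>r\<close> carries the big resolution to that of \<open>Sym (Suc n)\<close>, and
  \<open>s x\<close> carries it to tuples in the coset of elements sending \<open>Suc n\<close> to
  \<open>x\<close>. The map \<open>s x\<close> corrects \<open>r\<close> on the right by a
  transposition, which keeps left equivariance. For \<open>x = Suc n\<close> it is a retraction onto
  \<open>Sym n\<close>.\<close>

lemma ex_coset_retractions:
  assumes "{1..Suc n} \<subseteq> W"
  obtains r s where "\<And>h. h \<in> G \<Longrightarrow> r h \<in> Sym (Suc n)"
    "\<And>g h. g \<in> Sym (Suc n) \<Longrightarrow> h \<in> G \<Longrightarrow> r (g \<circ> h) = g \<circ> r h" "\<And>h. h \<in> Sym (Suc n) \<Longrightarrow> r h = h"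
    "\<And>x h. x \<in> {1..Suc n} \<Longrightarrow> h \<in> G \<Longrightarrow> s x h \<in> Sym (Suc n)"
    "\<And>x h. x \<in> {1..Suc n} \<Longrightarrow> h \<in> G \<Longrightarrow> s x h (Suc n) = x"
    "\<And>g x h. g \<in> Sym (Suc n) \<Longrightarrow> h \<in> G \<Longrightarrow> s (g x) (g \<circ> h) = g \<circ> s x h"
    "\<And>h. h \<in> Sym n \<Longrightarrow> s (Suc n) h = h"
proof -
  obtain r where r: "\<And>h. h permutes W \<Longrightarrow> r h permutes {1..Suc n}"
    "\<And>g h. g permutes {1..Suc n} \<Longrightarrow> h permutes W \<Longrightarrow> r (g \<circ> h) = g \<circ> r h"
    "\<And>h. h permutes {1..Suc n} \<Longrightarrow> r h = h"
    by (rule poly_system.ex_retraction[OF ps assms]) blast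
  define s where "s = (\<lambda>x h. r h \<circ> Transposition.transpose (Suc n) (inv (r h) x))"
  show thesis
  proof (rule that[of r s])
    show "r h \<in> Sym (Suc n)" if "h \<in> G" for h using r(1) that by (simp add: Sym_iff)
    show "r (g \<circ> h) = g \<circ> r h" if "g \<in> Sym (Suc n)" "h \<in> G" for g h using r(2) that by (simp add: Sym_iff)
    show "r h = h" if "h \<in> Sym (Suc n)" for h using r(3) that by (simp add: Sym_iff)
    show "s x h \<in> Sym (Suc n)" "s x h (Suc n) = x" if x: "x \<in> {1..Suc n}" and h: "h \<in> G" for x h
    proof -
      have rh: "r h permutes {1..Suc n}" using r(1) h by simp
      have "inv (r h) x \<in> {1..Suc n}" using permutes_in_image[OF permutes_inv[OF rh]] x by simp
      then show "s x h \<in> Sym (Suc n)" unfolding s_def Sym_iff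
        by (intro permutes_compose[OF permutes_swap_id rh]) auto
      show "s x h (Suc n) = x" unfolding s_def using permutes_inverses(1)[OF rh] by simp
    qed
    show "s (g x) (g \<circ> h) = g \<circ> s x h" if g: "g \<in> Sym (Suc n)" and h: "h \<in> G" for g x h
    proof -
      have g': "g permutes {1..Suc n}" using g by (simp add: Sym_iff)
      have rh: "r h permutes {1..Suc n}" using r(1) h by simp
      have "inv (g \<circ> r h) (g x) = inv (r h) x"
        using o_inv_distrib[OF permutes_bij[OF g'] permutes_bij[OF rh]] permutes_inverses(2)[OF g'] by simp
      then show ?thesis using r(2)[OF g'] h by (simp add: s_def comp_assoc)
    qed
    show "s (Suc n) h = h" if "h \<in> Sym n" for h
    proof -
      have h: "h permutes {1..Suc n}" "h (Suc n) = Suc n" using that Sym_Suc_iff[of h n] by (auto simp: Sym_iff)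
      have "inv h (Suc n) = Suc n" using permutes_inv_eq[OF h(1)] h(2) by simp
      then show ?thesis using r(3)[OF h(1)] by (simp add: s_def)
    qed
  qed
qed

section \<open>Surjectivity and injectivity of stabilization on bar homology\<close>

context
  fixes n assumes n: "{1..Suc n} \<subseteq> W" "m \<le> n" "m \<le> card (W - {1..Suc n})"
begin

lemma n': "{1..n} \<subseteq> W" "m \<le> Suc n"
  using n by auto

lemma sub_subgrp: "U \<subseteq> W \<Longrightarrow> subgrp (sub_img W U)"
  by (rule poly_system.M_subgrp[OF ps])

lemma sub_V: "U \<subseteq> W \<Longrightarrow> v \<in> sub_img W U \<Longrightarrow> v \<in> V W"
  using poly_system.M_sub[OF ps, of U v] sub_img_self[OF W] by simp

lemma bij_G: "g \<in> Sym (Suc n) \<Longrightarrow> bij_betw ((\<circ>) g) G G"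
  by (rule poly_system.bij_X[OF ps Sym_W[OF n(1) n'(2)]])

lemma inj_comp: "g \<in> Sym (Suc n) \<Longrightarrow> inj ((\<circ>) g)"
  using permutes_inj[of g "{1..Suc n}"] by (auto simp: Sym_iff inj_def fun_eq_iff)

lemma emb_incl: "v \<in> V {1..n} \<Longrightarrow> emb (Suc n) (act {1..n} {1..Suc n} id v) = emb n v"
  using act_comp[of "{1..n}" "{1..Suc n}" id W id v] mor_incl[of "{1..Suc n}" "{1..n}"] mor_incl[OF W n(1)]
  unfolding emb_def by auto

text \<open>Relative degree \<open>k\<close>, total length \<open>Suc k\<close>: the cone cycle
  \<open>(hat y, 0)\<close> is the boundary of some \<open>(a, u)\<close>, so \<open>y\<close> is up
  to sign homologous to the sum of the cycles \<open>u x\<close>. Moved to the cosets of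
  \<open>Sym n\<close> and evaluated at tuples based at \<open>id\<close>, only the one for
  \<open>x = Suc n\<close> remains, and it is the stabilization of a cycle of
  \<open>Sym n\<close>.\<close>

lemma hom_surj_poly:
  assumes "2 * k + 2 * e \<le> n + 2"
  shows "hom_surj V act n k"
  unfolding hom_surj_def
proof (rule ballI)
  fix y assume y: "y \<in> cycles V act (Suc n) k"
  note N = n(1) n'(2) and n0 = n'(1) n(2)
  have yc: "y \<in> chains V (Suc n) k" using y by (simp add: cycles_def)
  note yV = chains_V[OF N yc]
  obtain a u where a: "\<And>l. a l \<in> sub_img W {1..Suc n}"
      "\<And>g l. g permutes {1..Suc n} \<Longrightarrow> a (map ((\<circ>) g) l) = \<rho> g (a l)"
    and u: "\<And>l x. u l x \<in> sub_img W ({1..Suc n} - {x})"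
      "\<And>g l x. g permutes {1..Suc n} \<Longrightarrow> u (map ((\<circ>) g) l) (g x) = \<rho> g (u l x)"
    and eq1: "\<And>l. l \<noteq> [] \<Longrightarrow> hat (Suc n) y l = ins G a l + alt (length l) (\<Sum>x\<in>{1..Suc n}. u l x)"
    and eq2: "\<And>l x. l \<noteq> [] \<Longrightarrow> 0 = ins G (\<lambda>l. u l x) l"
  proof (rule poly_system.stable_cone[OF ps n(1), where L = "Suc k" and a = "hat (Suc n) y" and u = "\<lambda>_ _. 0"])
    show "m < card {1..Suc n}" "m \<le> card (W - {1..Suc n})" using n by auto
    show "2 * Suc k + 2 * e \<le> card {1..Suc n} + 3" using assms by simp
    show "hat (Suc n) y l \<noteq> 0 \<Longrightarrow> l \<noteq> [] \<and> set l \<subseteq> G \<and> length l = Suc k" for l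
      using hat_supp[OF N yc, of l] Sym_G[OF N] by blast
    show "hat (Suc n) y l \<in> sub_img W {1..Suc n}" for l by (rule hat_img[OF N yV])
    show "hat (Suc n) y (map ((\<circ>) g) l) = \<rho> g (hat (Suc n) y l)" if "g permutes {1..Suc n}" for g l
      using hat_perm[OF N yV, where g = g and l = l] that by (simp add: Sym_iff)
    show "0 \<in> sub_img W ({1..Suc n} - {x})" for x using n(1) by (intro subgrp_0 sub_subgrp) auto
    show "0 = \<rho> g 0" if "g permutes {1..Suc n}" for g
      using \<rho>_0[OF N Sym_W[OF N, of g]] that by (simp add: Sym_iff)
    show "ins G (hat (Suc n) y) l + alt (length l) (\<Sum>x\<in>{1..Suc n}. 0) = 0" if "l \<noteq> []" for l
      using ins_hat_cycle[OF N y that] by simp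
  qed (use that in auto)
  obtain r s where r: "\<And>h. h \<in> G \<Longrightarrow> r h \<in> Sym (Suc n)"
    "\<And>g h. g \<in> Sym (Suc n) \<Longrightarrow> h \<in> G \<Longrightarrow> r (g \<circ> h) = g \<circ> r h" "\<And>h. h \<in> Sym (Suc n) \<Longrightarrow> r h = h"
    and s: "\<And>x h. x \<in> {1..Suc n} \<Longrightarrow> h \<in> G \<Longrightarrow> s x h \<in> Sym (Suc n)"
    "\<And>x h. x \<in> {1..Suc n} \<Longrightarrow> h \<in> G \<Longrightarrow> s x h (Suc n) = x"
    "\<And>g x h. g \<in> Sym (Suc n) \<Longrightarrow> h \<in> G \<Longrightarrow> s (g x) (g \<circ> h) = g \<circ> s x h"
    "\<And>h. h \<in> Sym n \<Longrightarrow> s (Suc n) h = h"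
    by (rule ex_coset_retractions[OF n(1)]) blast
  have finG: "finite G" by (rule finite_permutations[OF W])
  have rG: "r ` G \<subseteq> Sym (Suc n)" using r(1) by blast
  have sG: "s x ` G \<subseteq> Sym (Suc n)" if "x \<in> {1..Suc n}" for x using s(1)[OF that] by blast
  have "s (Suc n) h \<in> Sym n" if "h \<in> G" for h
    using s(1,2)[OF _ that, of "Suc n"] Sym_Suc_iff[of "s (Suc n) h" n] by simp
  then have sGn: "s (Suc n) ` G \<subseteq> Sym n" by blast
  have Un: "{1..Suc n} - {Suc n} = {1..n}" by (simp add: atLeastAtMostSuc_conv)
  \<comment> \<open>\<open>p x\<close> moves \<open>u x\<close> into the coset of \<open>x\<close>,
    whereas \<open>a\<close> is moved by \<open>r\<close>. The prism \<open>h x\<close> repairs the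
    mismatch, and its boundary is absorbed into that of \<open>\<theta>\<close>.\<close>
  define h where "h = (\<lambda>x l. pris G (s x) r (\<lambda>l. u l x) l)"
  define p where "p = (\<lambda>x l. push_fwd G (s x) (\<lambda>l. u l x) l)"
  define \<theta> where "\<theta> = (\<lambda>l. push_fwd G r a l + alt (Suc k) (\<Sum>x\<in>{1..Suc n}. h x l))"
  have main: "hat (Suc n) y l = ins (Sym (Suc n)) \<theta> l + alt (Suc k) (\<Sum>x\<in>{1..Suc n}. p x l)"
    if l: "l \<noteq> []" "length l = Suc k" for l
  proof -
    have pu: "push_fwd G r (\<lambda>l. u l x) l = p x l + ins (Sym (Suc n)) (h x) l" if x: "x \<in> {1..Suc n}" for x
    proof -
      \<comment> \<open>\<open>u x\<close> is a cycle on nonempty tuples, and the prism sees only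
        these.\<close>
      have "pris G (s x) r (ins G (\<lambda>l. u l x)) l = 0" by (rule pris_eq_0) (use eq2 in simp)
      then show ?thesis
        using pris_ins[OF finG finite_Sym sG[OF x] rG, of "\<lambda>l. u l x" l] by (simp add: h_def p_def algebra_simps)
    qed
    have "hat (Suc n) y l = push_fwd G r (hat (Suc n) y) l"
      by (rule push_fwd_id[symmetric, OF _ Sym_G[OF N] finG r(3) rG]) (use hat_supp[OF N yc] in blast)
    also have "\<dots> = push_fwd G r (\<lambda>l. ins G a l + alt (length l) (\<Sum>x\<in>{1..Suc n}. u l x)) l"
      by (rule push_fwd_cong, rule eq1) (use l in auto)
    also have "\<dots> = push_fwd G r (ins G a) l + alt (Suc k) (\<Sum>x\<in>{1..Suc n}. push_fwd G r (\<lambda>l. u l x) l)"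
      by (simp only: push_fwd_add push_fwd_alt push_fwd_sum l(2))
    also have "(\<Sum>x\<in>{1..Suc n}. push_fwd G r (\<lambda>l. u l x) l) = (\<Sum>x\<in>{1..Suc n}. p x l + ins (Sym (Suc n)) (h x) l)"
      by (rule sum.cong[OF refl pu])
    also have "push_fwd G r (ins G a) l = ins (Sym (Suc n)) (push_fwd G r a) l"
      by (rule push_fwd_ins[OF finG finite_Sym rG, symmetric])
    finally show ?thesis by (simp only: \<theta>_def ins_add ins_alt ins_sum sum.distrib alt_add add_ac)
  qed
  have VW: "additive_on (V W) (\<rho> g)" if "g \<in> Sym (Suc n)" for g using \<rho>_add[OF N Sym_W[OF N that]] .
  have aV: "a l \<in> V W" for l by (rule sub_V[OF n(1) a(1)])
  have uV: "u l x \<in> V W" for l x using sub_V[OF _ u(1)[of l x]] n(1) by blast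
  have p_perm: "p (g x) (map ((\<circ>) g) l) = \<rho> g (p x l)" if g: "g \<in> Sym (Suc n)" for g x l
    unfolding p_def using u(2)[of g] g s(3)[OF g]
    by (intro push_fwd_transport(2)[OF VW[OF g] bij_G[OF g] inj_comp[OF g]] uV) (auto simp: Sym_iff)
  have h_perm: "h (g x) (map ((\<circ>) g) l) = \<rho> g (h x l)" if g: "g \<in> Sym (Suc n)" for g x l
    unfolding h_def using u(2)[of g] g s(3)[OF g] r(2)[OF g]
    by (intro pris_transport(2)[OF VW[OF g] bij_G[OF g] inj_comp[OF g]] uV) (auto simp: Sym_iff)
  have A_perm: "push_fwd G r a (map ((\<circ>) g) l) = \<rho> g (push_fwd G r a l)" if g: "g \<in> Sym (Suc n)" for g l
    using a(2)[of g] g r(2)[OF g]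
    by (intro push_fwd_transport(2)[OF VW[OF g] bij_G[OF g] inj_comp[OF g]] aV) (auto simp: Sym_iff)
  have \<theta>_M: "- \<theta> l \<in> sub_img W {1..Suc n}" for l
  proof -
    note S = sub_subgrp[OF n(1)]
    have "u l x \<in> sub_img W {1..Suc n}" for l x
      using u(1)[of l x] poly_system.M_mono[OF ps, of "{1..Suc n} - {x}" "{1..Suc n}"] n(1) by blast
    then have "h x l \<in> sub_img W {1..Suc n}" for x l unfolding h_def by (intro pris_closed[OF S])
    then show ?thesis unfolding \<theta>_def
      by (intro subgrp_uminus[OF S] subgrp_add[OF S] subgrp_alt[OF S] subgrp_sum[OF S] push_fwd_closed[OF S] a(1))
  qed
  have \<theta>_perm: "- \<theta> (map ((\<circ>) g) l) = \<rho> g (- \<theta> l)" if g: "g \<in> Sym (Suc n)" for g l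
  proof -
    have S: "subgrp (V W)" by (rule V_subgrp[OF W])
    have hV: "h x l \<in> V W" for x unfolding h_def by (rule pris_closed[OF S]) (rule uV)
    have AV: "push_fwd G r a l \<in> V W" by (rule push_fwd_closed[OF S aV])
    have sV: "(\<Sum>x\<in>{1..Suc n}. h x l) \<in> V W" by (rule subgrp_sum[OF S hV])
    have "bij_betw g {1..Suc n} {1..Suc n}" using g unfolding Sym_iff by (rule permutes_imp_bij)
    then have "(\<Sum>x\<in>{1..Suc n}. h x (map ((\<circ>) g) l)) = (\<Sum>x\<in>{1..Suc n}. h (g x) (map ((\<circ>) g) l))"
      by (rule sum.reindex_bij_betw[symmetric])
    also have "\<dots> = \<rho> g (\<Sum>x\<in>{1..Suc n}. h x l)"
      by (simp only: h_perm[OF g] additive_on_sum[OF VW[OF g] hV])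
    finally show ?thesis
      unfolding \<theta>_def A_perm[OF g] using AV sV
      by (simp add: additive_on_uminus[OF VW[OF g]] additive_on_add[OF VW[OF g]] additive_on_diff[OF VW[OF g]]
          additive_on_alt[OF VW[OF g]] subgrp_alt[OF S] subgrp_add[OF S] subgrp_uminus[OF S] del: alt_simps(2))
  qed
  define \<xi> where "\<xi> = (\<lambda>l. alt (Suc k) (p (Suc n) l))"
  have \<xi>_M: "\<xi> l \<in> sub_img W {1..n}" for l
    unfolding \<xi>_def p_def using u(1)[of _ "Suc n"] unfolding Un
    by (intro subgrp_alt push_fwd_closed sub_subgrp n0)
  have \<xi>_perm: "\<xi> (map ((\<circ>) g) l) = \<rho> g (\<xi> l)" if g: "g \<in> Sym n" for g l
  proof -
    have g': "g \<in> Sym (Suc n)" "g (Suc n) = Suc n" using g Sym_Suc_iff[of g n] by auto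
    have "p (Suc n) l \<in> V W" unfolding p_def by (rule push_fwd_closed[OF V_subgrp[OF W] uV])
    then show ?thesis unfolding \<xi>_def using p_perm[OF g'(1), of "Suc n" l] g'(2)
      by (simp only: additive_on_alt[OF VW[OF g'(1)]])
  qed
  have \<xi>_0: "\<xi> l = 0" if "\<not> set l \<subseteq> Sym n" for l
    using push_fwd_supp[of G "s (Suc n)" "\<lambda>l. u l (Suc n)" l] sGn that unfolding \<xi>_def p_def by fastforce
  define x where "x = unhat n k \<xi>"
  note xc = unhat_chain[OF n0, where f = \<xi> and k = k, OF \<xi>_M, folded x_def]
  have "bd act n k x hs = 0" for hs
  proof (cases "\<exists>k'. k = Suc k' \<and> hs \<in> tuples n k'")
    case True
    then obtain k' where k': "k = Suc k'" "hs \<in> tuples n k'" by blast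
    note pp = path_props[OF Sym_id, of hs n]
    have ph: "path id hs \<noteq> []" "set (path id hs) \<subseteq> Sym n" "length (path id hs) = k" using pp k' by (auto simp: tuples_iff)
    have "emb n (bd act n k x hs) = ins (Sym n) (hat n x) (path id hs)"
      unfolding k'(1) by (rule emb_bd[OF n0 _ k'(2)]) (rule xc(2))
    also have "\<dots> = ins (Sym n) \<xi> (path id hs)"
      unfolding x_def by (rule ins_cong, rule hat_unhat[OF n0, where f = \<xi>, OF \<xi>_M \<xi>_perm]) (use ph in auto)
    also have "\<dots> = alt (Suc k) (push_fwd G (s (Suc n)) (ins G (\<lambda>l. u l (Suc n))) (path id hs))"
      unfolding \<xi>_def p_def ins_alt push_fwd_ins[OF finG finite_Sym sGn] ..
    also have "push_fwd G (s (Suc n)) (ins G (\<lambda>l. u l (Suc n))) (path id hs) = 0"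
      by (rule push_fwd_eq_0, rule eq2[symmetric]) (use ph in auto)
    finally have "emb n (bd act n k x hs) = emb n 0"
      using additive_on_0[OF emb_additive[OF n0]] by simp
    moreover have "0 \<in> V {1..n}" by (rule subgrp_0[OF V_subgrp]) simp
    ultimately show ?thesis using emb_inj[OF n0] bd_V[OF n0, where b = x and k = k' and hs = hs, OF xc(2)] k'(1) by (auto dest: inj_onD)
  next
    case False
    then show ?thesis by (cases k) (auto simp: bd_def)
  qed
  then have x_cyc: "x \<in> cycles V act n k" using xc(1) by (simp add: cycles_def fun_eq_iff)
  \<comment> \<open>The minus sign is due to \<open>hom_surj\<close> asking for
    \<open>push x - y\<close> rather than \<open>y - push x\<close> as a boundary.\<close>
  define z where "z = unhat (Suc n) (Suc k) (\<lambda>l. - \<theta> l)"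
  note zc = unhat_chain[OF N, where f = "\<lambda>l. - \<theta> l" and k = "Suc k", OF \<theta>_M, folded z_def]
  have mor_incl_n: "FI_mor {1..n} {1..Suc n} id" by (auto simp: FI_mor_def)
  have "push act n x gs - y gs = bd act (Suc n) (Suc k) z gs" for gs
  proof (cases "gs \<in> tuples (Suc n) k")
    case True
    note pp = path_props[OF Sym_id, of gs "Suc n"]
    have ph: "path id gs \<noteq> []" "set (path id gs) \<subseteq> Sym (Suc n)" "length (path id gs) = Suc k"
      "ratios (path id gs) = gs" "hd (path id gs) = id" using pp True by (auto simp: tuples_iff)
    have "emb (Suc n) (bd act (Suc n) (Suc k) z gs) = ins (Sym (Suc n)) (hat (Suc n) z) (path id gs)"
      by (rule emb_bd[OF N _ True]) (rule zc(2))
    also have "\<dots> = ins (Sym (Suc n)) (\<lambda>l. - \<theta> l) (path id gs)"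
      unfolding z_def by (rule ins_cong, rule hat_unhat[OF N, where f = "\<lambda>l. - \<theta> l", OF \<theta>_M \<theta>_perm]) (use ph in auto)
    also have "\<dots> = alt (Suc k) (\<Sum>x\<in>{1..Suc n}. p x (path id gs)) - hat (Suc n) y (path id gs)"
      unfolding main[OF ph(1,3)] ins_uminus by simp
    also have "hat (Suc n) y (path id gs) = emb (Suc n) (y gs)"
      using ph by (simp add: hat_def \<rho>_id[OF N emb_W[OF N yV]])
    \<comment> \<open>\<open>p x\<close> is supported on tuples whose entries send
      \<open>Suc n\<close> to \<open>x\<close>, and the tuple at hand contains
      \<open>id\<close>.\<close>
    also have "(\<Sum>x\<in>{1..Suc n}. p x (path id gs)) = (\<Sum>x\<in>{1..Suc n}. if x = Suc n then p (Suc n) (path id gs) else 0)"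
    proof (rule sum.cong[OF refl])
      fix x assume x: "x \<in> {1..Suc n}"
      show "p x (path id gs) = (if x = Suc n then p (Suc n) (path id gs) else 0)"
      proof (cases "x = Suc n")
        case False
        have "p x (path id gs) = 0"
        proof (rule ccontr)
          assume "p x (path id gs) \<noteq> 0"
          then have "set (path id gs) \<subseteq> s x ` G" unfolding p_def by (rule push_fwd_supp)
          moreover have "id \<in> set (path id gs)" using ph(1,5) hd_in_set by metis
          ultimately obtain g where "g \<in> G" "id = s x g" by blast
          then show False using s(2)[OF x, of g] False by (metis id_apply)
        qed
        then show ?thesis using False by simp
      qed simp
    qed
    also have "alt (Suc k) \<dots> = \<xi> (path id gs)" by (simp add: \<xi>_def)
    also have "\<xi> (path id gs) = emb (Suc n) (push act n x gs)"
    proof (cases "set gs \<subseteq> Sym n")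
      case n: True
      then have "gs \<in> tuples n k" "gs \<in> tuples n (length gs)" using True by (auto simp: tuples_iff)
      then show ?thesis using emb_incl[OF xc(2)] xc(3) by (simp add: push_def)
    next
      case False
      have "\<not> set (path id gs) \<subseteq> Sym n"
        using ratios_props(1)[OF ph(1), of n] ph(4) False by auto
      then have "\<xi> (path id gs) = 0" by (rule \<xi>_0)
      moreover have "push act n x gs = 0" using False by (simp add: push_def tuples_iff)
      ultimately show ?thesis using additive_on_0[OF emb_additive[OF N]] by simp
    qed
    finally have eq: "emb (Suc n) (bd act (Suc n) (Suc k) z gs) = emb (Suc n) (push act n x gs) - emb (Suc n) (y gs)" .
    have pV: "push act n x gs \<in> V {1..Suc n}"
      using act_V[OF mor_incl_n xc(2)] subgrp_0[OF V_subgrp, of "{1..Suc n}"] by (simp add: push_def)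
    have dV: "push act n x gs - y gs \<in> V {1..Suc n}" by (rule subgrp_diff[OF V_subgrp pV yV]) simp
    have "emb (Suc n) (push act n x gs - y gs) = emb (Suc n) (bd act (Suc n) (Suc k) z gs)"
      using eq additive_on_diff[OF emb_additive[OF N] pV yV, of gs] by simp
    then show ?thesis
      by (rule inj_onD[OF emb_inj[OF N] _ dV bd_V[OF N, where b = z and k = k and hs = gs, OF zc(2)]])
  next
    case False
    have "push act n x gs = 0"
    proof (cases "gs \<in> tuples n (length gs)")
      case True
      then have "gs \<notin> tuples n k" using False Sym_Suc_iff[of _ n] by (auto simp: tuples_iff)
      then have "x gs = 0" by (simp add: x_def unhat_def)
      then show ?thesis using act_0[OF mor_incl_n] by (simp add: push_def)
    qed (simp add: push_def)
    moreover have "y gs = 0" using yc False by (auto simp: chains_def)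
    ultimately show ?thesis using False by (simp add: bd_def)
  qed
  then have "(\<lambda>gs. push act n x gs - y gs) \<in> boundaries V act (Suc n) k"
    unfolding boundaries_def using zc(1) by (auto simp: fun_eq_iff image_iff)
  then show "\<exists>x\<in>cycles V act n k. (\<lambda>gs. push act n x gs - y gs) \<in> boundaries V act (Suc n) k"
    using x_cyc by blast
qed

text \<open>Relative degree \<open>k + 1\<close>: from \<open>push x = bd z\<close>, the homogenized
  \<open>z\<close> and a coset version of \<open>x\<close> form a cone cycle. Its filling writes the
  latter as a boundary over each letter; at the letter \<open>Suc n\<close>, moved into
  \<open>Sym n\<close>, this makes \<open>x\<close> a boundary.\<close>

lemma hom_inj_poly:
  assumes "2 * k + 2 * e \<le> n"
  shows "hom_inj V act n k"
  unfolding hom_inj_def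
proof (intro ballI impI)
  fix x assume x: "x \<in> cycles V act n k" and bx: "push act n x \<in> boundaries V act (Suc n) k"
  note N = n(1) n'(2) and n0 = n'(1) n(2)
  have xc: "x \<in> chains V n k" using x by (simp add: cycles_def)
  note xV = chains_V[OF n0 xc]
  obtain z where zc: "z \<in> chains V (Suc n) (Suc k)" and z: "push act n x = bd act (Suc n) (Suc k) z"
    using bx by (auto simp: boundaries_def)
  note zV = chains_V[OF N zc]
  have finG: "finite G" by (rule finite_permutations[OF W])
  have Un: "{1..Suc n} - {Suc n} = {1..n}" by (simp add: atLeastAtMostSuc_conv)
  \<comment> \<open>\<open>x\<close> induced up to \<open>Sym (Suc n)\<close>: at the letter
    \<open>y\<close> it lives on tuples in the single coset of elements sending \<open>Suc n\<close>
    to \<open>y\<close>. Its sum over \<open>y\<close> is the homogenized push-forward, by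
    \<open>sum_xh\<close>.\<close>
  define xh where "xh = (\<lambda>l y. if l \<noteq> [] \<and> set l \<subseteq> Sym (Suc n) \<and> (\<forall>g\<in>set l. g (Suc n) = y)
      then \<rho> (hd l) (emb n (x (ratios l))) else 0)"
  have xh_N: "xh l (Suc n) = hat n x l" for l
  proof -
    have "set l \<subseteq> Sym n \<longleftrightarrow> set l \<subseteq> Sym (Suc n) \<and> (\<forall>g\<in>set l. g (Suc n) = Suc n)"
      using Sym_Suc_iff[of _ n] by blast
    then show ?thesis unfolding xh_def hat_def by presburger
  qed
  have emb0: "emb n 0 = 0" by (rule additive_on_0[OF emb_additive[OF n0]])
  have hdl: "hd l \<in> Sym (Suc n)" if "l \<noteq> []" "set l \<subseteq> Sym (Suc n)" for l using that by (cases l) auto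
  have xh_supp: "l \<noteq> [] \<and> set l \<subseteq> Sym (Suc n) \<and> y \<in> {1..Suc n} \<and> length l = Suc k \<and> (\<forall>g\<in>set l. g (Suc n) = y)"
    if nz: "xh l y \<noteq> 0" for l y
  proof -
    have l: "l \<noteq> []" "set l \<subseteq> Sym (Suc n)" "\<forall>g\<in>set l. g (Suc n) = y"
      using nz unfolding xh_def by presburger+
    have "hd l (Suc n) = y" using l(1,3) by simp
    then have y: "y \<in> {1..Suc n}"
      using permutes_in_image[of "hd l" "{1..Suc n}" "Suc n"] hdl[OF l(1,2)] by (simp add: Sym_iff)
    have "length l = Suc k"
    proof (rule ccontr)
      assume "length l \<noteq> Suc k"
      then have "ratios l \<notin> tuples n k" using ratios_props(2)[OF l(1,2)] by (auto simp: tuples_iff)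
      then have "x (ratios l) = 0" using xc by (auto simp: chains_def)
      moreover have "xh l y = \<rho> (hd l) (emb n (x (ratios l)))" using l unfolding xh_def by presburger
      ultimately show False using nz emb0 \<rho>_0[OF N Sym_W[OF N hdl[OF l(1,2)]]] by simp
    qed
    then show ?thesis using l y by blast
  qed
  have xh_M: "xh l y \<in> sub_img W ({1..Suc n} - {y})" for l y
  proof (cases "xh l y = 0")
    case True
    then show ?thesis using n(1) by (auto intro!: subgrp_0 sub_subgrp)
  next
    case False
    note l = xh_supp[OF False]
    have g: "hd l permutes {1..Suc n}" "hd l (Suc n) = y" using hdl l by (auto simp: Sym_iff)
    have "hd l ` ({1..Suc n} - {Suc n}) = hd l ` {1..Suc n} - hd l ` {Suc n}"
      by (rule image_set_diff[OF permutes_inj[OF g(1)]])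
    then have im: "hd l ` {1..n} = {1..Suc n} - {y}" unfolding Un permutes_image[OF g(1)] by (simp add: g(2))
    have gW: "hd l permutes W" using Sym_W[OF N] hdl l by blast
    have "\<rho> (hd l) (emb n (x (ratios l))) \<in> sub_img W (hd l ` {1..n})"
      by (rule poly_system.\<rho>_M[OF ps gW n0(1) emb_img[OF n0 xV]])
    moreover have "xh l y = \<rho> (hd l) (emb n (x (ratios l)))" using l unfolding xh_def by presburger
    ultimately show ?thesis unfolding im by simp
  qed
  have xh_perm: "xh (map ((\<circ>) g) l) (g y) = \<rho> g (xh l y)" if g: "g \<in> Sym (Suc n)" for g l y
  proof -
    have sub: "set (map ((\<circ>) g) l) \<subseteq> Sym (Suc n) \<longleftrightarrow> set l \<subseteq> Sym (Suc n)"
      using Sym_comp_iff[OF g] by auto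
    have "inj g" using g permutes_inj unfolding Sym_iff by blast
    then have eq: "(\<forall>h\<in>set (map ((\<circ>) g) l). h (Suc n) = g y) \<longleftrightarrow> (\<forall>h\<in>set l. h (Suc n) = y)"
      by (auto simp: inj_eq)
    show ?thesis
    proof (cases "l \<noteq> [] \<and> set l \<subseteq> Sym (Suc n) \<and> (\<forall>g\<in>set l. g (Suc n) = y)")
      case True
      have h: "hd (map ((\<circ>) g) l) = g \<circ> hd l" using True by (cases l) auto
      have "xh (map ((\<circ>) g) l) (g y) = \<rho> (g \<circ> hd l) (emb n (x (ratios l)))"
        using True sub eq h ratios_map[OF g, of l] unfolding xh_def by simp
      also have "\<dots> = \<rho> g (\<rho> (hd l) (emb n (x (ratios l))))"
        using True hdl[of l] by (intro \<rho>_comp[OF N] Sym_W[OF N] g emb_W[OF n0 xV]) auto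
      also have "\<rho> (hd l) (emb n (x (ratios l))) = xh l y" using True unfolding xh_def by presburger
      finally show ?thesis .
    next
      case False
      have "xh l y = 0" using False unfolding xh_def by presburger
      moreover have "xh (map ((\<circ>) g) l) (g y) = 0"
        using False sub eq unfolding xh_def by auto
      ultimately show ?thesis using \<rho>_0[OF N Sym_W[OF N g]] by simp
    qed
  qed
  have VW: "additive_on (V W) (\<rho> g)" if "g \<in> Sym (Suc n)" for g using \<rho>_add[OF N Sym_W[OF N that]] .
  have xhV: "xh l y \<in> V W" for l y using sub_V[OF _ xh_M[of l y]] n(1) by blast
  \<comment> \<open>The sign solves the cone condition against \<open>hat (Suc n) z\<close> on
    tuples of length \<open>Suc k\<close>.\<close>
  define w where "w = (\<lambda>l y. - alt (Suc k) (xh l y))"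
  have sum_xh: "(\<Sum>y\<in>{1..Suc n}. xh l y) = \<rho> (hd l) (emb (Suc n) (push act n x (ratios l)))"
    if l: "l \<noteq> []" "set l \<subseteq> Sym (Suc n)" for l
  proof (cases "\<forall>g\<in>set l. g (Suc n) = hd l (Suc n)")
    case True
    let ?y = "hd l (Suc n)"
    have hdin: "hd l \<in> set l" using l(1) by simp
    have y: "?y \<in> {1..Suc n}"
      using permutes_in_image[of "hd l" "{1..Suc n}" "Suc n"] hdl[OF l] by (simp add: Sym_iff)
    have "xh l y = (if y = ?y then xh l ?y else 0)" for y using hdin unfolding xh_def by auto
    then have "(\<Sum>y\<in>{1..Suc n}. xh l y) = (\<Sum>y\<in>{1..Suc n}. if y = ?y then xh l ?y else 0)"
      by (rule sum.cong[OF refl])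
    also have "\<dots> = xh l ?y" using y by (simp only: sum.delta finite_atLeastAtMost if_True)
    also have "\<dots> = \<rho> (hd l) (emb n (x (ratios l)))" using l True unfolding xh_def by presburger
    also have "emb n (x (ratios l)) = emb (Suc n) (push act n x (ratios l))"
      using ratios_Sym[OF l] True emb_incl[OF xV] by (simp add: push_def tuples_iff)
    finally show ?thesis .
  next
    case False
    have "xh l y = 0" for y
    proof (rule ccontr)
      assume "xh l y \<noteq> 0"
      then have "\<forall>g\<in>set l. g (Suc n) = y" "hd l \<in> set l" using xh_supp l(1) by auto
      then show False using False by metis
    qed
    moreover have "push act n x (ratios l) = 0" using ratios_Sym[OF l] False by (simp add: push_def tuples_iff)
    moreover have "emb (Suc n) 0 = 0" by (rule additive_on_0[OF emb_additive[OF N]])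
    ultimately show ?thesis using \<rho>_0[OF N Sym_W[OF N hdl[OF l]]] by simp
  qed
  obtain a u where u: "\<And>l y. u l y \<in> sub_img W ({1..Suc n} - {y})"
      "\<And>g l y. g permutes {1..Suc n} \<Longrightarrow> u (map ((\<circ>) g) l) (g y) = \<rho> g (u l y)"
    and eq2: "\<And>l y. l \<noteq> [] \<Longrightarrow> w l y = ins G (\<lambda>l. u l y) l"
  proof (rule poly_system.stable_cone[OF ps n(1), where L = "Suc (Suc k)" and a = "hat (Suc n) z" and u = w])
    show "m < card {1..Suc n}" "m \<le> card (W - {1..Suc n})" using n by auto
    show "2 * Suc (Suc k) + 2 * e \<le> card {1..Suc n} + 3" using assms by simp
    show "hat (Suc n) z l \<noteq> 0 \<Longrightarrow> l \<noteq> [] \<and> set l \<subseteq> G \<and> length l = Suc (Suc k)" for l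
      using hat_supp[OF N zc, of l] Sym_G[OF N] by blast
    show "hat (Suc n) z l \<in> sub_img W {1..Suc n}" for l by (rule hat_img[OF N zV])
    show "hat (Suc n) z (map ((\<circ>) g) l) = \<rho> g (hat (Suc n) z l)" if "g permutes {1..Suc n}" for g l
      using hat_perm[OF N zV, where g = g and l = l] that by (simp add: Sym_iff)
    show "w l y \<noteq> 0 \<Longrightarrow> l \<noteq> [] \<and> set l \<subseteq> G \<and> y \<in> {1..Suc n} \<and> Suc (length l) = Suc (Suc k)" for l y
      using xh_supp[of l y] Sym_G[OF N] unfolding w_def by auto
    show "w l y \<in> sub_img W ({1..Suc n} - {y})" for l y
      unfolding w_def using n(1) by (intro subgrp_uminus subgrp_alt sub_subgrp xh_M) auto
    show "w (map ((\<circ>) g) l) (g y) = \<rho> g (w l y)" if "g permutes {1..Suc n}" for g l y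
    proof -
      have g: "g \<in> Sym (Suc n)" using that by (simp add: Sym_iff)
      show ?thesis unfolding w_def xh_perm[OF g]
        using additive_on_uminus[OF VW[OF g] subgrp_alt[OF V_subgrp[OF W] xhV]] additive_on_alt[OF VW[OF g] xhV] by simp
    qed
    show "ins G (hat (Suc n) z) l + alt (length l) (\<Sum>y\<in>{1..Suc n}. w l y) = 0" if l: "l \<noteq> []" for l
    proof (cases "set l \<subseteq> Sym (Suc n) \<and> length l = Suc k")
      case True
      have "ins G (hat (Suc n) z) l = \<rho> (hd l) (emb (Suc n) (push act n x (ratios l)))"
        using ins_hat_G[OF N zc l] ins_hat[OF N zV l] True z by simp
      moreover have "(\<Sum>y\<in>{1..Suc n}. w l y) = - alt (Suc k) (\<Sum>y\<in>{1..Suc n}. xh l y)"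
        unfolding w_def by (simp only: sum_negf alt_sum)
      ultimately show ?thesis using sum_xh[OF l] True by simp
    next
      case False
      have "ins G (hat (Suc n) z) l = 0"
      proof (rule ins_eq_0, rule ccontr)
        fix g l' assume "set l' = insert g (set l)" "length l' = Suc (length l)" "hat (Suc n) z l' \<noteq> 0"
        then show False using hat_supp[OF N zc, of l'] False by auto
      qed
      moreover have "w l y = 0" for y using xh_supp[of l y] False unfolding w_def by auto
      ultimately show ?thesis by simp
    qed
    show "ins G (\<lambda>l. w l y) l = 0" if l: "l \<noteq> []" for l y
    proof (cases "y \<in> {1..Suc n}")
      case False
      have "w l y = 0" for l using xh_supp[of l y] False unfolding w_def by auto
      then show ?thesis by simp
    next
      case True
      \<comment> \<open>Translation by an element taking the letter \<open>y\<close> to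
        \<open>Suc n\<close> reduces the claim to \<open>hat n x\<close>, where \<open>x\<close> is
        a cycle.\<close>
      define g where "g = Transposition.transpose y (Suc n)"
      have g: "g \<in> Sym (Suc n)" unfolding g_def Sym_iff using True by (intro permutes_swap_id) auto
      have gy: "g y = Suc n" by (simp add: g_def)
      have "ins G (hat n x) (map ((\<circ>) g) l) = 0" using l by (intro ins_hat_cycle[OF n0 x]) simp
      then have "ins G (\<lambda>l. hat n x (map ((\<circ>) g) l)) l = 0" unfolding ins_map[OF bij_G[OF g]] .
      moreover have "hat n x (map ((\<circ>) g) l) = \<rho> g (xh l y)" for l
        using xh_perm[OF g, of l y] unfolding gy xh_N .
      ultimately have "ins G (\<lambda>l. \<rho> g (xh l y)) l = 0" by simp
      then have "\<rho> g (ins G (\<lambda>l. xh l y) l) = 0"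
        using ins_additive[OF VW[OF g], where l = l and X = G and c = "\<lambda>l. xh l y"] xhV by simp
      moreover have "ins G (\<lambda>l. xh l y) l \<in> V W" by (rule ins_closed[OF V_subgrp[OF W] xhV])
      ultimately have "ins G (\<lambda>l. xh l y) l = 0"
        using poly_system.\<rho>_eq_0[OF ps Sym_W[OF N g]] sub_img_self[OF W] by simp
      then show ?thesis unfolding w_def ins_uminus ins_alt by simp
    qed
  qed (use that in blast)
  obtain r s where s: "\<And>x h. x \<in> {1..Suc n} \<Longrightarrow> h \<in> G \<Longrightarrow> s x h \<in> Sym (Suc n)"
    "\<And>x h. x \<in> {1..Suc n} \<Longrightarrow> h \<in> G \<Longrightarrow> s x h (Suc n) = x"
    "\<And>g x h. g \<in> Sym (Suc n) \<Longrightarrow> h \<in> G \<Longrightarrow> s (g x) (g \<circ> h) = g \<circ> s x h"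
    "\<And>h. h \<in> Sym n \<Longrightarrow> s (Suc n) h = h"
    by (rule ex_coset_retractions[OF n(1)]) blast
  have "s (Suc n) h \<in> Sym n" if "h \<in> G" for h
    using s(1,2)[OF _ that, of "Suc n"] Sym_Suc_iff[of "s (Suc n) h" n] by simp
  then have sGn: "s (Suc n) ` G \<subseteq> Sym n" by blast
  have uV: "u l y \<in> V W" for l y using sub_V[OF _ u(1)[of l y]] n(1) by blast
  \<comment> \<open>The same sign as in \<open>w\<close>, so that the two cancel in the
    boundary.\<close>
  define \<xi> where "\<xi> = (\<lambda>l. - alt (Suc k) (push_fwd G (s (Suc n)) (\<lambda>l. u l (Suc n)) l))"
  have \<xi>_M: "\<xi> l \<in> sub_img W {1..n}" for l
    unfolding \<xi>_def using u(1)[of _ "Suc n"] unfolding Un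
    by (intro subgrp_uminus subgrp_alt push_fwd_closed sub_subgrp n0)
  have \<xi>_perm: "\<xi> (map ((\<circ>) g) l) = \<rho> g (\<xi> l)" if g: "g \<in> Sym n" for g l
  proof -
    have g': "g \<in> Sym (Suc n)" "g (Suc n) = Suc n" using g Sym_Suc_iff[of g n] by auto
    have pV: "push_fwd G (s (Suc n)) (\<lambda>l. u l (Suc n)) l \<in> V W" by (rule push_fwd_closed[OF V_subgrp[OF W] uV])
    have "push_fwd G (s (Suc n)) (\<lambda>l. u l (Suc n)) (map ((\<circ>) g) l) = \<rho> g (push_fwd G (s (Suc n)) (\<lambda>l. u l (Suc n)) l)"
      using u(2)[of g _ "Suc n"] g' s(3)[OF g'(1), of _ "Suc n"]
      by (intro push_fwd_transport(2)[OF VW[OF g'(1)] bij_G[OF g'(1)] inj_comp[OF g'(1)]] uV) (auto simp: Sym_iff)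
    then show ?thesis unfolding \<xi>_def
      by (simp only: additive_on_uminus[OF VW[OF g'(1)] subgrp_alt[OF V_subgrp[OF W] pV]] additive_on_alt[OF VW[OF g'(1)] pV])
  qed
  define t where "t = unhat n (Suc k) \<xi>"
  note tc = unhat_chain[OF n0, where f = \<xi> and k = "Suc k", OF \<xi>_M, folded t_def]
  have "bd act n (Suc k) t hs = x hs" for hs
  proof (cases "hs \<in> tuples n k")
    case True
    note pp = path_props[OF Sym_id, of hs n]
    have ph: "path id hs \<noteq> []" "set (path id hs) \<subseteq> Sym n" "length (path id hs) = Suc k"
      "ratios (path id hs) = hs" "hd (path id hs) = id" using pp True by (auto simp: tuples_iff)
    have "emb n (bd act n (Suc k) t hs) = ins (Sym n) (hat n t) (path id hs)"
      by (rule emb_bd[OF n0 _ True]) (rule tc(2))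
    also have "\<dots> = ins (Sym n) \<xi> (path id hs)"
      unfolding t_def by (rule ins_cong, rule hat_unhat[OF n0, where f = \<xi>, OF \<xi>_M \<xi>_perm]) (use ph in auto)
    also have "\<dots> = - alt (Suc k) (push_fwd G (s (Suc n)) (ins G (\<lambda>l. u l (Suc n))) (path id hs))"
      unfolding \<xi>_def ins_uminus ins_alt push_fwd_ins[OF finG finite_Sym sGn] ..
    also have "push_fwd G (s (Suc n)) (ins G (\<lambda>l. u l (Suc n))) (path id hs) =
        push_fwd G (s (Suc n)) (\<lambda>l. 0 - alt (Suc k) (hat n x l)) (path id hs)"
    proof (rule push_fwd_cong)
      fix l :: "(nat \<Rightarrow> nat) list" assume "length l = length (path id hs)"
      then have "l \<noteq> []" using ph by auto
      then show "ins G (\<lambda>l. u l (Suc n)) l = 0 - alt (Suc k) (hat n x l)"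
        using eq2[of l "Suc n"] by (simp add: w_def xh_N)
    qed
    also have "\<dots> = - alt (Suc k) (push_fwd G (s (Suc n)) (hat n x) (path id hs))"
    proof -
      have "push_fwd G (s (Suc n)) (\<lambda>l. alt (Suc k) (hat n x l)) (path id hs) =
        push_fwd G (s (Suc n)) (\<lambda>l. alt (length l) (hat n x l)) (path id hs)"
        by (rule push_fwd_cong) (simp add: ph)
      then show ?thesis
        using push_fwd_diff[of G "s (Suc n)" "\<lambda>_. 0" "\<lambda>l. alt (Suc k) (hat n x l)" "path id hs"]
        by (simp only: push_fwd_alt ph(3) push_fwd_zero diff_0)
    qed
    also have "push_fwd G (s (Suc n)) (hat n x) (path id hs) = hat n x (path id hs)"
      by (rule push_fwd_id[OF _ Sym_G[OF n0] finG s(4) sGn]) (use hat_supp[OF n0 xc] in blast)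
    also have "hat n x (path id hs) = emb n (x hs)"
      using ph by (simp add: hat_def \<rho>_id[OF n0 emb_W[OF n0 xV]])
    finally have "emb n (bd act n (Suc k) t hs) = emb n (x hs)" by simp
    then show ?thesis
      by (rule inj_onD[OF emb_inj[OF n0] _ bd_V[OF n0, where b = t and k = k and hs = hs, OF tc(2)] xV])
  next
    case False
    then show ?thesis using xc by (simp add: bd_def chains_def)
  qed
  then have "bd act n (Suc k) t = x" by (rule ext)
  then show "x \<in> boundaries V act n k" unfolding boundaries_def using tc(1) by blast
qed

end

end

theorem theoremA:
  fixes scale :: "'k::comm_ring_1 \<Rightarrow> 'b::ab_group_add \<Rightarrow> 'b"
    and V :: "nat set \<Rightarrow> 'b set"
    and act :: "nat set \<Rightarrow> nat set \<Rightarrow> (nat \<Rightarrow> nat) \<Rightarrow> 'b \<Rightarrow> 'b"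
    and d m :: int and k n :: nat
  assumes "fi_module scale V act"
    and "polynomial_fi V act d m"
    and "m \<ge> 0"
  shows "(int n \<ge> max m (2 * int k + 2 * d + 2) \<longrightarrow> hom_iso V act n k)
       \<and> (int n \<ge> max m (2 * int k + 2 * d) \<longrightarrow> hom_surj V act n k)"
proof -
  define e where "e = nat (d + 1)"
  define m' where "m' = nat m"
  \<comment> \<open>\<open>m'\<close> spare points beyond the larger of the two sets compared, one
    for each shift in \<open>stability\<close>.\<close>
  define W where "W = {1..Suc n + m'}"
  have d: "int e = d + 1" and m: "int m' = m"
    using assms(2,3) by (auto simp: polynomial_fi_def e_def m'_def)
  interpret fi_mod scale V act by unfold_locales (rule assms(1))
  interpret fi_poly scale V act m' e W
    by unfold_locales (use assms(2) m in \<open>simp_all add: polynomial_fi_def e_def W_def\<close>)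
  have W: "{1..Suc n} \<subseteq> W" "m' \<le> card (W - {1..Suc n})"
  proof -
    show "{1..Suc n} \<subseteq> W" by (auto simp: W_def)
    have "W - {1..Suc n} = {Suc (Suc n)..Suc n + m'}" by (auto simp: W_def)
    then show "m' \<le> card (W - {1..Suc n})" by simp
  qed
  have surj: "hom_surj V act n k" if "int n \<ge> max m (2 * int k + 2 * d)"
    by (rule hom_surj_poly[OF W(1) _ W(2)]) (use that d m in auto)
  have inj: "hom_inj V act n k" if "int n \<ge> max m (2 * int k + 2 * d + 2)"
    by (rule hom_inj_poly[OF W(1) _ W(2)]) (use that d m in auto)
  show ?thesis using surj inj by (auto simp: hom_iso_def)
qed

end
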